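(* Let $G$ act on a group $K$ by automorphisms, let $d\colon G\to K$ be a derivation relative to this action, and let $s_d\colon G\to K\rtimes G$, $s_d(g)=(d(g),g)$, be the corresponding splitting. Let $\pi_d\colon \widetilde{B(K\rtimes G)}_{\mathrm{Im}(s_d)}\to B(K\rtimes G)$ be the covering projection determined by the subgroup $s_d(G)\le K\rtimes G=\pi_1(B(K\rtimes G))$. Then: (1) $\pi_d$ is the covering projection over $B(K\rtimes G)$ whose fibre is the group $K$, viewed as a $(K\rtimes G)$-set with action given by $(k,g)\cdot k':=k+g\cdot k'-d(g)$. (2) $\mathrm{tc}(d)=\mathrm{secat}(\pi_d)$.
   Context: All groups are discrete; $G$ is written multiplicatively and $K$ additively (even though $K$ need not be abelian). If $G$ acts on $K$ by automorphisms, $(g,k)\mapsto g\cdot k$, the semi-direct product $K\rtimes G$ is the set $K\times G$ with $(k,g)(k',g')=(k+g\cdot k',gg')$, with projection $p\colon K\rtimes G\to G$, $p(k,g)=g$. A derivation is a function $d\colon G\to K$ with $d(gh)=d(g)+g\cdot d(h)$; it determines the splitting $s_d$ of $p$. A functorial classifying space construction gives a fibration $Bp\colon B(K\rtimes G)\to BG$ with fibre $BK$ and section $B(s_d)$. Coverings of $B(K\rtimes G)$ are classified by the action of its fundamental group $K\rtimes G$ on the fibre; the covering determined by a subgroup $L$ has fibre the set of left cosets of $L$. For a fibration $q\colon E\to Y$, the sectional category $\mathrm{secat}(q)$ is the minimal $n$ such that $Y$ has an open cover $U_0,\dots,U_n$ with each $U_i$ admitting a section $U_i\to E$ of $q$ ($\infty$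 if there is no such $n$). For a fibration $q\colon X\to B$ with section $s\colon B\to X$, let $P_BX=\{\alpha\colon I\to X \text{ continuous}\mid q\circ\alpha \text{ constant},\ \alpha(0)=s(q(\alpha(0)))\}$ and $\mathrm{ev}_1\colon P_BX\to X$, $\alpha\mapsto\alpha(1)$. The complexity of $d$ is the $BG$-parametrized LS-category of $B(K\rtimes G)$ with respect to the section $B(s_d)$ of $Bp$, that is, $$\mathrm{tc}(d):=\mathrm{cat}_{BG}(B(K\rtimes G))=\mathrm{secat}\big(\mathrm{ev}_1\colon P_{BG}B(K\rtimes G)\to B(K\rtimes G)\big).$$ *)

theory Defs
  imports
    "HOL-Analysis.Analysis"
    "HOL-Algebra.Bij"
    "HOL-Algebra.Group_Action"
    "HOL-Library.Extended_Nat"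
begin

section \<open>Derivations and semi-direct products\<close>

text \<open>
  All groups, including the coefficient group \<open>K\<close> that is traditionally written additively, use the
  multiplicative notation of HOL-Algebra.  An action of \<open>G\<close> on \<open>K\<close> by automorphisms is an element
  \<open>a\<close> of \<open>hom G (AutoGroup K)\<close>, and \<open>a g k\<close> is \<open>g \<cdot> k\<close>.
\<close>

definition semidirect_product ::
  "('k, 'm) monoid_scheme \<Rightarrow> ('g, 'n) monoid_scheme \<Rightarrow> ('g \<Rightarrow> 'k \<Rightarrow> 'k) \<Rightarrow> ('k \<times> 'g) monoid" where
  "semidirect_product K G a =
     \<lparr>carrier = carrier K \<times> carrier G,
      mult = (\<lambda>(k, g) (k', g'). (k \<otimes>\<^bsub>K\<^esub> a g k', g \<otimes>\<^bsub>G\<^esub> g')),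
      one = (\<one>\<^bsub>K\<^esub>, \<one>\<^bsub>G\<^esub>)\<rparr>"

definition derivation ::
  "('k, 'm) monoid_scheme \<Rightarrow> ('g, 'n) monoid_scheme \<Rightarrow> ('g \<Rightarrow> 'k \<Rightarrow> 'k) \<Rightarrow> ('g \<Rightarrow> 'k) \<Rightarrow> bool" where
  "derivation K G a d \<longleftrightarrow>
     d \<in> carrier G \<rightarrow> carrier K \<and>
     (\<forall>g\<in>carrier G. \<forall>h\<in>carrier G. d (g \<otimes>\<^bsub>G\<^esub> h) = d g \<otimes>\<^bsub>K\<^esub> a g (d h))"

definition splitting :: "('g \<Rightarrow> 'k) \<Rightarrow> 'g \<Rightarrow> 'k \<times> 'g" where
  "splitting d g = (d g, g)"

text \<open>The action \<open>(k, g) \<cdot> k' = k + g \<cdot> k' - d(g)\<close> of the semi-direct product on the set \<open>K\<close>;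
  it is restricted to the carrier because \<^const>\<open>group_action\<close> asks for extensional bijections.\<close>

definition derivation_action ::
  "('k, 'm) monoid_scheme \<Rightarrow> ('g \<Rightarrow> 'k \<Rightarrow> 'k) \<Rightarrow> ('g \<Rightarrow> 'k) \<Rightarrow> 'k \<times> 'g \<Rightarrow> 'k \<Rightarrow> 'k" where
  "derivation_action K a d =
     (\<lambda>(k, g). \<lambda>k'\<in>carrier K. (k \<otimes>\<^bsub>K\<^esub> a g k') \<otimes>\<^bsub>K\<^esub> inv\<^bsub>K\<^esub> (d g))"


section \<open>The fundamental group\<close>

abbreviation unit_interval :: "real topology" where
  "unit_interval \<equiv> top_of_set {0..1}"

text \<open>
  The library's \<^const>\<open>joinpaths\<close> and \<^const>\<open>homotopic_paths\<close> are confined to type-class topologies;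
  these are the same notions for abstract topologies.
\<close>

definition path_join :: "(real \<Rightarrow> 'x) \<Rightarrow> (real \<Rightarrow> 'x) \<Rightarrow> real \<Rightarrow> 'x" where
  "path_join p q = (\<lambda>t. if t \<le> 1/2 then p (2 * t) else q (2 * t - 1))"

definition path_homotopic :: "'x topology \<Rightarrow> (real \<Rightarrow> 'x) \<Rightarrow> (real \<Rightarrow> 'x) \<Rightarrow> bool" where
  "path_homotopic X p q \<longleftrightarrow>
     homotopic_with (\<lambda>r. r 0 = p 0 \<and> r 1 = p 1) unit_interval X p q"

definition path_class :: "'x topology \<Rightarrow> (real \<Rightarrow> 'x) \<Rightarrow> (real \<Rightarrow> 'x) set" where
  "path_class X p = {q. path_homotopic X p q}"

definition loops :: "'x topology \<Rightarrow> 'x \<Rightarrow> (real \<Rightarrow> 'x) set" where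
  "loops X x0 = {p. pathin X p \<and> p 0 = x0 \<and> p 1 = x0}"

definition fundamental_group :: "'x topology \<Rightarrow> 'x \<Rightarrow> (real \<Rightarrow> 'x) set monoid" where
  "fundamental_group X x0 =
     \<lparr>carrier = path_class X ` loops X x0,
      mult = (\<lambda>A B. \<Union>p\<in>A. \<Union>q\<in>B. path_class X (path_join p q)),
      one = path_class X (\<lambda>_. x0)\<rparr>"

definition pi1_map :: "'y topology \<Rightarrow> ('x \<Rightarrow> 'y) \<Rightarrow> (real \<Rightarrow> 'x) set \<Rightarrow> (real \<Rightarrow> 'y) set" where
  "pi1_map Y f A = (\<Union>p\<in>A. path_class Y (f \<circ> p))"


section \<open>Covering projections\<close>

text \<open>These follow the library's \<^const>\<open>covering_space\<close>, which is confined to type-class topologies.\<close>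

definition evenly_covered ::
  "'e topology \<Rightarrow> 'x topology \<Rightarrow> ('e \<Rightarrow> 'x) \<Rightarrow> 'x set \<Rightarrow> bool" where
  "evenly_covered E X c T \<longleftrightarrow>
     (\<exists>\<V>. \<Union>\<V> = {e \<in> topspace E. c e \<in> T} \<and>
          (\<forall>V\<in>\<V>. openin E V) \<and>
          pairwise disjnt \<V> \<and>
          (\<forall>V\<in>\<V>. homeomorphic_map (subtopology E V) (subtopology X T) c))"

definition covering_projection :: "'e topology \<Rightarrow> 'x topology \<Rightarrow> ('e \<Rightarrow> 'x) \<Rightarrow> bool" where
  "covering_projection E X c \<longleftrightarrow>
     continuous_map E X c \<and> c ` topspace E = topspace X \<and>
     (\<forall>x\<in>topspace X. \<exists>T. openin X T \<and> x \<in> T \<and> evenly_covered E X c T)"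

text \<open>
  The left action of the fundamental group on a fibre: a class \<open>A\<close> sends \<open>e\<close> to the starting point
  of the lift of a representative that ends at \<open>e\<close>.  Since the product in \<^const>\<open>fundamental_group\<close>
  traverses its left factor first, transporting \<open>e\<close> forwards along \<open>A\<close> would be a right action; the
  left action is the transport along the inverse of \<open>A\<close>.  With this convention the stabiliser of \<open>e\<close>
  is the image of the fundamental group of the total space at \<open>e\<close>, so the fibre of the connected
  covering determined by \<open>L\<close> is the set of left cosets of \<open>L\<close>.
\<close>

definition monodromy :: "'e topology \<Rightarrow> ('e \<Rightarrow> 'x) \<Rightarrow> (real \<Rightarrow> 'x) set \<Rightarrow> 'e \<Rightarrow> 'e" where
  "monodromy E c A e = (THE e'. \<exists>p. pathin E p \<and> p 0 = e' \<and> p 1 = e \<and> c \<circ> p \<in> A)"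

text \<open>The covering determined by a subgroup \<open>L\<close> of \<open>\<Gamma>\<close>, where \<open>\<theta>\<close> identifies the fundamental group of
  \<open>X\<close> at \<open>x0\<close> with \<open>\<Gamma>\<close>.\<close>

definition covering_determined_by ::
  "'x topology \<Rightarrow> 'x \<Rightarrow> ((real \<Rightarrow> 'x) set \<Rightarrow> 'h) \<Rightarrow> 'h set \<Rightarrow> 'e topology \<Rightarrow> ('e \<Rightarrow> 'x) \<Rightarrow> bool" where
  "covering_determined_by X x0 \<theta> L E c \<longleftrightarrow>
     covering_projection E X c \<and> path_connected_space E \<and>
     (\<exists>e0\<in>topspace E. c e0 = x0 \<and>
        \<theta> ` pi1_map X c ` carrier (fundamental_group E e0) = L)"


section \<open>Classifying spaces\<close>

text \<open>
  Numerable in the sense of Dold: the base has a locally finite partition of unity whose cozero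
  sets are evenly covered.
\<close>

definition numerable_covering :: "'e topology \<Rightarrow> 'x topology \<Rightarrow> ('e \<Rightarrow> 'x) \<Rightarrow> bool" where
  "numerable_covering E X c \<longleftrightarrow>
     covering_projection E X c \<and>
     (\<exists>\<U> :: ('x \<Rightarrow> real) set.
        (\<forall>u\<in>\<U>. continuous_map X euclideanreal u \<and> (\<forall>x\<in>topspace X. 0 \<le> u x)) \<and>
        (\<forall>x\<in>topspace X. \<exists>V. openin X V \<and> x \<in> V \<and> finite {u\<in>\<U>. \<exists>y\<in>V. u y \<noteq> 0}) \<and>
        (\<forall>x\<in>topspace X. (\<Sum>u | u \<in> \<U> \<and> u x \<noteq> 0. u x) = 1) \<and>
        (\<forall>u\<in>\<U>. evenly_covered E X c {x\<in>topspace X. u x \<noteq> 0}))"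

text \<open>
  \<open>X\<close> is a classifying space of the discrete group \<open>\<Gamma>\<close>: its fundamental group is identified with
  \<open>\<Gamma>\<close> by \<open>\<theta>\<close>, and it is the base of a numerable covering with contractible total space.  For discrete
  \<open>\<Gamma>\<close> such a covering is the same as a numerable principal \<open>\<Gamma>\<close>-bundle with contractible total space.
  Every connected CW complex that is a \<open>K(\<Gamma>, 1)\<close> qualifies.  The points of a contractible covering
  of \<open>X\<close> correspond to the homotopy classes of paths in \<open>X\<close> starting at \<open>x0\<close>, so it is no restriction
  to look for the total space on the type of sets of paths.
\<close>

definition classifying_space ::
  "('h, 'm) monoid_scheme \<Rightarrow> 'x topology \<Rightarrow> 'x \<Rightarrow> ((real \<Rightarrow> 'x) set \<Rightarrow> 'h) \<Rightarrow> bool" where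
  "classifying_space \<Gamma> X x0 \<theta> \<longleftrightarrow>
     x0 \<in> topspace X \<and>
     \<theta> \<in> iso (fundamental_group X x0) \<Gamma> \<and>
     (\<exists>(E :: (real \<Rightarrow> 'x) set topology) c. numerable_covering E X c \<and> contractible_space E)"

text \<open>\<open>f\<close> is the map between classifying spaces that corresponds to the homomorphism \<open>h\<close>.\<close>

definition classifying_map ::
  "'x topology \<Rightarrow> 'x \<Rightarrow> ((real \<Rightarrow> 'x) set \<Rightarrow> 'h) \<Rightarrow>
   'y topology \<Rightarrow> 'y \<Rightarrow> ((real \<Rightarrow> 'y) set \<Rightarrow> 'l) \<Rightarrow> ('h \<Rightarrow> 'l) \<Rightarrow> ('x \<Rightarrow> 'y) \<Rightarrow> bool" where
  "classifying_map X x0 \<theta> Y y0 \<eta> h f \<longleftrightarrow>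
     continuous_map X Y f \<and> f x0 = y0 \<and>
     (\<forall>A\<in>carrier (fundamental_group X x0). \<eta> (pi1_map Y f A) = h (\<theta> A))"


section \<open>Fibrations and sectional category\<close>

text \<open>
  The homotopy lifting property for all spaces.  HOL cannot quantify over types here, but the
  universal test space, which consists of the pairs of a point \<open>e\<close> of \<open>E\<close> and a path of \<open>B\<close> starting at \<open>q e\<close>,
  has points of type \<open>'e \<times> (real \<Rightarrow> 'b)\<close>; so the property for all spaces on that type gives it for
  spaces on every type.
\<close>

definition hurewicz_fibration :: "'e topology \<Rightarrow> 'b topology \<Rightarrow> ('e \<Rightarrow> 'b) \<Rightarrow> bool" where
  "hurewicz_fibration E B q \<longleftrightarrow>
     continuous_map E B q \<and>
     (\<forall>(Z :: ('e \<times> (real \<Rightarrow> 'b)) topology) f h.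
        continuous_map Z E f \<and> continuous_map (prod_topology Z unit_interval) B h \<and>
        (\<forall>z\<in>topspace Z. h (z, 0) = q (f z)) \<longrightarrow>
        (\<exists>H. continuous_map (prod_topology Z unit_interval) E H \<and>
             (\<forall>z\<in>topspace Z. H (z, 0) = f z \<and> (\<forall>t\<in>{0..1}. q (H (z, t)) = h (z, t)))))"

definition secat :: "'e topology \<Rightarrow> 'y topology \<Rightarrow> ('e \<Rightarrow> 'y) \<Rightarrow> enat" where
  "secat E Y q =
     Inf {enat n | n.
       \<exists>U :: nat \<Rightarrow> 'y set.
         (\<forall>i\<le>n. openin Y (U i)) \<and> (\<Union>i\<le>n. U i) = topspace Y \<and>
         (\<forall>i\<le>n. \<exists>\<sigma>. continuous_map (subtopology Y (U i)) E \<sigma> \<and> (\<forall>y\<in>U i. q (\<sigma> y) = y))}"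

text \<open>The compact-open topology; maps are represented by extensional functions.\<close>

definition mapping_space :: "'a topology \<Rightarrow> 'b topology \<Rightarrow> ('a \<Rightarrow> 'b) topology" where
  "mapping_space A B =
     topology_generated_by
       {{f \<in> extensional (topspace A). continuous_map A B f \<and> f ` C \<subseteq> U} | C U.
          compactin A C \<and> openin B U}"

definition fibrewise_path_space ::
  "'x topology \<Rightarrow> ('x \<Rightarrow> 'b) \<Rightarrow> ('b \<Rightarrow> 'x) \<Rightarrow> (real \<Rightarrow> 'x) topology" where
  "fibrewise_path_space X q s =
     subtopology (mapping_space unit_interval X)
       {\<alpha>. (\<exists>b. \<forall>t\<in>{0..1}. q (\<alpha> t) = b) \<and> \<alpha> 0 = s (q (\<alpha> 0))}"

definition parametrized_cat :: "'x topology \<Rightarrow> ('x \<Rightarrow> 'b) \<Rightarrow> ('b \<Rightarrow> 'x) \<Rightarrow> enat" where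
  "parametrized_cat X q s = secat (fibrewise_path_space X q s) X (\<lambda>\<alpha>. \<alpha> 1)"


section \<open>The complexity of a derivation\<close>

text \<open>
  The values of a functorial classifying space construction that enter the complexity of a
  derivation \<open>d\<close>: the classifying spaces \<open>X\<close> of the semi-direct product and \<open>Y\<close> of \<open>G\<close>, the fibration
  \<open>Bp\<close> of \<open>X\<close> over \<open>Y\<close> induced by the projection, and its section \<open>Bs\<close> induced by the splitting of \<open>d\<close>.
\<close>

definition classifying_fibration ::
  "('k, 'm) monoid_scheme \<Rightarrow> ('g, 'n) monoid_scheme \<Rightarrow> ('g \<Rightarrow> 'k \<Rightarrow> 'k) \<Rightarrow> ('g \<Rightarrow> 'k) \<Rightarrow>
   'x topology \<Rightarrow> 'x \<Rightarrow> ((real \<Rightarrow> 'x) set \<Rightarrow> 'k \<times> 'g) \<Rightarrow>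
   'y topology \<Rightarrow> 'y \<Rightarrow> ((real \<Rightarrow> 'y) set \<Rightarrow> 'g) \<Rightarrow> ('x \<Rightarrow> 'y) \<Rightarrow> ('y \<Rightarrow> 'x) \<Rightarrow> bool" where
  "classifying_fibration K G a d X x0 \<theta> Y y0 \<eta> Bp Bs \<longleftrightarrow>
     classifying_space (semidirect_product K G a) X x0 \<theta> \<and>
     classifying_space G Y y0 \<eta> \<and>
     classifying_map X x0 \<theta> Y y0 \<eta> snd Bp \<and>
     classifying_map Y y0 \<eta> X x0 \<theta> (splitting d) Bs \<and>
     hurewicz_fibration X Y Bp \<and>
     (\<forall>y\<in>topspace Y. Bp (Bs y) = y)"

text \<open>The complexity \<open>tc(d)\<close>; the derivation enters through the section \<open>Bs\<close> only.\<close>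

definition tc :: "'x topology \<Rightarrow> ('x \<Rightarrow> 'y) \<Rightarrow> ('y \<Rightarrow> 'x) \<Rightarrow> enat" where
  "tc X Bp Bs = parametrized_cat X Bp Bs"

end

theory Submission
  imports Defs
begin

text \<open>
  The covering \<open>\<pi>\<close> belongs to the subgroup \<open>L = s_d(G)\<close> of \<open>\<Gamma> = K \<rtimes> G\<close>, and both claims come from
  the fact that \<open>L\<close> is a complement of \<open>K\<close>.

  For the first claim, \<open>\<Gamma>\<close> acts transitively on the fibre of \<open>\<pi>\<close> over the base point, and the stabiliser
  of the distinguished point \<open>e0\<close> is \<open>L\<close>.  The action \<open>(k, g) \<cdot> k' = k + g \<cdot> k' - d(g)\<close> on \<open>K\<close> is
  transitive as well, and the stabiliser of the neutral element is \<open>L\<close> again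
  (\<open>act_stabiliser\<close>, \<open>fibre_bijection\<close>).

  For the second claim, fix an open set \<open>U\<close> of \<open>X\<close>; the two sectional categories agree because the
  evaluation of fibrewise paths has a section over \<open>U\<close> if and only if \<open>\<pi>\<close> has one.  A section of the
  evaluation is a homotopy of maps from \<open>U\<close> to \<open>X\<close>, vertical over \<open>Y\<close>, from \<open>Bs \<circ> Bp\<close> to the inclusion.
  The section \<open>Bs\<close> lifts to a map \<open>\<tau>\<close> from \<open>Y\<close> to the covering space \<open>E\<close>, since its loops have classes in
  \<open>L\<close> (\<open>section_lift\<close>).  If a homotopy is given, its lift to \<open>E\<close> starting at \<open>\<tau> \<circ> Bp\<close> ends in a section
  of \<open>\<pi>\<close>.  Conversely, let \<open>\<sigma>\<close> be a section of \<open>\<pi>\<close> over \<open>U\<close>.  The maps \<open>\<tau> \<circ> Bp\<close> and \<open>\<sigma>\<close> from \<open>U\<close> to \<open>E\<close>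
  agree after composition with \<open>q = Bp \<circ> \<pi>\<close>, and a homotopy between them over \<open>Y\<close> is projected by \<open>\<pi>\<close>
  to a homotopy of the required kind.

  Such a homotopy exists because \<open>q\<close> is a fibration with contractible fibres, which is used in the
  following form.  Let \<open>D\<close> and \<open>W\<close> be the contractible coverings of \<open>X\<close> and \<open>Y\<close>.  As \<open>q\<close> maps the
  fundamental group \<open>L\<close> of \<open>E\<close> isomorphically to \<open>G\<close>, the space \<open>D\<close> is the fibre product of \<open>E\<close> and \<open>W\<close>
  over \<open>Y\<close> (\<open>contractible_fibre_product\<close>).  Over an open set on which the covering \<open>W\<close> of \<open>Y\<close> has a
  section, the contractions of \<open>D\<close> and \<open>W\<close> and the homotopy lifting property of \<open>q\<close> yield a vertical
  contraction of \<open>E\<close> to a section of \<open>q\<close> (\<open>local_contraction\<close>).  These sets are the cozero sets of a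
  partition of unity on \<open>Y\<close>, and an argument of Dold glues the local contractions: a vertical homotopy
  between two maps is a map on \<open>U \<times> [0,1]\<close> that is known near the two ends, and it is obtained by running
  through the sets of the partition in a fixed order and contracting more and more of what has been
  obtained before, as the weight of the new set increases (\<open>glue_continuous\<close>, \<open>vertical_homotopy\<close>).

  A classifying space may fail to be locally path connected, so maps are lifted to coverings along the
  contractions of \<open>D\<close> and \<open>W\<close>, and not along paths chosen in their domains.
\<close>

section \<open>Continuous maps and mapping spaces\<close>

lemma continuous_map_locally:
  assumes "\<And>x. x \<in> topspace X \<Longrightarrow>
    \<exists>U. openin X U \<and> x \<in> U \<and> continuous_map (subtopology X U) Y f"
  shows "continuous_map X Y f"
proof -
  obtain U where U: "\<And>x. x \<in> topspace X \<Longrightarrow>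
      openin X (U x) \<and> x \<in> U x \<and> continuous_map (subtopology X (U x)) Y f"
    using assms by metis
  show ?thesis
    by (rule pasting_lemma[where I = "topspace X" and T = U and f = "\<lambda>_. f"]) (use U in auto)
qed

lemma continuous_map_comp:
  "continuous_map A B f \<Longrightarrow> continuous_map B C g \<Longrightarrow> continuous_map A C (\<lambda>x. g (f x))"
  using continuous_map_compose[of A B f C g] by (simp add: o_def)

lemma continuous_map_unit_intervalI:
  assumes "continuous_map X euclideanreal f" "\<And>x. x \<in> topspace X \<Longrightarrow> 0 \<le> f x \<and> f x \<le> 1"
  shows "continuous_map X unit_interval f"
  using assms by (auto simp: continuous_map_in_subtopology)

lemma continuous_map_top_of_set_real:
  "continuous_map X (top_of_set S) f \<Longrightarrow> continuous_map X euclidean f"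
  by (rule continuous_map_into_fulltopology)

lemma topspace_mapping_space:
  "topspace (mapping_space A B) = {f \<in> extensional (topspace A). continuous_map A B f}"
proof -
  let ?S = "{{f \<in> extensional (topspace A). continuous_map A B f \<and> f ` C \<subseteq> U} | C U.
      compactin A C \<and> openin B U}"
  let ?M = "{f \<in> extensional (topspace A). continuous_map A B f}"
  have "{f \<in> extensional (topspace A). continuous_map A B f \<and> f ` {} \<subseteq> {}} \<in> ?S"
    using compactin_empty openin_empty by blast
  then have "?M \<in> ?S" by simp
  moreover have "T \<subseteq> ?M" if "T \<in> ?S" for T using that by auto
  ultimately have "\<Union>?S = ?M" by (intro equalityI Union_least Union_upper)
  then show ?thesis
    unfolding mapping_space_def topology_generated_by_topspace .
qed

lemma openin_mapping_space:
  assumes "compactin A C" "openin B U"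
  shows "openin (mapping_space A B)
    {f \<in> extensional (topspace A). continuous_map A B f \<and> f ` C \<subseteq> U}"
  unfolding mapping_space_def by (rule topology_generated_by_Basis) (use assms in auto)

text \<open>The unit interval is locally compact, so evaluation is continuous in the compact-open topology.\<close>

lemma continuous_map_uncurry:
  assumes \<sigma>: "continuous_map Z (mapping_space unit_interval X) \<sigma>"
  shows "continuous_map (prod_topology Z unit_interval) X (\<lambda>(z, t). \<sigma> z t)"
proof -
  have cont: "continuous_map unit_interval X (\<sigma> z)" if "z \<in> topspace Z" for z
    using \<sigma> that by (auto simp: continuous_map_def topspace_mapping_space)
  have op: "openin (prod_topology Z unit_interval)
      {p \<in> topspace (prod_topology Z unit_interval). (case p of (z, t) \<Rightarrow> \<sigma> z t) \<in> V}" (is "openin _ ?P")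
    if V: "openin X V" for V
  proof (subst openin_prod_topology_alt, intro allI impI)
    fix z t assume "(z, t) \<in> ?P"
    then have z: "z \<in> topspace Z" and t: "t \<in> {0..1}" and zt: "\<sigma> z t \<in> V" by auto
    have "openin unit_interval {s \<in> topspace unit_interval. \<sigma> z s \<in> V}"
      using cont[OF z] V by (rule openin_continuous_map_preimage)
    then obtain e where e: "e > 0" "cball t e \<inter> {0..1} \<subseteq> {s \<in> {0..1}. \<sigma> z s \<in> V}"
      using t zt unfolding openin_contains_cball by auto
    define C where "C = cball t e \<inter> {0..1}"
    have "compactin unit_interval C"
      unfolding C_def by (auto simp: compactin_subtopology)
    then have "openin Z {z \<in> topspace Z. \<sigma> z \<in> {f \<in> extensional (topspace unit_interval).
          continuous_map unit_interval X f \<and> f ` C \<subseteq> V}}" (is "openin Z ?A")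
      by (intro openin_continuous_map_preimage[OF \<sigma>] openin_mapping_space V)
    moreover have "openin unit_interval (ball t e \<inter> {0..1})"
      by (metis inf_commute open_ball openin_open_Int)
    moreover have "z \<in> ?A"
      using \<sigma> z e unfolding C_def by (auto simp: continuous_map_def topspace_mapping_space)
    moreover have "?A \<times> (ball t e \<inter> {0..1}) \<subseteq> ?P"
      unfolding C_def by auto
    ultimately show "\<exists>U W. openin Z U \<and> openin unit_interval W \<and> z \<in> U \<and> t \<in> W \<and> U \<times> W \<subseteq> ?P"
      using t e(1) by (intro exI[of _ ?A] exI[of _ "ball t e \<inter> {0..1}"]) auto
  qed
  show ?thesis
    unfolding continuous_map_def
  proof (intro conjI allI impI)
    show "(\<lambda>(z, t). \<sigma> z t) \<in> topspace (prod_topology Z unit_interval) \<rightarrow> topspace X"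
      using cont by (auto simp: continuous_map_def)
  qed (rule op)
qed

lemma continuous_map_curry:
  assumes h: "continuous_map (prod_topology Z unit_interval) X h"
  shows "continuous_map Z (mapping_space unit_interval X) (\<lambda>z. \<lambda>t\<in>{0..1}. h (z, t))"
proof -
  have slice: "continuous_map unit_interval X (\<lambda>t\<in>{0..1}. h (z, t))" if "z \<in> topspace Z" for z
  proof -
    have "continuous_map unit_interval X (h \<circ> Pair z)"
      by (rule continuous_map_compose[OF _ h]) (auto intro!: continuous_map_pairedI simp: that)
    then show ?thesis by (rule continuous_map_eq) auto
  qed
  show ?thesis
    unfolding mapping_space_def
  proof (rule continuous_on_generated_topo)
    show "(\<lambda>z. \<lambda>t\<in>{0..1}. h (z, t)) ` topspace Z \<subseteq> \<Union>{{f \<in> extensional (topspace unit_interval).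
        continuous_map unit_interval X f \<and> f ` C \<subseteq> U} | C U. compactin unit_interval C \<and> openin X U}"
      using slice topspace_mapping_space[of unit_interval X]
      unfolding mapping_space_def topology_generated_by_topspace by auto
  next
    fix S assume "S \<in> {{f \<in> extensional (topspace unit_interval).
        continuous_map unit_interval X f \<and> f ` C \<subseteq> U} | C U. compactin unit_interval C \<and> openin X U}"
    then obtain C U where S: "S = {f \<in> extensional (topspace unit_interval).
        continuous_map unit_interval X f \<and> f ` C \<subseteq> U}"
      and C: "compactin unit_interval C" and U: "openin X U" by blast
    have C01: "C \<subseteq> {0..1}" using compactin_subset_topspace[OF C] by simp
    let ?W = "{p \<in> topspace (prod_topology Z unit_interval). h p \<in> U}"
    have W: "openin (prod_topology Z unit_interval) ?W"
      using h U by (rule openin_continuous_map_preimage)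
    show "openin Z ((\<lambda>z. \<lambda>t\<in>{0..1}. h (z, t)) -` S \<inter> topspace Z)" (is "openin Z ?T")
    proof (subst openin_subopen, intro ballI)
      fix z assume "z \<in> ?T"
      then have z: "z \<in> topspace Z" and zS: "(\<lambda>t\<in>{0..1}. h (z, t)) \<in> S" by auto
      have "h (z, t) \<in> U" if "t \<in> C" for t
      proof -
        have "(\<lambda>t\<in>{0..1}. h (z, t)) t \<in> U" "t \<in> {0..1}" using zS that C01 by (auto simp: S)
        then show ?thesis by simp
      qed
      then have "{z} \<times> C \<subseteq> ?W" using C01 z by auto
      from tube_lemma_right[OF W C z this] obtain A B where
        A: "openin Z A" "z \<in> A" "C \<subseteq> B" "A \<times> B \<subseteq> ?W" by blast
      have "A \<subseteq> ?T"
      proof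
        fix w assume w: "w \<in> A"
        then have "w \<in> topspace Z" using A(1) openin_subset by blast
        moreover have "h (w, t) \<in> U" if "t \<in> C" for t using A w that by blast
        ultimately show "w \<in> ?T" using slice C01 by (auto simp: S subset_iff)
      qed
      then show "\<exists>T. openin Z T \<and> z \<in> T \<and> T \<subseteq> ?T" using A by blast
    qed
  qed
qed

section \<open>Homotopies of paths and the fundamental group\<close>

definition path_rev :: "(real \<Rightarrow> 'x) \<Rightarrow> real \<Rightarrow> 'x" where
  "path_rev p = (\<lambda>t. p (1 - t))"

lemma path_rev_simps [simp]: "path_rev p 0 = p 1" "path_rev p 1 = p 0"
  by (auto simp: path_rev_def)

lemma path_join_simps [simp]: "path_join p q 0 = p 0" "path_join p q 1 = q 1"
  by (auto simp: path_join_def)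

lemma comp_path_join: "f \<circ> path_join p q = path_join (f \<circ> p) (f \<circ> q)"
  by (auto simp: path_join_def)

lemma comp_path_rev: "f \<circ> path_rev p = path_rev (f \<circ> p)"
  by (auto simp: path_rev_def)

lemma pathin_reparam:
  assumes "pathin X p" "continuous_on {0..1} f" "f ` {0..1} \<subseteq> {0..1}"
  shows "pathin X (p \<circ> f)"
  using assms unfolding pathin_def
  by (intro continuous_map_compose[of _ unit_interval]) (auto simp: continuous_map_in_subtopology)

lemma pathin_rev: "pathin X p \<Longrightarrow> pathin X (path_rev p)"
  using pathin_reparam[of X p "\<lambda>t. 1 - t"] continuous_on_diff[OF continuous_on_const continuous_on_id]
  by (fastforce simp: path_rev_def o_def)

lemma pathin_topspace: "pathin X p \<Longrightarrow> t \<in> {0..1} \<Longrightarrow> p t \<in> topspace X"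
  by (auto simp: pathin_def continuous_map_def)

lemma pathin_join:
  assumes "pathin X p" "pathin X q" "p 1 = q 0"
  shows "pathin X (path_join p q)"
  unfolding pathin_def path_join_def
proof (rule continuous_map_cases_le)
  have "continuous_map (subtopology unit_interval A) euclideanreal (\<lambda>t. 2 * t)"
    "continuous_map (subtopology unit_interval A) euclideanreal (\<lambda>t. 2 * t - 1)" for A
    unfolding subtopology_subtopology continuous_map_iff_continuous by (intro continuous_intros)+
  then have 1: "continuous_map (subtopology unit_interval {x \<in> topspace unit_interval. x \<le> 1/2})
      unit_interval (\<lambda>t. 2 * t)"
    and 2: "continuous_map (subtopology unit_interval {x \<in> topspace unit_interval. 1/2 \<le> x})
      unit_interval (\<lambda>t. 2 * t - 1)"
    by (auto intro: continuous_map_unit_intervalI)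
  show "continuous_map (subtopology unit_interval {x \<in> topspace unit_interval. x \<le> 1/2}) X (\<lambda>t. p (2 * t))"
    using continuous_map_compose[OF 1, of X p] assms(1) by (simp add: pathin_def o_def)
  show "continuous_map (subtopology unit_interval {x \<in> topspace unit_interval. 1/2 \<le> x}) X (\<lambda>t. q (2 * t - 1))"
    using continuous_map_compose[OF 2, of X q] assms(2) by (simp add: pathin_def o_def)
  show "p (2 * t) = q (2 * t - 1)" if "t = 1/2" for t
    using assms(3) unfolding that by simp
qed auto

lemma pathin_comp: "pathin A p \<Longrightarrow> continuous_map A B f \<Longrightarrow> pathin B (\<lambda>t. f (p t))"
  unfolding pathin_def by (rule continuous_map_comp)

lemma path_homotopic_imp:
  assumes "path_homotopic X p q"
  shows "pathin X p" "pathin X q" "q 0 = p 0" "q 1 = p 1"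
  using homotopic_with_imp_continuous_maps[of _ unit_interval X p q]
    homotopic_with_imp_property[of _ unit_interval X p q] assms
  by (auto simp: path_homotopic_def pathin_def)

lemma path_homotopic_refl: "pathin X p \<Longrightarrow> path_homotopic X p p"
  by (simp add: path_homotopic_def pathin_def)

lemma path_homotopic_sym: "path_homotopic X p q \<Longrightarrow> path_homotopic X q p"
  using path_homotopic_imp(3,4)[of X p q] unfolding path_homotopic_def
  by (subst homotopic_with_sym) simp

lemma path_homotopic_trans:
  "path_homotopic X p q \<Longrightarrow> path_homotopic X q r \<Longrightarrow> path_homotopic X p r"
  using path_homotopic_imp(3,4)[of X p q] unfolding path_homotopic_def
  by (auto elim: homotopic_with_trans)

lemma path_homotopic_compose:
  assumes "path_homotopic X p q" "continuous_map X Y f"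
  shows "path_homotopic Y (f \<circ> p) (f \<circ> q)"
  using assms unfolding path_homotopic_def
  by (auto intro: homotopic_with_compose_continuous_map_left)

lemma path_homotopicE:
  assumes "path_homotopic X p q"
  obtains h where "continuous_map (prod_topology unit_interval unit_interval) X h"
    "\<And>s. h (0, s) = p s" "\<And>s. h (1, s) = q s"
    "\<And>t. t \<in> {0..1} \<Longrightarrow> h (t, 0) = p 0 \<and> h (t, 1) = p 1"
  using assms unfolding path_homotopic_def homotopic_with_def by auto

lemma path_homotopicI:
  assumes "continuous_map (prod_topology unit_interval unit_interval) X h"
    "\<And>s. h (0, s) = p s" "\<And>s. h (1, s) = q s"
    "\<And>t. t \<in> {0..1} \<Longrightarrow> h (t, 0) = p 0 \<and> h (t, 1) = p 1"
  shows "path_homotopic X p q"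
  using assms unfolding path_homotopic_def homotopic_with_def by blast

lemma path_homotopic_eq:
  assumes "pathin X p" "\<And>t. t \<in> {0..1} \<Longrightarrow> p t = q t"
  shows "path_homotopic X p q"
  unfolding path_homotopic_def
  by (rule homotopic_with_equal) (use assms in \<open>auto simp: pathin_def\<close>)

lemma path_homotopic_rev:
  assumes "path_homotopic X p q"
  shows "path_homotopic X (path_rev p) (path_rev q)"
proof -
  obtain h where h: "continuous_map (prod_topology unit_interval unit_interval) X h"
    "\<And>s. h (0, s) = p s" "\<And>s. h (1, s) = q s"
    "\<And>t. t \<in> {0..1} \<Longrightarrow> h (t, 0) = p 0 \<and> h (t, 1) = p 1"
    using assms by (rule path_homotopicE) blast
  show ?thesis
  proof (rule path_homotopicI)
    let ?II = "prod_topology unit_interval unit_interval"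
    have "continuous_map ?II unit_interval (\<lambda>x. 1 - snd x)"
      by (intro continuous_map_unit_intervalI continuous_map_diff
          continuous_map_top_of_set_real[OF continuous_map_snd]) auto
    then show "continuous_map ?II X (\<lambda>x. h (fst x, 1 - snd x))"
      by (intro continuous_map_compose[OF _ h(1), unfolded o_def] continuous_map_pairedI continuous_map_fst)
  qed (auto simp: path_rev_def h)
qed

text \<open>The straight-line homotopy in the parameter space \<open>S\<close>: the identities between path classes below
  compare two paths in one parameter interval or in one parameter square.\<close>

lemma path_homotopic_convex:
  fixes S :: "'a::real_normed_vector set"
  assumes S: "convex S" and g: "continuous_map (top_of_set S) X g"
    and f: "continuous_on {0..1} f1" "continuous_on {0..1} f2"
      "\<And>t. t \<in> {0..1} \<Longrightarrow> f1 t \<in> S \<and> f2 t \<in> S" "f1 0 = f2 0" "f1 1 = f2 1"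
  shows "path_homotopic X (g \<circ> f1) (g \<circ> f2)"
proof (rule path_homotopicI)
  define k where "k = (\<lambda>(t :: real, s). (1 - t) *\<^sub>R f1 s + t *\<^sub>R f2 s)"
  have "continuous_on ({0..1} \<times> {0..1}) k"
    unfolding k_def case_prod_unfold
    by (intro continuous_intros continuous_on_compose2[OF f(1)] continuous_on_compose2[OF f(2)]) auto
  moreover have "k ` ({0..1} \<times> {0..1}) \<subseteq> S"
    using S f(3) by (auto simp: k_def intro!: convexD)
  ultimately have "continuous_map (prod_topology unit_interval unit_interval) (top_of_set S) k"
    by (simp add: continuous_map_in_subtopology image_subset_iff_funcset flip: subtopology_Times)
  then show "continuous_map (prod_topology unit_interval unit_interval) X (g \<circ> k)"
    using g by (rule continuous_map_compose)
  show "(g \<circ> k) (0, s) = (g \<circ> f1) s" "(g \<circ> k) (1, s) = (g \<circ> f2) s" for s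
    by (auto simp: k_def)
  show "(g \<circ> k) (t, 0) = (g \<circ> f1) 0 \<and> (g \<circ> k) (t, 1) = (g \<circ> f1) 1" for t
    by (simp add: k_def f scaleR_diff_left flip: scaleR_add_left)
qed

lemma path_homotopic_join_rev:
  assumes "pathin X p"
  shows "path_homotopic X (path_join p (path_rev p)) (\<lambda>_. p 0)"
proof -
  let ?f = "\<lambda>t::real. 1 - \<bar>2 * t - 1\<bar>"
  have "path_join p (path_rev p) = p \<circ> ?f"
    by (auto simp: path_join_def path_rev_def fun_eq_iff abs_if intro: arg_cong[of _ _ p])
  moreover have "path_homotopic X (p \<circ> ?f) (p \<circ> (\<lambda>_. 0))"
  proof (rule path_homotopic_convex[where S = "{0..1}"])
    show "continuous_on {0..1} ?f" by (intro continuous_intros)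
  qed (use assms in \<open>auto simp: pathin_def abs_if\<close>)
  ultimately show ?thesis by (simp add: o_def)
qed

text \<open>After \<open>\<alpha>\<close> followed by the reverse of \<open>\<beta>\<close>, traversing \<open>\<beta>\<close> means running back on the same path to
  its middle.\<close>

lemma path_homotopic_cancel:
  assumes "pathin X \<alpha>" "pathin X \<beta>" "\<alpha> 1 = \<beta> 1"
  shows "path_homotopic X (path_join (path_join \<alpha> (path_rev \<beta>)) \<beta>) \<alpha>"
proof -
  let ?c = "path_join \<alpha> (path_rev \<beta>)"
  let ?f = "\<lambda>t::real. min (2 * t) (3/2 - t)"
  have c: "pathin X ?c" using assms by (simp add: pathin_join pathin_rev)
  have "path_homotopic X (?c \<circ> ?f) (?c \<circ> (\<lambda>t. t / 2))"
  proof (rule path_homotopic_convex[where S = "{0..1}"])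
    show "continuous_on {0..1} ?f" "continuous_on {0..1} (\<lambda>t::real. t / 2)"
      by (intro continuous_intros; simp)+
  qed (use c in \<open>auto simp: pathin_def min_def\<close>)
  moreover have "path_homotopic X (path_join ?c \<beta>) (?c \<circ> ?f)"
  proof (rule path_homotopic_eq)
    show "pathin X (path_join ?c \<beta>)" using c assms by (simp add: pathin_join)
    show "path_join ?c \<beta> t = (?c \<circ> ?f) t" if "t \<in> {0..1}" for t
    proof (cases "t \<le> 1/2")
      case False
      have eq: "2 - 2 * (3/2 - t) = 2 * t - 1" by simp
      show ?thesis
      proof (cases "t = 1")
        case True
        then show ?thesis using assms(3) by (simp add: path_join_def path_rev_def min_def)
      next
        case False
        then have "3/2 - t > 1/2" "min (2 * t) (3/2 - t) = 3/2 - t" using that \<open>\<not> t \<le> 1/2\<close> by auto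
        then show ?thesis using \<open>\<not> t \<le> 1/2\<close> eq by (simp add: path_join_def path_rev_def algebra_simps)
      qed
    qed (simp add: path_join_def min_def)
  qed
  moreover have "path_homotopic X (?c \<circ> (\<lambda>t. t / 2)) \<alpha>"
    by (rule path_homotopic_sym, rule path_homotopic_eq[OF assms(1)]) (auto simp: path_join_def)
  ultimately show ?thesis using path_homotopic_trans by blast
qed

lemma path_homotopic_join:
  assumes "path_homotopic X p p'" "path_homotopic X q q'" "p 1 = q 0"
  shows "path_homotopic X (path_join p q) (path_join p' q')"
proof -
  obtain h where h: "continuous_map (prod_topology unit_interval unit_interval) X h"
    "\<And>s. h (0, s) = p s" "\<And>s. h (1, s) = p' s"
    "\<And>t. t \<in> {0..1} \<Longrightarrow> h (t, 0) = p 0 \<and> h (t, 1) = p 1"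
    using assms(1) by (rule path_homotopicE) blast
  obtain k where k: "continuous_map (prod_topology unit_interval unit_interval) X k"
    "\<And>s. k (0, s) = q s" "\<And>s. k (1, s) = q' s"
    "\<And>t. t \<in> {0..1} \<Longrightarrow> k (t, 0) = q 0 \<and> k (t, 1) = q 1"
    using assms(2) by (rule path_homotopicE) blast
  let ?II = "prod_topology unit_interval unit_interval"
  let ?f = "\<lambda>x. if snd x \<le> 1/2 then h (fst x, 2 * snd x) else k (fst x, 2 * snd x - 1)"
  have snd: "continuous_map (subtopology ?II A) euclideanreal snd" for A
    by (rule continuous_map_from_subtopology[OF continuous_map_top_of_set_real[OF continuous_map_snd]])
  have fst: "continuous_map (subtopology ?II A) unit_interval fst" for A
    by (rule continuous_map_from_subtopology[OF continuous_map_fst])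
  show ?thesis
  proof (rule path_homotopicI)
    show "continuous_map ?II X ?f"
    proof (rule continuous_map_cases_le)
      show "continuous_map (subtopology ?II {x \<in> topspace ?II. snd x \<le> 1/2}) X (\<lambda>x. h (fst x, 2 * snd x))"
        by (intro continuous_map_compose[OF _ h(1), unfolded o_def] continuous_map_pairedI fst
            continuous_map_unit_intervalI continuous_map_real_mult snd) auto
      show "continuous_map (subtopology ?II {x \<in> topspace ?II. 1/2 \<le> snd x}) X (\<lambda>x. k (fst x, 2 * snd x - 1))"
        by (intro continuous_map_compose[OF _ k(1), unfolded o_def] continuous_map_pairedI fst
            continuous_map_unit_intervalI continuous_map_real_mult continuous_map_diff snd) auto
      show "continuous_map ?II euclideanreal snd"
        by (rule continuous_map_top_of_set_real[OF continuous_map_snd])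
      show "h (fst x, 2 * snd x) = k (fst x, 2 * snd x - 1)" if "x \<in> topspace ?II" "snd x = 1/2" for x
        using that(1) h(4)[of "fst x"] k(4)[of "fst x"] assms(3) unfolding that(2) by auto
    qed simp
  qed (use h k in \<open>auto simp: path_join_def\<close>)
qed

text \<open>A contraction sweeps a loop out to a square whose other three sides are the track of the base
  point, a constant path and the track again.\<close>

lemma contractible_loop_null:
  assumes W: "contractible_space W" and l: "pathin W l" "l 0 = l 1"
  shows "path_homotopic W l (\<lambda>_. l 0)"
proof -
  obtain a h where h: "continuous_map (prod_topology unit_interval W) W h"
    and h0: "\<And>w. h (0, w) = w" and h1: "\<And>w. h (1, w) = a"
    using W unfolding contractible_space_def homotopic_with_def by auto
  define Q where "Q = (\<lambda>(s, t). h (t, l s))"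
  have Q: "continuous_map (top_of_set ({0..1} \<times> {0..1})) W Q"
  proof -
    have "continuous_map (prod_topology unit_interval unit_interval) W (\<lambda>x. h (snd x, l (fst x)))"
      using l(1) unfolding pathin_def
      by (intro continuous_map_compose[OF _ h, unfolded o_def] continuous_map_pairedI
          continuous_map_snd continuous_map_compose[OF continuous_map_fst, unfolded o_def])
    then show ?thesis
      by (simp add: Q_def case_prod_unfold flip: subtopology_Times)
  qed
  \<comment> \<open>The path \<open>f\<close> follows the other three sides.  The contraction ends at the point \<open>a\<close> and moves both
    ends of the loop along the same track, so the images of \<open>f\<close> and of the path \<open>g\<close>, which runs up the
    left side and back, coincide.\<close>
  define f where "f = (\<lambda>t::real. (min 1 (max 0 (3 * t - 1)), min 1 (min (3 * t) (3 - 3 * t))))"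
  define g where "g = (\<lambda>t::real. (0::real, min 1 (min (3 * t) (3 - 3 * t))))"
  have "path_homotopic W (Q \<circ> (\<lambda>t. (t, 0))) (Q \<circ> f)"
  proof (rule path_homotopic_convex[OF _ Q])
    show "continuous_on {0..1} f" unfolding f_def by (intro continuous_intros)
  qed (auto simp: f_def convex_Times continuous_on_Pair continuous_on_const continuous_on_id)
  moreover have "(Q \<circ> f) t = (Q \<circ> g) t" for t
    using l(2) h1 by (auto simp: Q_def f_def g_def min_def max_def)
  then have "Q \<circ> f = Q \<circ> g" by blast
  moreover have "path_homotopic W (Q \<circ> g) (Q \<circ> (\<lambda>_. (0, 0)))"
  proof (rule path_homotopic_convex[OF _ Q])
    show "continuous_on {0..1} g" unfolding g_def by (intro continuous_intros)
  qed (auto simp: g_def convex_Times continuous_on_const)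
  ultimately have "path_homotopic W (Q \<circ> (\<lambda>t. (t, 0))) (Q \<circ> (\<lambda>_. (0, 0)))"
    using path_homotopic_trans by metis
  then show ?thesis by (simp add: Q_def o_def h0)
qed

lemma path_class_eq: "path_homotopic X p q \<Longrightarrow> path_class X p = path_class X q"
  unfolding path_class_def by (blast intro: path_homotopic_trans path_homotopic_sym)

lemma path_class_self: "pathin X p \<Longrightarrow> p \<in> path_class X p"
  unfolding path_class_def by (simp add: path_homotopic_refl)

lemma path_class_eqD: "pathin X q \<Longrightarrow> path_class X p = path_class X q \<Longrightarrow> path_homotopic X p q"
  using path_class_self[of X q] unfolding path_class_def by auto

lemma loops_join: "p \<in> loops X x \<Longrightarrow> q \<in> loops X x \<Longrightarrow> path_join p q \<in> loops X x"
  by (auto simp: loops_def intro: pathin_join)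

lemma loops_rev: "p \<in> loops X x \<Longrightarrow> path_rev p \<in> loops X x"
  by (auto simp: loops_def intro: pathin_rev)

lemma loops_const: "x \<in> topspace X \<Longrightarrow> (\<lambda>_. x) \<in> loops X x"
  by (auto simp: loops_def pathin_def)

lemma loops_compose: "continuous_map X Y f \<Longrightarrow> p \<in> loops X x \<Longrightarrow> f \<circ> p \<in> loops Y (f x)"
  by (auto simp: loops_def intro: pathin_compose)

lemma carrier_fundamental_group: "carrier (fundamental_group X x) = path_class X ` loops X x"
  by (simp add: fundamental_group_def)

lemma mult_fundamental_group:
  assumes "p \<in> loops X x" "q \<in> loops X x"
  shows "path_class X p \<otimes>\<^bsub>fundamental_group X x\<^esub> path_class X q = path_class X (path_join p q)"
proof -
  have "path_class X (path_join p' q') = path_class X (path_join p q)"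
    if "p' \<in> path_class X p" "q' \<in> path_class X q" for p' q'
    using that assms
    by (intro path_class_eq[symmetric] path_homotopic_join) (auto simp: path_class_def loops_def)
  moreover have "p \<in> path_class X p" "q \<in> path_class X q"
    using assms by (auto simp: loops_def intro: path_class_self)
  ultimately have "(\<Union>p'\<in>path_class X p. \<Union>q'\<in>path_class X q. path_class X (path_join p' q')) =
      path_class X (path_join p q)"
    by (intro equalityI UN_least) blast+
  then show ?thesis by (simp add: fundamental_group_def)
qed

lemma pi1_map_path_class:
  assumes "continuous_map X Y f" "pathin X p"
  shows "pi1_map Y f (path_class X p) = path_class Y (f \<circ> p)"
proof -
  have "path_class Y (f \<circ> q) = path_class Y (f \<circ> p)" if "q \<in> path_class X p" for q
    using that assms
    by (intro path_class_eq[symmetric] path_homotopic_compose) (auto simp: path_class_def)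
  then show ?thesis
    using path_class_self[OF assms(2)] unfolding pi1_map_def by blast
qed

text \<open>The identification of the fundamental group with \<open>\<Gamma>\<close> is used through the values \<open>val p\<close> on
  representing loops, where the group laws become statements about joined and reversed paths.\<close>

locale pi1_identification = group \<Gamma> for \<Gamma> :: "('h, 'm) monoid_scheme" (structure) +
  fixes X :: "'x topology" and x0 :: 'x and \<theta> :: "(real \<Rightarrow> 'x) set \<Rightarrow> 'h"
  assumes base: "x0 \<in> topspace X" and iso: "\<theta> \<in> iso (fundamental_group X x0) \<Gamma>"
begin

definition val :: "(real \<Rightarrow> 'x) \<Rightarrow> 'h" where
  "val p = \<theta> (path_class X p)"

lemma val_closed [simp]: "p \<in> loops X x0 \<Longrightarrow> val p \<in> carrier \<Gamma>"
  using iso by (auto simp: val_def iso_def hom_def carrier_fundamental_group)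

lemma val_join: "p \<in> loops X x0 \<Longrightarrow> q \<in> loops X x0 \<Longrightarrow> val (path_join p q) = val p \<otimes> val q"
  using iso by (auto simp: val_def iso_def hom_def carrier_fundamental_group simp flip: mult_fundamental_group)

lemma val_cong: "path_homotopic X p q \<Longrightarrow> val p = val q"
  by (simp add: val_def path_class_eq)

lemma val_const: "val (\<lambda>_. x0) = \<one>"
proof -
  have "path_join (\<lambda>_. x0) (\<lambda>_. x0) = (\<lambda>_. x0)" by (auto simp: path_join_def)
  then have "val (\<lambda>_. x0) \<otimes> val (\<lambda>_. x0) = val (\<lambda>_. x0)"
    using val_join[of "\<lambda>_. x0" "\<lambda>_. x0"] loops_const[OF base] by simp
  then show ?thesis
    using loops_const[OF base] by (metis l_cancel_one' val_closed)
qed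

lemma val_rev: "p \<in> loops X x0 \<Longrightarrow> val (path_rev p) = inv val p"
proof -
  assume p: "p \<in> loops X x0"
  then have "path_homotopic X (path_join p (path_rev p)) (\<lambda>_. x0)"
    using path_homotopic_join_rev[of X p] by (auto simp: loops_def)
  then have "val p \<otimes> val (path_rev p) = \<one>"
    using val_join[OF p loops_rev[OF p]] val_cong val_const by metis
  then show ?thesis
    using p by (metis inv_comm inv_equality loops_rev val_closed)
qed

lemma val_eqD:
  assumes "p \<in> loops X x0" "q \<in> loops X x0" "val p = val q"
  shows "path_homotopic X p q"
proof -
  have "path_class X p = path_class X q"
    using iso assms by (auto simp: val_def iso_def bij_betw_def inj_on_def carrier_fundamental_group)
  then show ?thesis using assms(2) by (auto simp: loops_def intro: path_class_eqD)
qed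

lemma val_surj: "g \<in> carrier \<Gamma> \<Longrightarrow> \<exists>p\<in>loops X x0. val p = g"
  using iso by (force simp: val_def iso_def bij_betw_def carrier_fundamental_group image_iff)

end

section \<open>Covering projections\<close>

text \<open>Evenly covered sets are mostly used through the sheet \<open>S\<close> at a given point and the inverse \<open>j\<close> of the
  projection on it.\<close>

lemma evenly_covered_sheet:
  assumes ev: "evenly_covered E X c T" and T: "openin X T" and e: "e \<in> topspace E" "c e \<in> T"
  obtains S j where "openin E S" "e \<in> S" "c ` S \<subseteq> T" "continuous_map (subtopology X T) E j"
    "\<And>x. x \<in> T \<Longrightarrow> j x \<in> S \<and> c (j x) = x" "\<And>y. y \<in> S \<Longrightarrow> j (c y) = y"
proof -
  obtain \<V> where "\<Union>\<V> = {e \<in> topspace E. c e \<in> T} \<and> (\<forall>V\<in>\<V>. openin E V) \<and> pairwise disjnt \<V> \<and>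
    (\<forall>V\<in>\<V>. homeomorphic_map (subtopology E V) (subtopology X T) c)"
    using ev unfolding evenly_covered_def ..
  then have V: "\<Union>\<V> = {e \<in> topspace E. c e \<in> T}" "\<forall>V\<in>\<V>. openin E V"
    "\<forall>V\<in>\<V>. homeomorphic_map (subtopology E V) (subtopology X T) c" by simp_all
  have "e \<in> \<Union>\<V>" using V(1) e by simp
  then obtain S where S: "S \<in> \<V>" "e \<in> S" by (rule UnionE)
  then have "homeomorphic_map (subtopology E S) (subtopology X T) c" using V by blast
  then obtain j where j: "homeomorphic_maps (subtopology E S) (subtopology X T) c j"
    using homeomorphic_map_maps by blast
  have sub: "S \<subseteq> topspace E" "T \<subseteq> topspace X"
    using V S T by (auto dest: openin_subset)
  show thesis
  proof (rule that[of S j])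
    show "continuous_map (subtopology X T) E j"
      using j by (auto simp: homeomorphic_maps_def continuous_map_in_subtopology)
    show "j x \<in> S \<and> c (j x) = x" if "x \<in> T" for x
      using that j sub unfolding homeomorphic_maps_def continuous_map_in_subtopology
      by (auto simp: topspace_subtopology_subset)
    show "j (c y) = y" if "y \<in> S" for y
      using that j sub unfolding homeomorphic_maps_def by (auto simp: topspace_subtopology_subset)
    show "c ` S \<subseteq> T" "openin E S" using V S by auto
  qed (use S in auto)
qed

lemma covering_projectionD:
  assumes "covering_projection E X c"
  shows "continuous_map E X c" "c ` topspace E = topspace X"
  using assms by (auto simp: covering_projection_def)

lemma covering_sheet:
  assumes "covering_projection E X c" "e \<in> topspace E"
  obtains S T j where "openin E S" "e \<in> S" "openin X T" "c ` S \<subseteq> T"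
    "continuous_map (subtopology X T) E j"
    "\<And>x. x \<in> T \<Longrightarrow> j x \<in> S \<and> c (j x) = x" "\<And>y. y \<in> S \<Longrightarrow> j (c y) = y"
proof -
  have "c e \<in> topspace X" using covering_projectionD[OF assms(1)] assms(2) by blast
  then obtain T where T: "openin X T" "c e \<in> T" "evenly_covered E X c T"
    using assms(1) unfolding covering_projection_def by blast
  show thesis
    by (rule evenly_covered_sheet[OF T(3,1) assms(2) T(2)]) (rule that, use T in auto)
qed

text \<open>Distinct points of a fibre lie in different sheets; for lifts this replaces a Hausdorff condition.\<close>

lemma covering_fibre_separated:
  assumes E: "covering_projection E X c" and e: "e \<in> topspace E" "e' \<in> topspace E" "c e = c e'" "e \<noteq> e'"
  obtains S S' where "openin E S" "openin E S'" "e \<in> S" "e' \<in> S'" "disjnt S S'"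
proof -
  have "c e \<in> topspace X" using covering_projectionD[OF E] e by blast
  then obtain T where T: "openin X T" "c e \<in> T" "evenly_covered E X c T"
    using E unfolding covering_projection_def by blast
  from T(3) obtain \<V> where "\<Union>\<V> = {e \<in> topspace E. c e \<in> T} \<and> (\<forall>V\<in>\<V>. openin E V) \<and> pairwise disjnt \<V> \<and>
    (\<forall>V\<in>\<V>. homeomorphic_map (subtopology E V) (subtopology X T) c)"
    unfolding evenly_covered_def ..
  then have V: "\<Union>\<V> = {e \<in> topspace E. c e \<in> T}" "\<forall>V\<in>\<V>. openin E V" "pairwise disjnt \<V>"
    "\<forall>V\<in>\<V>. homeomorphic_map (subtopology E V) (subtopology X T) c" by simp_all
  have "e \<in> \<Union>\<V>" "e' \<in> \<Union>\<V>" using V(1) e T by auto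
  then obtain S S' where S: "S \<in> \<V>" "S' \<in> \<V>" "e \<in> S" "e' \<in> S'" by blast
  have "S \<noteq> S'"
  proof
    assume "S = S'"
    moreover have "inj_on c (topspace (subtopology E S))"
      using V(4) S(1) homeomorphic_imp_injective_map by blast
    ultimately show False using S e V(2) by (auto simp: inj_on_def)
  qed
  then have "disjnt S S'" using V(3) S by (auto simp: pairwise_def)
  then show thesis using that S V(2) by blast
qed

text \<open>Two lifts agree on a set that is open because a sheet meets each fibre once, and closed because
  different sheets are disjoint.\<close>

lemma covering_lift_unique:
  assumes E: "covering_projection E X c" and Z: "connected_space Z"
    and f: "continuous_map Z E f" and g: "continuous_map Z E g"
    and eq: "\<And>z. z \<in> topspace Z \<Longrightarrow> c (f z) = c (g z)"
    and z0: "z0 \<in> topspace Z" "f z0 = g z0" and z: "z \<in> topspace Z"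
  shows "f z = g z"
proof (rule ccontr)
  have top: "f w \<in> topspace E" "g w \<in> topspace E" if "w \<in> topspace Z" for w
    using f g that by (auto simp: continuous_map_def)
  have pre: "openin Z {w \<in> topspace Z. f w \<in> S \<and> g w \<in> S'}" if "openin E S" "openin E S'" for S S'
    using openin_Int[OF openin_continuous_map_preimage[OF f that(1)] openin_continuous_map_preimage[OF g that(2)]]
    by (rule back_subst[where P = "openin Z"]) auto
  assume neq: "f z \<noteq> g z"
  show False
  proof (rule connected_spaceD[OF Z])
    show "openin Z {w \<in> topspace Z. f w = g w}"
    proof (subst openin_subopen, safe)
      fix w assume w: "w \<in> topspace Z" "f w = g w"
      obtain S T j where S: "openin E S" "f w \<in> S" "openin X T"
        "\<And>y. y \<in> S \<Longrightarrow> j (c y) = y"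
        by (rule covering_sheet[OF E top(1)[OF w(1)]]) blast
      have "f v = g v" if "v \<in> topspace Z" "f v \<in> S" "g v \<in> S" for v
        using S(4) eq that by metis
      then show "\<exists>A. openin Z A \<and> w \<in> A \<and> A \<subseteq> {w \<in> topspace Z. f w = g w}"
        using pre[OF S(1) S(1)] w S(2) by (intro exI[of _ "{v \<in> topspace Z. f v \<in> S \<and> g v \<in> S}"]) auto
    qed
    show "openin Z {w \<in> topspace Z. f w \<noteq> g w}"
    proof (subst openin_subopen, safe)
      fix w assume w: "w \<in> topspace Z" "f w \<noteq> g w"
      obtain S S' where S: "openin E S" "openin E S'" "f w \<in> S" "g w \<in> S'" "disjnt S S'"
        by (rule covering_fibre_separated[OF E top(1)[OF w(1)] top(2)[OF w(1)] eq[OF w(1)] w(2)])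
      then show "\<exists>A. openin Z A \<and> w \<in> A \<and> A \<subseteq> {w \<in> topspace Z. f w \<noteq> g w}"
        using pre[OF S(1,2)] w
        by (intro exI[of _ "{v \<in> topspace Z. f v \<in> S \<and> g v \<in> S'}"]) (auto simp: disjnt_def)
    qed
  qed (use z z0 neq in auto)
qed

lemma covering_path_lift_unique:
  assumes "covering_projection E X c" "pathin E r" "pathin E r'" "r 0 = r' 0"
    "\<And>t. t \<in> {0..1} \<Longrightarrow> c (r t) = c (r' t)" "t \<in> {0..1}"
  shows "r t = r' t"
proof (rule covering_lift_unique[OF assms(1), of unit_interval])
  show "connected_space unit_interval" by (simp add: connected_space_subtopology)
qed (use assms in \<open>auto simp: pathin_def\<close>)

text \<open>Lifts exist locally in the parameter, over each short interval because an evenly covered set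
  contains the homotopy there, and hence over the whole interval by Bolzano's principle.\<close>

lemma covering_homotopy_lift_local:
  assumes E: "covering_projection E X c"
    and h: "continuous_map (prod_topology Z unit_interval) X h"
    and f: "continuous_map Z E f" "\<And>z. z \<in> topspace Z \<Longrightarrow> c (f z) = h (z, 0)"
    and z0: "z0 \<in> topspace Z"
  shows "\<exists>M H. openin Z M \<and> z0 \<in> M \<and>
    continuous_map (subtopology (prod_topology Z euclideanreal) (M \<times> {0..1})) E H \<and>
    (\<forall>z\<in>M. H (z, 0) = f z \<and> (\<forall>t\<in>{0..1}. c (H (z, t)) = h (z, t)))"
proof -
  let ?Z = "prod_topology Z euclideanreal"
  have ZI: "prod_topology Z unit_interval = subtopology ?Z (topspace Z \<times> {0..1})"
    by (simp add: subtopology_Times)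
  have mono: "continuous_map (subtopology ?Z A) Y k"
    if "continuous_map (subtopology ?Z B) Y k" "A \<subseteq> B" for A B k and Y :: "'w topology"
    using that by (rule continuous_map_from_subtopology_mono)
  \<comment> \<open>\<open>P a b\<close> says that every local lift of the slice at \<open>a\<close> extends to \<open>[a, b]\<close> after its domain has been
    shrunk around \<open>z0\<close>; lifts of adjacent intervals are pasted, so \<open>P\<close> is transitive.\<close>
  define initial where "initial = (\<lambda>a N g. openin Z N \<and> z0 \<in> N \<and>
    continuous_map (subtopology Z N) E g \<and> (\<forall>z\<in>N. c (g z) = h (z, a)))"
  define lift where "lift = (\<lambda>a b N g M H. openin Z M \<and> z0 \<in> M \<and> M \<subseteq> N \<and>
    continuous_map (subtopology ?Z (M \<times> {a..b})) E H \<and>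
    (\<forall>z\<in>M. H (z, a) = g z \<and> (\<forall>t\<in>{a..b}. c (H (z, t)) = h (z, t))))"
  define P where "P = (\<lambda>a b. 0 \<le> a \<longrightarrow> b \<le> 1 \<longrightarrow>
    (\<forall>N g. initial a N g \<longrightarrow> (\<exists>M H. lift a b N g M H)))"
  have "P 0 1"
  proof (rule Bolzano)
    fix x y w assume Pxy: "P x y" and Pyw: "P y w" and le: "x \<le> y" "y \<le> w"
    show "P x w"
      unfolding P_def
    proof (intro allI impI)
      fix N g
      assume A: "0 \<le> x" "w \<le> 1" "initial x N g"
      moreover have "y \<le> 1" "0 \<le> y" using A le by auto
      ultimately obtain M H where "lift x y N g M H"
        using Pxy unfolding P_def by blast
      then have M: "openin Z M" "z0 \<in> M" "M \<subseteq> N"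
        "continuous_map (subtopology ?Z (M \<times> {x..y})) E H"
        "\<forall>z\<in>M. H (z, x) = g z \<and> (\<forall>t\<in>{x..y}. c (H (z, t)) = h (z, t))"
        by (simp_all add: lift_def)
      have "continuous_map (subtopology Z M) (subtopology ?Z (M \<times> {x..y})) (\<lambda>z. (z, y))"
        using M(1) le by (auto simp: continuous_map_in_subtopology intro!: continuous_map_pairedI)
      then have "continuous_map (subtopology Z M) E (\<lambda>z. H (z, y))"
        using continuous_map_compose[OF _ M(4)] by (auto simp: o_def)
      moreover have "\<forall>z\<in>M. c (H (z, y)) = h (z, y)" using M(5) le by auto
      ultimately have "initial y M (\<lambda>z. H (z, y))"
        using M(1,2) by (simp add: initial_def)
      then obtain M' H' where "lift y w M (\<lambda>z. H (z, y)) M' H'"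
        using Pyw \<open>0 \<le> y\<close> A(2) unfolding P_def by blast
      then have M': "openin Z M'" "z0 \<in> M'" "M' \<subseteq> M"
        "continuous_map (subtopology ?Z (M' \<times> {y..w})) E H'"
        "\<forall>z\<in>M'. H' (z, y) = H (z, y) \<and> (\<forall>t\<in>{y..w}. c (H' (z, t)) = h (z, t))"
        by (simp_all add: lift_def)
      let ?G = "\<lambda>p. if snd p \<le> y then H p else H' p"
      have "continuous_map (subtopology ?Z (M' \<times> {x..w})) E ?G"
      proof (rule continuous_map_cases_le)
        let ?T = "subtopology ?Z (M' \<times> {x..w})"
        show "continuous_map ?T euclideanreal snd"
          by (intro continuous_map_from_subtopology continuous_map_snd)
        show "continuous_map (subtopology ?T {p \<in> topspace ?T. snd p \<le> y}) E H"
          unfolding subtopology_subtopology by (rule mono[OF M(4)]) (use M' in auto)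
        show "continuous_map (subtopology ?T {p \<in> topspace ?T. y \<le> snd p}) E H'"
          unfolding subtopology_subtopology by (rule mono[OF M'(4)]) auto
        show "H p = H' p" if "p \<in> topspace ?T" "snd p = y" for p
          using that M'(5) by (cases p) auto
      qed simp
      moreover have "?G (z, x) = g z \<and> (\<forall>t\<in>{x..w}. c (?G (z, t)) = h (z, t))" if "z \<in> M'" for z
        using that M(5) M'(3,5) le by auto
      ultimately have "lift x w N g M' ?G"
        using M(3) M'(1-3) by (simp add: lift_def)
      then show "\<exists>M H. lift x w N g M H" by blast
    qed
  next
    fix x :: real assume x: "0 \<le> x" "x \<le> 1"
    have zx: "(z0, x) \<in> topspace (prod_topology Z unit_interval)" using z0 x by simp
    then have "h (z0, x) \<in> topspace X" using h by (auto simp: continuous_map_def)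
    then obtain T where T: "openin X T" "h (z0, x) \<in> T" "evenly_covered E X c T"
      using E unfolding covering_projection_def by blast
    have "openin (prod_topology Z unit_interval) {p \<in> topspace (prod_topology Z unit_interval). h p \<in> T}"
      (is "openin _ ?O") using h T(1) by (rule openin_continuous_map_preimage)
    moreover have "(z0, x) \<in> ?O" using zx T(2) by simp
    ultimately obtain A B where A: "openin Z A" "openin unit_interval B" "z0 \<in> A" "x \<in> B" "A \<times> B \<subseteq> ?O"
      unfolding openin_prod_topology_alt by meson
    then obtain d where d: "d > 0" "ball x d \<inter> {0..1} \<subseteq> B"
      unfolding openin_contains_ball by blast
    have "P a b" if ab: "a \<le> x" "x \<le> b" "b - a < d" for a b
      unfolding P_def
    proof (intro allI impI)
      fix N g
      assume "0 \<le> a" "b \<le> 1" "initial a N g"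
      then have as: "0 \<le> a" "b \<le> 1" "openin Z N" "z0 \<in> N" "continuous_map (subtopology Z N) E g"
        "\<forall>z\<in>N. c (g z) = h (z, a)"
        by (simp_all add: initial_def)
      have sub: "{a..b} \<subseteq> B" using ab d as by (auto simp: dist_real_def subset_iff)
      then have hT: "h (z, t) \<in> T" if "z \<in> A" "t \<in> {a..b}" for z t
        using A that by blast
      have "g z0 \<in> topspace E"
        using as z0 by (auto simp: continuous_map_def)
      moreover have "c (g z0) \<in> T" using as hT[OF A(3), of a] ab by auto
      ultimately obtain S j where S: "openin E S" "g z0 \<in> S" "c ` S \<subseteq> T"
        "continuous_map (subtopology X T) E j"
        "\<And>x. x \<in> T \<Longrightarrow> j x \<in> S \<and> c (j x) = x" "\<And>y. y \<in> S \<Longrightarrow> j (c y) = y"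
        by (rule evenly_covered_sheet[OF T(3,1)]) blast
      define M where "M = A \<inter> {z \<in> N. g z \<in> S}"
      have "openin (subtopology Z N) {z \<in> topspace (subtopology Z N). g z \<in> S}"
        using as(5) S(1) by (rule openin_continuous_map_preimage)
      also have "{z \<in> topspace (subtopology Z N). g z \<in> S} = {z \<in> N. g z \<in> S}"
        using openin_subset[OF as(3)] by auto
      finally have "openin Z {z \<in> N. g z \<in> S}" using as(3) by (simp add: openin_open_subtopology)
      then have M: "openin Z M" unfolding M_def using A(1) by blast
      have "continuous_map (subtopology ?Z (M \<times> {a..b})) X h"
        by (rule mono[OF h[unfolded ZI]]) (use openin_subset[OF M] as in auto)
      moreover have "h ` (M \<times> {a..b}) \<subseteq> T" using hT by (auto simp: M_def)
      ultimately have "continuous_map (subtopology ?Z (M \<times> {a..b})) (subtopology X T) h"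
        by (auto simp: continuous_map_in_subtopology)
      then have "continuous_map (subtopology ?Z (M \<times> {a..b})) E (j \<circ> h)"
        using S(4) by (rule continuous_map_compose)
      moreover have "(j \<circ> h) (z, a) = g z" if "z \<in> M" for z
        using that as(6) S(6)[of "g z"] by (auto simp: M_def)
      moreover have "c ((j \<circ> h) (z, t)) = h (z, t)" if "z \<in> M" "t \<in> {a..b}" for z t
        using that S(5) hT by (auto simp: M_def)
      moreover have "z0 \<in> M" "M \<subseteq> N" using A as S by (auto simp: M_def)
      ultimately have "lift a b N g M (j \<circ> h)" using M by (simp add: lift_def)
      then show "\<exists>M H. lift a b N g M H" by blast
    qed
    then show "\<exists>d>0. \<forall>a b. a \<le> x \<and> x \<le> b \<and> b - a < d \<longrightarrow> P a b" using d by blast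
  qed simp
  moreover have "initial 0 (topspace Z) f"
    using f z0 by (simp add: initial_def)
  ultimately obtain M H where "lift 0 1 (topspace Z) f M H" unfolding P_def by blast
  then show ?thesis unfolding lift_def by blast
qed

text \<open>By uniqueness of path lifts the local lifts agree on each slice \<open>{w} \<times> [0,1]\<close>, wherever it is
  contained in the domain of several of them.\<close>

theorem covering_homotopy_lift:
  assumes E: "covering_projection E X c"
    and h: "continuous_map (prod_topology Z unit_interval) X h"
    and f: "continuous_map Z E f" "\<And>z. z \<in> topspace Z \<Longrightarrow> c (f z) = h (z, 0)"
  obtains H where "continuous_map (prod_topology Z unit_interval) E H"
    "\<And>z. z \<in> topspace Z \<Longrightarrow> H (z, 0) = f z"
    "\<And>z t. z \<in> topspace Z \<Longrightarrow> t \<in> {0..1} \<Longrightarrow> c (H (z, t)) = h (z, t)"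
proof -
  let ?Z = "prod_topology Z euclideanreal"
  have "\<forall>z\<in>topspace Z. \<exists>M H. openin Z M \<and> z \<in> M \<and>
      continuous_map (subtopology ?Z (M \<times> {0..1})) E H \<and>
      (\<forall>z\<in>M. H (z, 0) = f z \<and> (\<forall>t\<in>{0..1}. c (H (z, t)) = h (z, t)))"
    using covering_homotopy_lift_local[OF E h f] by blast
  then obtain M H where M: "\<And>z. z \<in> topspace Z \<Longrightarrow> openin Z (M z) \<and> z \<in> M z \<and>
      continuous_map (subtopology ?Z (M z \<times> {0..1})) E (H z) \<and>
      (\<forall>w\<in>M z. H z (w, 0) = f w \<and> (\<forall>t\<in>{0..1}. c (H z (w, t)) = h (w, t)))"
    by metis
  have slice: "pathin E (\<lambda>t. H z (w, t))" if "z \<in> topspace Z" "w \<in> M z" for z w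
  proof -
    have w: "w \<in> topspace Z" using that M openin_subset by blast
    have "continuous_map unit_interval (subtopology ?Z (M z \<times> {0..1})) (Pair w)"
      using that w by (auto simp: continuous_map_in_subtopology intro!: continuous_map_pairedI)
    then show ?thesis
      unfolding pathin_def using M[OF that(1)] continuous_map_compose[of unit_interval _ "Pair w" E "H z"]
      by (auto simp: o_def)
  qed
  define G where "G = (\<lambda>(z, t). H z (z, t))"
  have eq: "G (w, t) = H z (w, t)" if "z \<in> topspace Z" "w \<in> M z" "t \<in> {0..1}" for z w t
  proof -
    have w: "w \<in> topspace Z" "w \<in> M w" using that M openin_subset by blast+
    show ?thesis
      unfolding G_def split
      by (rule covering_path_lift_unique[OF E slice slice]) (use M w that in auto)
  qed
  show thesis
  proof (rule that[of G])
    show "continuous_map (prod_topology Z unit_interval) E G"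
    proof (rule continuous_map_locally)
      fix x assume "x \<in> topspace (prod_topology Z unit_interval)"
      then obtain z t where x: "x = (z, t)" "z \<in> topspace Z" "t \<in> {0..1}" by (cases x) auto
      let ?U = "M z \<times> {0..1}"
      have "openin (prod_topology Z unit_interval) ?U"
        using M[OF x(2)] by (simp add: openin_prod_Times_iff)
      moreover have sub: "subtopology (prod_topology Z unit_interval) ?U = subtopology ?Z ?U"
        using M[OF x(2)] by (simp add: subtopology_Times subtopology_subtopology)
      moreover have "continuous_map (subtopology ?Z ?U) E G"
        by (rule continuous_map_eq[of _ _ "H z"]) (use M[OF x(2)] eq[OF x(2)] in auto)
      ultimately show "\<exists>U. openin (prod_topology Z unit_interval) U \<and> x \<in> U \<and>
          continuous_map (subtopology (prod_topology Z unit_interval) U) E G"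
        using x M[OF x(2)] by (intro exI[of _ ?U]) auto
    qed
  qed (use M in \<open>auto simp: G_def\<close>)
qed

lemma covering_path_lift:
  assumes E: "covering_projection E X c" and p: "pathin X p" and e: "e \<in> topspace E" "c e = p 0"
  obtains r where "pathin E r" "r 0 = e" "\<And>t. t \<in> {0..1} \<Longrightarrow> c (r t) = p t"
proof -
  let ?Z = "discrete_topology {()}"
  have "continuous_map (prod_topology ?Z unit_interval) X (p \<circ> snd)"
    using p unfolding pathin_def by (rule continuous_map_compose[OF continuous_map_snd])
  then obtain H where H: "continuous_map (prod_topology ?Z unit_interval) E H"
    "\<And>z. z \<in> topspace ?Z \<Longrightarrow> H (z, 0) = e"
    "\<And>z t. z \<in> topspace ?Z \<Longrightarrow> t \<in> {0..1} \<Longrightarrow> c (H (z, t)) = (p \<circ> snd) (z, t)"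
    by (rule covering_homotopy_lift[OF E, of ?Z _ "\<lambda>_. e"]) (use e in auto)
  have "continuous_map unit_interval (prod_topology ?Z unit_interval) (Pair ())"
    by (auto intro!: continuous_map_pairedI)
  then have "pathin E (\<lambda>t. H ((), t))"
    unfolding pathin_def using continuous_map_compose[OF _ H(1)] by (auto simp: o_def)
  then show thesis by (rule that) (use H in auto)
qed

lemma covering_path_lift_end:
  assumes E: "covering_projection E X c" and p: "pathin X p" and e: "e \<in> topspace E" "c e = p 1"
  obtains r where "pathin E r" "r 1 = e" "\<And>t. t \<in> {0..1} \<Longrightarrow> c (r t) = p t"
proof -
  obtain q where q: "pathin E q" "q 0 = e" "\<And>t. t \<in> {0..1} \<Longrightarrow> c (q t) = path_rev p t"
    by (rule covering_path_lift[OF E pathin_rev[OF p] e(1)]) (use e in auto)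
  show thesis
    by (rule that[of "path_rev q"]) (use q pathin_rev in \<open>auto simp: path_rev_def\<close>)
qed

text \<open>The lift of a homotopy of paths moves the end inside a fibre, where it has to stay fixed because
  lifts of constant paths are constant.\<close>

lemma covering_lift_homotopic_end:
  assumes E: "covering_projection E X c" and r: "pathin E r" "pathin E r'" "r 0 = r' 0"
    and hom: "path_homotopic X (c \<circ> r) (c \<circ> r')"
  shows "r 1 = r' 1"
proof -
  obtain h where h: "continuous_map (prod_topology unit_interval unit_interval) X h"
    "\<And>s. h (0, s) = (c \<circ> r) s" "\<And>s. h (1, s) = (c \<circ> r') s"
    "\<And>t. t \<in> {0..1} \<Longrightarrow> h (t, 0) = (c \<circ> r) 0 \<and> h (t, 1) = (c \<circ> r) 1"
    using hom by (rule path_homotopicE) blast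
  have r0: "r 0 \<in> topspace E" using r(1) pathin_topspace[of E r 0] by simp
  obtain H where H: "continuous_map (prod_topology unit_interval unit_interval) E H"
    "\<And>z. z \<in> topspace unit_interval \<Longrightarrow> H (z, 0) = r 0"
    "\<And>z t. z \<in> topspace unit_interval \<Longrightarrow> t \<in> {0..1} \<Longrightarrow> c (H (z, t)) = h (z, t)"
    by (rule covering_homotopy_lift[OF E h(1), of "\<lambda>_. r 0"]) (use h(4) r0 in auto)
  have slice: "pathin E (\<lambda>t. H (s, t))" "pathin E (\<lambda>t. H (t, s))" if "s \<in> {0..1}" for s
  proof -
    have "continuous_map unit_interval (prod_topology unit_interval unit_interval) (Pair s)"
      "continuous_map unit_interval (prod_topology unit_interval unit_interval) (\<lambda>t. (t, s))"
      using that by (auto simp: continuous_on_Pair continuous_on_const continuous_on_id)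
    from this[THEN continuous_map_compose[OF _ H(1)]]
    show "pathin E (\<lambda>t. H (s, t))" "pathin E (\<lambda>t. H (t, s))"
      by (simp_all add: pathin_def o_def)
  qed
  have "H (0, 1) = r 1"
    by (rule covering_path_lift_unique[OF E slice(1) r(1)]) (use h(2) H in auto)
  moreover have "H (1, 1) = r' 1"
    by (rule covering_path_lift_unique[OF E slice(1) r(2)]) (use h(3) H r in auto)
  moreover have "H (1, 1) = H (0, 1)"
  proof (rule covering_path_lift_unique[OF E slice(2), of 1 "\<lambda>_. H (0, 1)" 1])
    show "pathin E (\<lambda>_. H (0, 1))"
      using slice(1)[of 0] pathin_topspace[of E _ 1] by (auto simp: pathin_def)
    show "c (H (t, 1)) = c (H (0, 1))" if "t \<in> {0..1}" for t
      using that h(4)[OF that] h(4)[of 0] H(3)[of t 1] H(3)[of 0 1] by simp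
  qed auto
  ultimately show ?thesis by simp
qed

lemma covering_lift_homotopic_start:
  assumes "covering_projection E X c" "pathin E r" "pathin E r'" "r 1 = r' 1"
    "path_homotopic X (c \<circ> r) (c \<circ> r')"
  shows "r 0 = r' 0"
  using covering_lift_homotopic_end[of E X c "path_rev r" "path_rev r'"] assms
    path_homotopic_rev[OF assms(5)] by (simp add: pathin_rev comp_path_rev)

text \<open>If the loop formed by the projections of two paths with the same start \<open>e0\<close> is homotopic to the
  projection of a loop at \<open>e0\<close>, it lifts to a loop, whose two halves are the given paths.\<close>

lemma covering_loop_closing:
  assumes E: "covering_projection E X c"
    and r: "pathin E r" "pathin E r'" "r 0 = r' 0" "c (r 1) = c (r' 1)"
    and l: "l \<in> loops E (r 0)"
    and hom: "path_homotopic X (path_join (c \<circ> r) (path_rev (c \<circ> r'))) (c \<circ> l)"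
  shows "r 1 = r' 1"
proof -
  let ?p = "path_join (c \<circ> r) (path_rev (c \<circ> r'))"
  have r0: "r 0 \<in> topspace E" using r(1) pathin_topspace[of E r 0] by simp
  obtain q where q: "pathin E q" "q 0 = r 0" "\<And>t. t \<in> {0..1} \<Longrightarrow> c (q t) = ?p t"
    by (rule covering_path_lift[OF E path_homotopic_imp(1)[OF hom] r0]) auto
  have "path_homotopic X (c \<circ> q) (c \<circ> l)"
    using path_homotopic_eq[OF path_homotopic_imp(1)[OF hom], of "c \<circ> q"] q(3) hom
    by (metis comp_apply path_homotopic_sym path_homotopic_trans)
  then have q1: "q 1 = r 0"
    using covering_lift_homotopic_end[OF E q(1)] l q(2) by (auto simp: loops_def)
  have "pathin E (q \<circ> (\<lambda>t. t / 2))" "pathin E (q \<circ> (\<lambda>t. 1 - t / 2))"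
    by (rule pathin_reparam[OF q(1)]; (intro continuous_intros)?; auto)+
  then have h: "pathin E (\<lambda>t. q (t / 2))" "pathin E (\<lambda>t. q (1 - t / 2))" by (auto simp: o_def)
  have "q (1 / 2) = r 1"
    by (rule covering_path_lift_unique[OF E h(1) r(1)]) (use q in \<open>auto simp: path_join_def\<close>)
  moreover have "q (1 - 1 / 2) = r' 1"
  proof (rule covering_path_lift_unique[OF E h(2) r(2)])
    show "c (q (1 - t / 2)) = c (r' t)" if "t \<in> {0..1}" for t
      using that q(3)[of "1 - t / 2"] r(4) by (cases "t = 1") (auto simp: path_join_def path_rev_def)
  qed (use q1 r in auto)
  ultimately show ?thesis by simp
qed

lemma contractible_spaceE:
  assumes "contractible_space Z" "topspace Z \<noteq> {}"
  obtains a k where "a \<in> topspace Z" "continuous_map (prod_topology Z unit_interval) Z k"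
    "\<And>z. k (z, 0) = z" "\<And>z. k (z, 1) = a"
proof -
  obtain a where hom: "homotopic_with (\<lambda>x. True) Z Z id (\<lambda>x. a)"
    using assms(1) unfolding contractible_space_def by blast
  then obtain h where h: "continuous_map (prod_topology unit_interval Z) Z h"
    "\<And>w. h (0, w) = w" "\<And>w. h (1, w) = a"
    unfolding homotopic_with_def by auto
  have "a \<in> topspace Z"
    using homotopic_with_imp_continuous_maps[OF hom] assms(2) by auto
  moreover have "continuous_map (prod_topology Z unit_interval) Z (\<lambda>x. h (snd x, fst x))"
    by (intro continuous_map_compose[OF _ h(1), unfolded o_def] continuous_map_pairedI
        continuous_map_fst continuous_map_snd)
  ultimately show thesis
    using h by (intro that[of a "\<lambda>x. h (snd x, fst x)"]) auto
qed

text \<open>A map from a contractible space is homotopic to a constant map, which lifts; the lift of the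
  homotopy ends in a lift of the map.  The constant is chosen so that the track of \<open>z0\<close> ends at \<open>e0\<close>.\<close>

lemma contractible_lift:
  assumes E: "covering_projection E X c" and Z: "contractible_space Z"
    and f: "continuous_map Z X f" and z0: "z0 \<in> topspace Z" and e0: "e0 \<in> topspace E" "c e0 = f z0"
  obtains F where "continuous_map Z E F" "F z0 = e0" "\<And>z. z \<in> topspace Z \<Longrightarrow> c (F z) = f z"
proof -
  obtain a k where k: "a \<in> topspace Z" "continuous_map (prod_topology Z unit_interval) Z k"
    "\<And>z. k (z, 0) = z" "\<And>z. k (z, 1) = a"
    using contractible_spaceE[OF Z] z0 by blast
  have fk: "continuous_map (prod_topology Z unit_interval) X (\<lambda>x. f (k x))"
    using continuous_map_compose[OF k(2) f] by (simp add: o_def)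
  have "continuous_map unit_interval (prod_topology Z unit_interval) (Pair z0)"
    using z0 by (auto intro!: continuous_map_pairedI)
  then have "pathin X (\<lambda>t. f (k (z0, t)))"
    unfolding pathin_def using continuous_map_compose[OF _ fk] by (auto simp: o_def)
  then obtain r where r: "pathin E r" "r 0 = e0" "\<And>t. t \<in> {0..1} \<Longrightarrow> c (r t) = f (k (z0, t))"
    by (rule covering_path_lift[OF E _ e0(1)]) (use e0 k in auto)
  have "continuous_map (prod_topology Z unit_interval) unit_interval (\<lambda>x. 1 - snd x)"
    by (intro continuous_map_unit_intervalI continuous_map_diff
        continuous_map_top_of_set_real[OF continuous_map_snd]) auto
  then have "continuous_map (prod_topology Z unit_interval) X (\<lambda>x. f (k (fst x, 1 - snd x)))"
    by (intro continuous_map_compose[OF _ fk, unfolded o_def] continuous_map_pairedI continuous_map_fst)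
  then obtain H where H: "continuous_map (prod_topology Z unit_interval) E H"
    "\<And>z. z \<in> topspace Z \<Longrightarrow> H (z, 0) = r 1"
    "\<And>z t. z \<in> topspace Z \<Longrightarrow> t \<in> {0..1} \<Longrightarrow> c (H (z, t)) = f (k (fst (z, t), 1 - snd (z, t)))"
    by (rule covering_homotopy_lift[OF E, of Z _ "\<lambda>_. r 1"])
      (use r(3)[of 1] k pathin_topspace[OF r(1), of 1] in auto)
  have slice: "continuous_map Z (prod_topology Z unit_interval) (\<lambda>z. (z, 1))"
    "continuous_map unit_interval (prod_topology Z unit_interval) (Pair z0)"
    using z0 by (auto intro!: continuous_map_pairedI)
  have "H (z0, 1) = path_rev r 1"
  proof (rule covering_path_lift_unique[OF E])
    show "pathin E (\<lambda>t. H (z0, t))"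
      unfolding pathin_def using continuous_map_compose[OF slice(2) H(1)] by (simp add: o_def)
  qed (use r H z0 pathin_rev[OF r(1)] in \<open>auto simp: path_rev_def\<close>)
  moreover have "continuous_map Z E (\<lambda>z. H (z, 1))"
    using continuous_map_compose[OF slice(1) H(1)] by (simp add: o_def)
  ultimately show thesis
    using r H k by (intro that[of "\<lambda>z. H (z, 1)"]) auto
qed

lemma covering_open_map:
  assumes E: "covering_projection E X c"
  shows "open_map E X c"
  unfolding open_map_def
proof (intro allI impI)
  fix U assume U: "openin E U"
  show "openin X (c ` U)"
  proof (subst openin_subopen, safe)
    fix e assume e: "e \<in> U"
    then have "e \<in> topspace E" using U openin_subset by blast
    then obtain S T j where S: "openin E S" "e \<in> S" "openin X T" "c ` S \<subseteq> T"
      "continuous_map (subtopology X T) E j"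
      "\<And>x. x \<in> T \<Longrightarrow> j x \<in> S \<and> c (j x) = x" "\<And>y. y \<in> S \<Longrightarrow> j (c y) = y"
      by (rule covering_sheet[OF E]) blast
    have "openin (subtopology X T) {x \<in> topspace (subtopology X T). j x \<in> U}"
      using S(5) U by (rule openin_continuous_map_preimage)
    then have "openin X {x \<in> topspace (subtopology X T). j x \<in> U}"
      using S(3) by (simp add: openin_open_subtopology)
    moreover have "c e \<in> {x \<in> topspace (subtopology X T). j x \<in> U}"
      using S e openin_subset[OF S(3)] by auto
    moreover have "{x \<in> topspace (subtopology X T). j x \<in> U} \<subseteq> c ` U"
      using S(6) by (auto simp: image_iff) (metis)
    ultimately show "\<exists>A. openin X A \<and> c e \<in> A \<and> A \<subseteq> c ` U" by blast
  qed
qed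

text \<open>Over the image of a small open set under the open map \<open>c\<close>, a set on which \<open>p\<close> is injective
  contains no other points than the values of \<open>f\<close>.\<close>

lemma open_map_into_locally_injective:
  assumes f: "continuous_map D T f" and c: "open_map D X c" and p: "continuous_map T X p"
    and inj: "\<And>x. x \<in> topspace T \<Longrightarrow> \<exists>N. openin T N \<and> x \<in> N \<and> inj_on p N"
    and cf: "\<And>z. z \<in> topspace D \<Longrightarrow> p (f z) = c z"
  shows "open_map D T f"
  unfolding open_map_def
proof (intro allI impI)
  fix U assume U: "openin D U"
  show "openin T (f ` U)"
  proof (subst openin_subopen, safe)
    fix z assume z: "z \<in> U"
    then have "f z \<in> topspace T" using U f openin_subset by (fastforce simp: continuous_map_def)
    then obtain N where N: "openin T N" "f z \<in> N" "inj_on p N" using inj by blast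
    let ?O = "U \<inter> {z \<in> topspace D. f z \<in> N}"
    let ?A = "N \<inter> {x \<in> topspace T. p x \<in> c ` ?O}"
    have "openin D ?O" using U openin_continuous_map_preimage[OF f N(1)] by blast
    then have "openin X (c ` ?O)" using c by (simp add: open_map_def)
    then have "openin T ?A" using N(1) openin_continuous_map_preimage[OF p] by blast
    moreover have zD: "z \<in> topspace D" using z U openin_subset by blast
    moreover have "p (f z) \<in> c ` ?O" using cf[OF zD] z zD N(2) by auto
    then have "f z \<in> ?A" using N(2) \<open>f z \<in> topspace T\<close> by simp
    moreover have "?A \<subseteq> f ` U"
    proof
      fix x assume x: "x \<in> ?A"
      then obtain v where v: "v \<in> ?O" "p x = c v" by blast
      then have "p x = p (f v)" "f v \<in> N" using cf by auto
      then have "x = f v" using N(3) x by (auto simp: inj_on_def)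
      then show "x \<in> f ` U" using v by blast
    qed
    ultimately show "\<exists>A. openin T A \<and> f z \<in> A \<and> A \<subseteq> f ` U" by blast
  qed
qed

lemma evenly_covered_section:
  assumes "evenly_covered E X c T" "openin X T" "c ` topspace E = topspace X"
  obtains j where "continuous_map (subtopology X T) E j" "\<And>x. x \<in> T \<Longrightarrow> c (j x) = x"
proof (cases "T = {}")
  case True
  then show thesis using that[of undefined] by simp
next
  case False
  then obtain e where "e \<in> topspace E" "c e \<in> T"
    using assms openin_subset by (metis (no_types, lifting) equals0I imageE subsetD)
  then show thesis
    by (rule evenly_covered_sheet[OF assms(1,2)]) (use that in blast)
qed

section \<open>The semi-direct product acting on the coefficient group\<close>

locale group_derivation = K: group K + G: group G
  for K :: "('k, 'm) monoid_scheme" and G :: "('g, 'n) monoid_scheme" +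
  fixes a :: "'g \<Rightarrow> 'k \<Rightarrow> 'k" and d :: "'g \<Rightarrow> 'k"
  assumes a_hom: "a \<in> hom G (AutoGroup K)" and deriv: "derivation K G a d"
begin

abbreviation SD where "SD \<equiv> semidirect_product K G a"
abbreviation act where "act \<equiv> derivation_action K a d"

lemma a_auto: "g \<in> carrier G \<Longrightarrow> a g \<in> auto K"
  using a_hom by (auto simp: hom_def AutoGroup_def)

lemma a_closed [simp]: "g \<in> carrier G \<Longrightarrow> k \<in> carrier K \<Longrightarrow> a g k \<in> carrier K"
  using a_auto by (auto simp: auto_def hom_def)

lemma a_mult: "g \<in> carrier G \<Longrightarrow> k \<in> carrier K \<Longrightarrow> l \<in> carrier K \<Longrightarrow>
    a g (k \<otimes>\<^bsub>K\<^esub> l) = a g k \<otimes>\<^bsub>K\<^esub> a g l"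
  using a_auto by (auto simp: auto_def hom_def)

lemma a_comp: "g \<in> carrier G \<Longrightarrow> h \<in> carrier G \<Longrightarrow> k \<in> carrier K \<Longrightarrow>
    a (g \<otimes>\<^bsub>G\<^esub> h) k = a g (a h k)"
  using a_auto[of g] a_auto[of h] hom_mult[OF a_hom, of g h]
  by (auto simp: AutoGroup_def BijGroup_def auto_def compose_def)

lemma a_one: "k \<in> carrier K \<Longrightarrow> a \<one>\<^bsub>G\<^esub> k = k"
  using hom_one[OF a_hom G.is_group K.AutoGroup] by (auto simp: AutoGroup_def BijGroup_def)

lemma a_of_one: "g \<in> carrier G \<Longrightarrow> a g \<one>\<^bsub>K\<^esub> = \<one>\<^bsub>K\<^esub>"
  using hom_one[of "a g" K K] a_auto K.is_group by (auto simp: auto_def)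

lemma a_inv: "g \<in> carrier G \<Longrightarrow> k \<in> carrier K \<Longrightarrow> a g (inv\<^bsub>K\<^esub> k) = inv\<^bsub>K\<^esub> (a g k)"
  by (metis K.inv_closed K.inv_equality K.l_inv a_closed a_mult a_of_one)

lemma d_closed [simp]: "g \<in> carrier G \<Longrightarrow> d g \<in> carrier K"
  using deriv by (auto simp: derivation_def)

lemma d_mult: "g \<in> carrier G \<Longrightarrow> h \<in> carrier G \<Longrightarrow> d (g \<otimes>\<^bsub>G\<^esub> h) = d g \<otimes>\<^bsub>K\<^esub> a g (d h)"
  using deriv by (auto simp: derivation_def)

lemma d_one: "d \<one>\<^bsub>G\<^esub> = \<one>\<^bsub>K\<^esub>"
  using d_mult[of "\<one>\<^bsub>G\<^esub>" "\<one>\<^bsub>G\<^esub>"] a_one[of "d \<one>\<^bsub>G\<^esub>"] by simp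

lemma SD_simps [simp]:
  "carrier SD = carrier K \<times> carrier G" "\<one>\<^bsub>SD\<^esub> = (\<one>\<^bsub>K\<^esub>, \<one>\<^bsub>G\<^esub>)"
  "(k, g) \<otimes>\<^bsub>SD\<^esub> (k', g') = (k \<otimes>\<^bsub>K\<^esub> a g k', g \<otimes>\<^bsub>G\<^esub> g')"
  by (auto simp: semidirect_product_def)

lemma group_SD: "group SD"
proof (rule groupI)
  fix x assume "x \<in> carrier SD"
  then obtain k g where x: "x = (k, g)" "k \<in> carrier K" "g \<in> carrier G" by auto
  have "a (inv\<^bsub>G\<^esub> g) (inv\<^bsub>K\<^esub> k) \<otimes>\<^bsub>K\<^esub> a (inv\<^bsub>G\<^esub> g) k = \<one>\<^bsub>K\<^esub>"
    using x a_mult[of "inv\<^bsub>G\<^esub> g" "inv\<^bsub>K\<^esub> k" k] by (simp add: a_of_one)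
  then show "\<exists>y\<in>carrier SD. y \<otimes>\<^bsub>SD\<^esub> x = \<one>\<^bsub>SD\<^esub>"
    using x by (intro bexI[of _ "(a (inv\<^bsub>G\<^esub> g) (inv\<^bsub>K\<^esub> k), inv\<^bsub>G\<^esub> g)"]) auto
next
  fix x y z assume "x \<in> carrier SD" "y \<in> carrier SD" "z \<in> carrier SD"
  then show "x \<otimes>\<^bsub>SD\<^esub> y \<otimes>\<^bsub>SD\<^esub> z = x \<otimes>\<^bsub>SD\<^esub> (y \<otimes>\<^bsub>SD\<^esub> z)"
    by (auto simp: a_mult a_comp K.m_assoc G.m_assoc)
qed (auto simp: a_one)

sublocale SD: group SD
  by (rule group_SD)

lemma act_eq: "k' \<in> carrier K \<Longrightarrow> act (k, g) k' = k \<otimes>\<^bsub>K\<^esub> a g k' \<otimes>\<^bsub>K\<^esub> inv\<^bsub>K\<^esub> (d g)"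
  by (simp add: derivation_action_def)

lemma act_closed [simp]: "x \<in> carrier SD \<Longrightarrow> k' \<in> carrier K \<Longrightarrow> act x k' \<in> carrier K"
  by (cases x) (auto simp: act_eq)

lemma act_one: "k' \<in> carrier K \<Longrightarrow> act \<one>\<^bsub>SD\<^esub> k' = k'"
  by (simp add: act_eq a_one d_one)

lemma act_mult:
  assumes "x \<in> carrier SD" "y \<in> carrier SD" "k' \<in> carrier K"
  shows "act (x \<otimes>\<^bsub>SD\<^esub> y) k' = act x (act y k')"
  using assms
  by (cases x; cases y)
    (auto simp: act_eq a_mult a_comp a_inv d_mult K.m_assoc K.inv_mult_group)

lemma act_bij: "x \<in> carrier SD \<Longrightarrow> act x \<in> Bij (carrier K)"
proof -
  assume x: "x \<in> carrier SD"
  have "bij_betw (act x) (carrier K) (carrier K)"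
  proof (rule bij_betw_byWitness[where f' = "act (inv\<^bsub>SD\<^esub> x)"])
    have ix: "inv\<^bsub>SD\<^esub> x \<in> carrier SD" using x by (rule SD.inv_closed)
    show "\<forall>k\<in>carrier K. act (inv\<^bsub>SD\<^esub> x) (act x k) = k"
      using act_mult[OF ix x] SD.l_inv[OF x] act_one by metis
    show "\<forall>k\<in>carrier K. act x (act (inv\<^bsub>SD\<^esub> x) k) = k"
      using act_mult[OF x ix] SD.r_inv[OF x] act_one by metis
    show "act x ` carrier K \<subseteq> carrier K" "act (inv\<^bsub>SD\<^esub> x) ` carrier K \<subseteq> carrier K"
      using x ix act_closed by blast+
  qed
  then show ?thesis
    by (cases x) (auto simp: Bij_def derivation_action_def)
qed

lemma group_action_act: "group_action SD (carrier K) act"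
  unfolding group_action_def group_hom_def group_hom_axioms_def
proof (intro conjI)
  show "act \<in> hom SD (BijGroup (carrier K))"
  proof (rule homI)
    fix x y assume xy: "x \<in> carrier SD" "y \<in> carrier SD"
    then have "x \<otimes>\<^bsub>SD\<^esub> y \<in> carrier SD" by (rule SD.m_closed)
    then have "act (x \<otimes>\<^bsub>SD\<^esub> y) \<in> extensional (carrier K)"
      using act_bij by (auto simp: Bij_def)
    then have "act (x \<otimes>\<^bsub>SD\<^esub> y) = compose (carrier K) (act x) (act y)"
      by (rule extensionalityI) (auto simp: compose_def act_mult[OF xy])
    then show "act (x \<otimes>\<^bsub>SD\<^esub> y) = act x \<otimes>\<^bsub>BijGroup (carrier K)\<^esub> act y"
      using act_bij[OF xy(1)] act_bij[OF xy(2)] by (simp add: BijGroup_def)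
  qed (use act_bij in \<open>simp add: BijGroup_def\<close>)
qed (rule group_SD, rule group_BijGroup)

text \<open>The stabiliser of the neutral element is the image of the splitting, so the orbit map identifies
  the cosets of that image with the coefficient group.\<close>

lemma act_stabiliser:
  assumes "x \<in> carrier SD"
  shows "act x \<one>\<^bsub>K\<^esub> = \<one>\<^bsub>K\<^esub> \<longleftrightarrow> x \<in> splitting d ` carrier G"
proof -
  obtain k g where x: "x = (k, g)" "k \<in> carrier K" "g \<in> carrier G" using assms by auto
  have "k \<otimes>\<^bsub>K\<^esub> inv\<^bsub>K\<^esub> d g = \<one>\<^bsub>K\<^esub> \<longleftrightarrow> k = d g"
    using x K.inv_solve_right[of "\<one>\<^bsub>K\<^esub>" k "d g"] by auto
  then show ?thesis using x by (auto simp: act_eq a_of_one splitting_def)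
qed

lemma act_one_eq_iff:
  assumes x: "x \<in> carrier SD" and y: "y \<in> carrier SD"
  shows "act x \<one>\<^bsub>K\<^esub> = act y \<one>\<^bsub>K\<^esub> \<longleftrightarrow> inv\<^bsub>SD\<^esub> x \<otimes>\<^bsub>SD\<^esub> y \<in> splitting d ` carrier G"
proof -
  have ix: "inv\<^bsub>SD\<^esub> x \<in> carrier SD" using x by (rule SD.inv_closed)
  have "act (inv\<^bsub>SD\<^esub> x \<otimes>\<^bsub>SD\<^esub> y) \<one>\<^bsub>K\<^esub> = \<one>\<^bsub>K\<^esub> \<longleftrightarrow> act (inv\<^bsub>SD\<^esub> x) (act y \<one>\<^bsub>K\<^esub>) = \<one>\<^bsub>K\<^esub>"
    using act_mult[OF ix y] by simp
  also have "\<dots> \<longleftrightarrow> act x \<one>\<^bsub>K\<^esub> = act y \<one>\<^bsub>K\<^esub>"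
    using act_mult[OF x ix] act_mult[OF ix x] SD.l_inv[OF x] SD.r_inv[OF x] act_one
      act_closed[OF y K.one_closed] K.one_closed by metis
  finally show ?thesis
    using act_stabiliser[OF SD.m_closed[OF ix y]] by simp
qed

end

section \<open>The fibre of the covering determined by a subgroup\<close>

context pi1_identification
begin

text \<open>The subgroup of a covering consists of the values of the loops that lift to loops at \<open>e0\<close>.\<close>

lemma covering_determined_byE:
  assumes "covering_determined_by X x0 \<theta> L E c"
  obtains e0 where "e0 \<in> topspace E" "c e0 = x0"
    "\<And>l. l \<in> loops E e0 \<Longrightarrow> val (c \<circ> l) \<in> L"
    "\<And>g. g \<in> L \<Longrightarrow> \<exists>l\<in>loops E e0. val (c \<circ> l) = g"
proof -
  obtain e0 where e0: "e0 \<in> topspace E" "c e0 = x0"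
    "\<theta> ` pi1_map X c ` carrier (fundamental_group E e0) = L"
    using assms unfolding covering_determined_by_def by blast
  have "continuous_map E X c"
    using assms covering_projectionD unfolding covering_determined_by_def by blast
  then have "pi1_map X c (path_class E l) = path_class X (c \<circ> l)" if "l \<in> loops E e0" for l
    using that by (intro pi1_map_path_class) (auto simp: loops_def)
  then have "L = (\<lambda>l. val (c \<circ> l)) ` loops E e0"
    unfolding e0(3)[symmetric] carrier_fundamental_group image_image val_def
    by (intro image_cong) auto
  then show thesis using that e0 by auto
qed

lemma loop_over:
  assumes "continuous_map E X c" "pathin E r" "c (r 0) = x0" "c (r 1) = x0"
  shows "c \<circ> r \<in> loops X x0"
  using assms by (auto simp: loops_def intro: pathin_compose)

lemma monodromy_eq:
  assumes E: "covering_projection E X c" and q: "pathin E q" "c \<circ> q \<in> A" and A: "A \<in> carrier (fundamental_group X x0)"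
  shows "monodromy E c A (q 1) = q 0"
  unfolding monodromy_def
proof (rule the_equality)
  show "\<exists>p. pathin E p \<and> p 0 = q 0 \<and> p 1 = q 1 \<and> c \<circ> p \<in> A" using q by blast
next
  fix e' assume "\<exists>p. pathin E p \<and> p 0 = e' \<and> p 1 = q 1 \<and> c \<circ> p \<in> A"
  then obtain p where p: "pathin E p" "p 0 = e'" "p 1 = q 1" "c \<circ> p \<in> A" by blast
  have "path_homotopic X (c \<circ> p) (c \<circ> q)"
    using p(4) q(2) A path_homotopic_sym path_homotopic_trans
    unfolding carrier_fundamental_group path_class_def by blast
  then show "e' = q 0"
    using covering_lift_homotopic_start[OF E p(1) q(1)] p by simp
qed

end

text \<open>A point \<open>e\<close> of the fibre is sent to the translate of the neutral element by the class of the
  projection of any path from \<open>e\<close> to the base point; the choice of the path changes that class by an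
  element of the subgroup, which is the stabiliser.\<close>

theorem (in group_derivation) fibre_bijection:
  fixes X :: "'x topology" and E :: "'e topology"
  assumes base: "x0 \<in> topspace X" and \<theta>: "\<theta> \<in> iso (fundamental_group X x0) SD"
    and det: "covering_determined_by X x0 \<theta> (splitting d ` carrier G) E c"
  shows "\<exists>\<phi>. bij_betw \<phi> {e \<in> topspace E. c e = x0} (carrier K) \<and>
    (\<forall>A\<in>carrier (fundamental_group X x0). \<forall>e\<in>{e \<in> topspace E. c e = x0}.
      \<phi> (monodromy E c A e) = act (\<theta> A) (\<phi> e))"
proof -
  interpret pi1_identification SD X x0 \<theta>
    by unfold_locales (use base \<theta> in auto)
  let ?L = "splitting d ` carrier G"
  let ?F = "{e \<in> topspace E. c e = x0}"
  have E: "covering_projection E X c" and pc: "path_connected_space E"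
    using det by (auto simp: covering_determined_by_def)
  have c: "continuous_map E X c" by (rule covering_projectionD[OF E])
  obtain e0 where e0: "e0 \<in> topspace E" "c e0 = x0"
    and L1: "\<And>l. l \<in> loops E e0 \<Longrightarrow> val (c \<circ> l) \<in> ?L"
    and L2: "\<And>g. g \<in> ?L \<Longrightarrow> \<exists>l\<in>loops E e0. val (c \<circ> l) = g"
    using det by (rule covering_determined_byE) blast
  define conn where "conn = (\<lambda>e r. pathin E r \<and> r 0 = e \<and> r 1 = e0)"
  have conn_loop: "c \<circ> r \<in> loops X x0" if "conn e r" "e \<in> ?F" for e r
    using that e0 c by (intro loop_over) (auto simp: conn_def)
  have conn_ex: "\<exists>r. conn e r" if "e \<in> ?F" for e
    using pc that e0(1) by (simp add: path_connected_space_def conn_def)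
  have wd: "act (val (c \<circ> r)) \<one>\<^bsub>K\<^esub> = act (val (c \<circ> r')) \<one>\<^bsub>K\<^esub>"
    if r: "conn e r" "conn e r'" and e: "e \<in> ?F" for e r r'
  proof -
    have "path_join (path_rev r) r' \<in> loops E e0"
      using r by (auto simp: conn_def loops_def intro: pathin_join pathin_rev)
    from L1[OF this] have "val (path_join (path_rev (c \<circ> r)) (c \<circ> r')) \<in> ?L"
      by (simp add: comp_path_join comp_path_rev)
    then have "inv\<^bsub>SD\<^esub> val (c \<circ> r) \<otimes>\<^bsub>SD\<^esub> val (c \<circ> r') \<in> ?L"
      using conn_loop[OF r(1) e] conn_loop[OF r(2) e] by (simp add: val_join val_rev loops_rev)
    then show ?thesis
      using act_one_eq_iff[OF val_closed val_closed] conn_loop r e by blast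
  qed
  define \<phi> where "\<phi> = (\<lambda>e. act (val (c \<circ> (SOME r. conn e r))) \<one>\<^bsub>K\<^esub>)"
  have \<phi>: "\<phi> e = act (val (c \<circ> r)) \<one>\<^bsub>K\<^esub>" if "conn e r" "e \<in> ?F" for e r
    unfolding \<phi>_def using wd[OF someI[of "conn e"], of r r] that by blast
  have "inj_on \<phi> ?F"
  proof (rule inj_onI)
    fix e e' assume e: "e \<in> ?F" "e' \<in> ?F" and eq: "\<phi> e = \<phi> e'"
    obtain r r' where r: "conn e r" "conn e' r'" using e conn_ex by blast
    note lp = conn_loop[OF r(1) e(1)] conn_loop[OF r(2) e(2)]
    have "inv\<^bsub>SD\<^esub> val (c \<circ> r) \<otimes>\<^bsub>SD\<^esub> val (c \<circ> r') \<in> ?L"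
      using act_one_eq_iff[OF val_closed[OF lp(1)] val_closed[OF lp(2)]] eq
        \<phi>[OF r(1) e(1)] \<phi>[OF r(2) e(2)] by simp
    then obtain l where l: "l \<in> loops E e0" "val (c \<circ> l) = inv\<^bsub>SD\<^esub> val (c \<circ> r) \<otimes>\<^bsub>SD\<^esub> val (c \<circ> r')"
      using L2 by blast
    have cl: "c \<circ> l \<in> loops X x0" using loops_compose[OF c l(1)] e0 by simp
    have rl: "pathin E (path_join r l)"
      using r l by (auto simp: conn_def loops_def intro: pathin_join)
    have "val (path_join (c \<circ> r) (c \<circ> l)) = val (c \<circ> r')"
      using SD.inv_solve_left[OF val_closed[OF cl] val_closed[OF lp(1)] val_closed[OF lp(2)]]
      unfolding val_join[OF lp(1) cl] l(2) by simp
    then have "path_homotopic X (path_join (c \<circ> r) (c \<circ> l)) (c \<circ> r')"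
      by (rule val_eqD[OF loops_join[OF lp(1) cl] lp(2)])
    then have "path_join r l 0 = r' 0"
      using r l(1) by (intro covering_lift_homotopic_start[OF E rl]) (auto simp: conn_def loops_def comp_path_join)
    then show "e = e'" using r by (auto simp: conn_def)
  qed
  moreover have "\<phi> ` ?F = carrier K"
  proof (intro equalityI subsetI)
    fix k assume "k \<in> \<phi> ` ?F"
    then obtain e r where e: "e \<in> ?F" "conn e r" "k = \<phi> e" using conn_ex by blast
    show "k \<in> carrier K"
      unfolding e(3) \<phi>[OF e(2,1)] by (rule act_closed[OF val_closed[OF conn_loop[OF e(2,1)]] K.one_closed])
  next
    fix k assume k: "k \<in> carrier K"
    \<comment> \<open>A loop in the class \<open>(k, \<one>)\<close> moves the neutral element to \<open>k\<close>, as \<open>d\<close> vanishes at \<open>\<one>\<close>.\<close>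
    then obtain p where p: "p \<in> loops X x0" "val p = (k, \<one>\<^bsub>G\<^esub>)"
      using val_surj[of "(k, \<one>\<^bsub>G\<^esub>)"] by auto
    then have pp: "pathin X p" "p 0 = x0" "p 1 = x0" by (auto simp: loops_def)
    obtain r where r: "pathin E r" "r 1 = e0" "\<And>t. t \<in> {0..1} \<Longrightarrow> c (r t) = p t"
      by (rule covering_path_lift_end[OF E pp(1) e0(1)]) (use e0 pp in auto)
    have "path_homotopic X p (c \<circ> r)" by (rule path_homotopic_eq[OF pp(1)]) (simp add: r)
    then have "val (c \<circ> r) = (k, \<one>\<^bsub>G\<^esub>)" using val_cong p(2) by metis
    moreover have "r 0 \<in> ?F" using r(3)[of 0] pp pathin_topspace[OF r(1), of 0] by simp
    moreover have "conn (r 0) r" using r by (simp add: conn_def)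
    ultimately have "\<phi> (r 0) = k" using \<phi>[of "r 0" r] k by (simp add: act_eq a_one d_one)
    then show "k \<in> \<phi> ` ?F" using \<open>r 0 \<in> ?F\<close> by blast
  qed
  ultimately have "bij_betw \<phi> ?F (carrier K)" by (simp add: bij_betw_def)
  moreover have "\<phi> (monodromy E c A e) = act (\<theta> A) (\<phi> e)"
    if A: "A \<in> carrier (fundamental_group X x0)" and e: "e \<in> ?F" for A e
  proof -
    obtain p where p: "p \<in> loops X x0" "A = path_class X p"
      using A by (auto simp: carrier_fundamental_group)
    then have pp: "pathin X p" "p 0 = x0" "p 1 = x0" by (auto simp: loops_def)
    obtain q where q: "pathin E q" "q 1 = e" "\<And>t. t \<in> {0..1} \<Longrightarrow> c (q t) = p t"
      by (rule covering_path_lift_end[OF E pp(1), of e]) (use e pp in auto)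
    have hom: "path_homotopic X p (c \<circ> q)" by (rule path_homotopic_eq[OF pp(1)]) (simp add: q)
    then have mon: "monodromy E c A e = q 0"
      using monodromy_eq[OF E q(1) _ A] q(2) p(2) by (simp add: path_class_def)
    obtain r where r: "conn e r" using conn_ex e by blast
    have q0: "q 0 \<in> ?F" using q(3)[of 0] pp pathin_topspace[OF q(1), of 0] by simp
    have "conn (q 0) (path_join q r)"
      using r q by (auto simp: conn_def intro: pathin_join)
    then have "\<phi> (q 0) = act (val (path_join (c \<circ> q) (c \<circ> r))) \<one>\<^bsub>K\<^esub>"
      using \<phi> q0 by (simp add: comp_path_join)
    also have "c \<circ> q \<in> loops X x0" using q q0 e c by (intro loop_over) auto
    then have "val (path_join (c \<circ> q) (c \<circ> r)) = val p \<otimes>\<^bsub>SD\<^esub> val (c \<circ> r)"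
      using conn_loop[OF r e] val_cong[OF hom] by (simp add: val_join)
    also have "act (val p \<otimes>\<^bsub>SD\<^esub> val (c \<circ> r)) \<one>\<^bsub>K\<^esub> = act (val p) (act (val (c \<circ> r)) \<one>\<^bsub>K\<^esub>)"
      using act_mult[OF val_closed val_closed] p(1) conn_loop[OF r e] by blast
    finally show ?thesis using mon \<phi>[OF r e] p(2) by (simp add: val_def)
  qed
  ultimately show ?thesis by blast
qed

section \<open>Lifting in Hurewicz fibrations\<close>

text \<open>Every lifting problem is a pull-back of the one posed by the space of pairs of a point of \<open>E\<close> and
  a path of \<open>B\<close> starting below it, so a solution of that one solves problems on spaces of any type.\<close>

theorem hurewicz_fibration_lift:
  fixes Z :: "'z topology"
  assumes q: "hurewicz_fibration E B q"
    and f: "continuous_map Z E f" and h: "continuous_map (prod_topology Z unit_interval) B h"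
    and start: "\<And>z. z \<in> topspace Z \<Longrightarrow> h (z, 0) = q (f z)"
  obtains H where "continuous_map (prod_topology Z unit_interval) E H"
    "\<And>z. z \<in> topspace Z \<Longrightarrow> H (z, 0) = f z"
    "\<And>z t. z \<in> topspace Z \<Longrightarrow> t \<in> {0..1} \<Longrightarrow> q (H (z, t)) = h (z, t)"
proof -
  define T where "T = subtopology (prod_topology E (mapping_space unit_interval B)) {(e, \<beta>). \<beta> 0 = q e}"
  have "continuous_map T (mapping_space unit_interval B) snd"
    unfolding T_def by (rule continuous_map_from_subtopology[OF continuous_map_snd])
  from continuous_map_uncurry[OF this]
  have ev: "continuous_map (prod_topology T unit_interval) B (\<lambda>(z, t). snd z t)" .
  have fst: "continuous_map T E fst"
    unfolding T_def by (rule continuous_map_from_subtopology[OF continuous_map_fst])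
  have T0: "(case (z, 0) of (z, t) \<Rightarrow> snd z t) = q (fst z)" if "z \<in> topspace T" for z
    using that unfolding T_def by auto
  have "\<exists>\<Lambda>. continuous_map (prod_topology T unit_interval) E \<Lambda> \<and>
    (\<forall>z\<in>topspace T. \<Lambda> (z, 0) = fst z \<and> (\<forall>t\<in>{0..1}. q (\<Lambda> (z, t)) = (case (z, t) of (z, t) \<Rightarrow> snd z t)))"
    by (rule q[unfolded hurewicz_fibration_def, THEN conjunct2, THEN spec[of _ T], THEN spec[of _ fst],
          THEN spec[of _ "\<lambda>(z, t). snd z t"], THEN mp])
      (use ev fst T0 in blast)
  then obtain \<Lambda> where \<Lambda>: "continuous_map (prod_topology T unit_interval) E \<Lambda>"
    "\<forall>z\<in>topspace T. \<Lambda> (z, 0) = fst z \<and> (\<forall>t\<in>{0..1}. q (\<Lambda> (z, t)) = (case (z, t) of (z, t) \<Rightarrow> snd z t))"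
    by (elim exE conjE)
  define g where "g = (\<lambda>z. (f z, \<lambda>t\<in>{0..1}. h (z, t)))"
  have g: "continuous_map Z T g"
    unfolding T_def continuous_map_in_subtopology g_def
    using start by (auto intro!: continuous_map_pairedI f continuous_map_curry[OF h])
  then have gT: "g z \<in> topspace T" if "z \<in> topspace Z" for z
    using that by (auto simp: continuous_map_def)
  show thesis
  proof (rule that[of "\<lambda>x. \<Lambda> (g (fst x), snd x)"])
    show "continuous_map (prod_topology Z unit_interval) E (\<lambda>x. \<Lambda> (g (fst x), snd x))"
      by (intro continuous_map_compose[OF _ \<Lambda>(1), unfolded o_def] continuous_map_pairedI
          continuous_map_compose[OF continuous_map_fst g, unfolded o_def] continuous_map_snd)
    show "\<Lambda> (g (fst (z, 0)), snd (z, 0)) = f z" if "z \<in> topspace Z" for z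
      using \<Lambda>(2) gT[OF that] by (auto simp: g_def)
    show "q (\<Lambda> (g (fst (z, t)), snd (z, t))) = h (z, t)" if "z \<in> topspace Z" "t \<in> {0..1}" for z t
      using \<Lambda>(2) gT[OF that(1)] that(2) by (simp add: g_def)
  qed
qed

section \<open>Gluing vertical homotopies along a partition of unity\<close>

text \<open>Only finitely many members of a partition of unity are non-zero at a point.  Listing them in an
  order that is fixed once and for all makes the gluings at neighbouring points comparable.\<close>

lemma coherent_enumeration:
  obtains enum :: "'a set \<Rightarrow> 'a list"
  where "\<And>T. finite T \<Longrightarrow> set (enum T) = T"
    "\<And>S T. finite T \<Longrightarrow> S \<subseteq> T \<Longrightarrow> enum S = filter (\<lambda>x. x \<in> S) (enum T)"
proof -
  obtain r :: "'a rel" where "Well_order r \<and> Field r = UNIV"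
    using well_ordering ..
  then have "well_order_on UNIV r" by metis
  then have lin: "refl r" "trans r" "antisym r" "total r"
    unfolding order_on_defs by simp_all
  interpret L: linorder "\<lambda>x y. (x, y) \<in> r" "\<lambda>x y. (x, y) \<in> r \<and> x \<noteq> y"
  proof
    show "((x, y) \<in> r \<and> x \<noteq> y) = ((x, y) \<in> r \<and> (y, x) \<notin> r)" for x y
      using lin(1,3) by (auto simp: antisym_def refl_on_def)
    show "(x, x) \<in> r" for x using lin(1) by (auto simp: refl_on_def)
    show "(x, y) \<in> r \<Longrightarrow> (y, z) \<in> r \<Longrightarrow> (x, z) \<in> r" for x y z using lin(2) by (rule transD)
    show "(x, y) \<in> r \<Longrightarrow> (y, x) \<in> r \<Longrightarrow> x = y" for x y using lin(3) by (rule antisymD)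
    show "(x, y) \<in> r \<or> (y, x) \<in> r" for x y
      using lin(1,4) by (cases "x = y") (auto simp: total_on_def refl_on_def)
  qed
  have set: "set (L.sorted_list_of_set T) = T" if "finite T" for T
    using that by (rule L.set_sorted_list_of_set)
  show thesis
  proof (rule that[of L.sorted_list_of_set])
    fix S T :: "'a set" assume T: "finite T" "S \<subseteq> T"
    show "L.sorted_list_of_set S = filter (\<lambda>x. x \<in> S) (L.sorted_list_of_set T)"
    proof (rule L.strict_sorted_equal)
      show "set (L.sorted_list_of_set S) = set (filter (\<lambda>x. x \<in> S) (L.sorted_list_of_set T))"
        using set[OF T(1)] set[OF finite_subset[OF T(2,1)]] T(2) by auto
    qed (use L.strict_sorted_list_of_set in \<open>auto intro!: sorted_wrt_filter\<close>)
  qed (rule set)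
qed

text \<open>One step moves the point \<open>e\<close> obtained so far by the contraction \<open>k u\<close>, the further the larger the
  share of \<open>u\<close> in the accumulated weight.  Where the weight \<open>W\<close> accumulated before is \<open>0\<close>, the point \<open>e\<close>
  need not depend continuously on \<open>p\<close>.  This does no harm: close to such places the share of \<open>u\<close> exceeds
  one half, hence the factor \<open>2\<close> has completed the contraction, whose end does not depend on \<open>e\<close>.\<close>

primrec glue :: "('u \<Rightarrow> 'p \<Rightarrow> real) \<Rightarrow> ('u \<Rightarrow> 'e \<times> real \<Rightarrow> 'e) \<Rightarrow> ('p \<Rightarrow> real \<times> 'e) \<Rightarrow> 'u list \<Rightarrow> 'p \<Rightarrow> real \<times> 'e"
where
  "glue w k s [] p = s p"
| "glue w k s (u # us) p =
    (let W = fst (glue w k s us p); e = snd (glue w k s us p)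
     in (W + w u p, if w u p = 0 then e else k u (e, min 1 (2 * w u p / (W + w u p)))))"

lemma glue_filter:
  "(\<And>u. u \<in> set us \<Longrightarrow> \<not> Q u \<Longrightarrow> w u p = 0) \<Longrightarrow> glue w k s (filter Q us) p = glue w k s us p"
  by (induction us) (auto simp: Let_def)

lemma fst_glue: "fst (glue w k s us p) = fst (s p) + (\<Sum>u\<leftarrow>us. w u p)"
  by (induction us) (auto simp: Let_def)

text \<open>Over each of the sets \<open>V u\<close> the map \<open>q\<close> is shrinkable in the sense of Dold, by a deformation to the
  section \<open>\<sigma> u\<close>.\<close>

locale local_contractions =
  fixes E :: "'e topology" and Y :: "'y topology" and q :: "'e \<Rightarrow> 'y"
    and \<U> :: "'u set" and V :: "'u \<Rightarrow> 'y set"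
    and k :: "'u \<Rightarrow> 'e \<times> real \<Rightarrow> 'e" and \<sigma> :: "'u \<Rightarrow> 'y \<Rightarrow> 'e"
  assumes q: "continuous_map E Y q"
    and V: "\<And>u. u \<in> \<U> \<Longrightarrow> openin Y (V u)"
    and k: "\<And>u. u \<in> \<U> \<Longrightarrow>
      continuous_map (prod_topology (subtopology E {e \<in> topspace E. q e \<in> V u}) unit_interval) E (k u)"
    and \<sigma>: "\<And>u. u \<in> \<U> \<Longrightarrow> continuous_map (subtopology Y (V u)) E (\<sigma> u)"
    and k0: "\<And>u e. u \<in> \<U> \<Longrightarrow> e \<in> topspace E \<Longrightarrow> q e \<in> V u \<Longrightarrow> k u (e, 0) = e"
    and k1: "\<And>u e. u \<in> \<U> \<Longrightarrow> e \<in> topspace E \<Longrightarrow> q e \<in> V u \<Longrightarrow> k u (e, 1) = \<sigma> u (q e)"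
    and qk: "\<And>u e t. u \<in> \<U> \<Longrightarrow> e \<in> topspace E \<Longrightarrow> q e \<in> V u \<Longrightarrow> t \<in> {0..1} \<Longrightarrow> q (k u (e, t)) = q e"
begin

lemma k_topspace:
  "u \<in> \<U> \<Longrightarrow> e \<in> topspace E \<Longrightarrow> q e \<in> V u \<Longrightarrow> t \<in> {0..1} \<Longrightarrow> k u (e, t) \<in> topspace E"
  using k[of u] by (auto simp: continuous_map_def Pi_iff)

text \<open>Continuity of one step is checked in three regions: where the old weight is positive, over
  \<open>V u\<close>, the formula is a composition of continuous maps, also at points where the new weight is \<open>0\<close>,
  because the contraction starts with the identity; outside \<open>V u\<close> the new weight vanishes locally and
  nothing changes; and where the old weight is \<open>0\<close> the result is the section \<open>\<sigma> u\<close>.\<close>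

lemma glue_continuous:
  fixes P :: "'p topology"
  assumes r: "continuous_map P Y r"
    and w: "\<And>u. u \<in> \<U> \<Longrightarrow> continuous_map P euclideanreal (w u)" "\<And>u p. u \<in> \<U> \<Longrightarrow> p \<in> topspace P \<Longrightarrow> 0 \<le> w u p"
    and w0: "\<And>u p. u \<in> \<U> \<Longrightarrow> p \<in> topspace P \<Longrightarrow> r p \<notin> V u \<Longrightarrow>
        \<exists>N. openin P N \<and> p \<in> N \<and> (\<forall>p'\<in>N. w u p' = 0)"
    and s: "continuous_map P euclideanreal (fst \<circ> s)" "\<And>p. p \<in> topspace P \<Longrightarrow> 0 \<le> fst (s p)"
      "continuous_map (subtopology P {p \<in> topspace P. fst (s p) > 0}) E (snd \<circ> s)"
      "\<And>p. p \<in> topspace P \<Longrightarrow> snd (s p) \<in> topspace E \<and> q (snd (s p)) = r p"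
    and us: "set us \<subseteq> \<U>"
  shows "continuous_map P euclideanreal (fst \<circ> glue w k s us) \<and>
    (\<forall>p\<in>topspace P. 0 \<le> fst (glue w k s us p)) \<and>
    continuous_map (subtopology P {p \<in> topspace P. fst (glue w k s us p) > 0}) E (snd \<circ> glue w k s us) \<and>
    (\<forall>p\<in>topspace P. snd (glue w k s us p) \<in> topspace E \<and> q (snd (glue w k s us p)) = r p)"
  using us
proof (induction us)
  case Nil
  then show ?case using s by (simp add: o_def)
next
  case (Cons u us)
  then have u: "u \<in> \<U>" by simp
  define W where "W = fst \<circ> glue w k s us"
  define e where "e = snd \<circ> glue w k s us"
  have IH: "continuous_map P euclideanreal W" "\<And>p. p \<in> topspace P \<Longrightarrow> 0 \<le> W p"
    "continuous_map (subtopology P {p \<in> topspace P. W p > 0}) E e"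
    "\<And>p. p \<in> topspace P \<Longrightarrow> e p \<in> topspace E \<and> q (e p) = r p"
    using Cons by (auto simp: W_def e_def o_def)
  define W' where "W' = (\<lambda>p. W p + w u p)"
  define e' where "e' = (\<lambda>p. if w u p = 0 then e p else k u (e p, min 1 (2 * w u p / W' p)))"
  have glue: "glue w k s (u # us) = (\<lambda>p. (W' p, e' p))"
    by (auto simp: W'_def e'_def W_def e_def Let_def)
  have cW': "continuous_map P euclideanreal W'"
    unfolding W'_def by (intro continuous_map_add IH(1) w(1) u)
  have W'0: "0 \<le> W' p" if "p \<in> topspace P" for p
    using IH(2) w(2)[OF u] that by (simp add: W'_def)
  have rV: "r p \<in> V u" if "p \<in> topspace P" "w u p \<noteq> 0" for p
    using w0[OF u that(1)] that(2) by blast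
  have e': "e' p \<in> topspace E \<and> q (e' p) = r p" if p: "p \<in> topspace P" for p
  proof (cases "w u p = 0")
    case True
    then show ?thesis using IH(4)[OF p] by (simp add: e'_def)
  next
    case False
    then have "q (e p) \<in> V u" "min 1 (2 * w u p / W' p) \<in> {0..1}"
      using rV[OF p] IH(4)[OF p] w(2)[OF u p] W'0[OF p] by auto
    then show ?thesis
      using False IH(4)[OF p] k_topspace[OF u, of "e p"] qk[OF u, of "e p"] by (auto simp: e'_def)
  qed
  have "continuous_map (subtopology P {p \<in> topspace P. W' p > 0}) E e'"
  proof (rule continuous_map_locally)
    let ?O = "{p \<in> topspace P. W' p > 0}"
    fix p assume "p \<in> topspace (subtopology P ?O)"
    then have p: "p \<in> topspace P" "W' p > 0" by auto
    have pos: "openin P {p \<in> topspace P. f p > 0}" if "continuous_map P euclideanreal f" for f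
      using openin_continuous_map_preimage[OF that, of "{0<..}"] by simp
    have oV: "openin P {p \<in> topspace P. r p \<in> V u}"
      using r V[OF u] by (rule openin_continuous_map_preimage)
    have loc: "\<exists>U. openin (subtopology P ?O) U \<and> p \<in> U \<and> continuous_map (subtopology (subtopology P ?O) U) E e'"
      if N: "openin P N" "p \<in> N" and sub: "\<And>x. x \<in> N \<Longrightarrow> W' x > 0" and c: "continuous_map (subtopology P N) E e'" for N
    proof -
      have "N \<subseteq> ?O" using openin_subset[OF N(1)] sub by auto
      then have "openin (subtopology P ?O) N" "subtopology (subtopology P ?O) N = subtopology P N"
        using N by (auto simp: openin_open_subtopology pos[OF cW'] subtopology_subtopology Int_absorb1)
      then show ?thesis using N c by metis
    qed
    consider "W p > 0" "r p \<in> V u" | "W p > 0" "r p \<notin> V u" | "W p = 0"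
      using IH(2)[OF p(1)] by fastforce
    then show "\<exists>U. openin (subtopology P ?O) U \<and> p \<in> U \<and> continuous_map (subtopology (subtopology P ?O) U) E e'"
    proof cases
      case 1
      let ?N = "{p \<in> topspace P. W p > 0} \<inter> {p \<in> topspace P. r p \<in> V u}"
      have W'N: "W' x > 0" if "x \<in> ?N" for x
        using that w(2)[OF u, of x] by (auto simp: W'_def)
      have "continuous_map (subtopology P ?N) (subtopology E {e \<in> topspace E. q e \<in> V u}) e"
        using continuous_map_from_subtopology_mono[OF IH(3), of ?N] IH(4)
        by (auto simp: continuous_map_in_subtopology)
      moreover have "continuous_map (subtopology P ?N) unit_interval (\<lambda>p. min 1 (2 * w u p / W' p))"
      proof (rule continuous_map_unit_intervalI)
        show "continuous_map (subtopology P ?N) euclideanreal (\<lambda>p. min 1 (2 * w u p / W' p))"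
          using continuous_map_from_subtopology[OF cW', of ?N] continuous_map_from_subtopology[OF w(1)[OF u], of ?N]
          by (intro continuous_map_real_min continuous_map_real_divide continuous_map_real_mult
              continuous_map_canonical_const) (use W'N in fastforce)+
        show "0 \<le> min 1 (2 * w u x / W' x) \<and> min 1 (2 * w u x / W' x) \<le> 1"
          if "x \<in> topspace (subtopology P ?N)" for x
          using that w(2)[OF u, of x] W'0[of x] by auto
      qed
      ultimately have "continuous_map (subtopology P ?N) E (\<lambda>p. k u (e p, min 1 (2 * w u p / W' p)))"
        by (intro continuous_map_compose[OF _ k[OF u], unfolded o_def] continuous_map_pairedI)
      then have "continuous_map (subtopology P ?N) E e'"
        by (rule continuous_map_eq) (use k0[OF u] IH(4) in \<open>auto simp: e'_def\<close>)
      moreover have "openin P ?N" using pos[OF IH(1)] oV by blast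
      ultimately show ?thesis using 1 p W'N by (intro loc[of ?N]) auto
    next
      case 2
      then obtain N where N: "openin P N" "p \<in> N" "\<forall>p'\<in>N. w u p' = 0" using w0[OF u p(1)] by blast
      let ?N = "{p \<in> topspace P. W p > 0} \<inter> N"
      have "continuous_map (subtopology P ?N) E e"
        by (rule continuous_map_from_subtopology_mono[OF IH(3)]) auto
      then have "continuous_map (subtopology P ?N) E e'"
        by (rule continuous_map_eq) (use N(3) in \<open>auto simp: e'_def\<close>)
      moreover have "openin P ?N" using pos[OF IH(1)] N(1) by blast
      ultimately show ?thesis using 2 p N by (intro loc[of ?N]) (auto simp: W'_def)
    next
      case 3
      let ?N = "{p \<in> topspace P. w u p - W p > 0}"
      have wN: "w u x > 0" "W' x > 0" "2 * w u x / W' x \<ge> 1" if "x \<in> ?N" for x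
        using that IH(2)[of x] by (auto simp: W'_def field_simps)
      have "continuous_map (subtopology P ?N) (subtopology Y (V u)) r"
        using continuous_map_from_subtopology[OF r] wN(1) rV
        by (fastforce simp: continuous_map_in_subtopology)
      then have "continuous_map (subtopology P ?N) E (\<sigma> u \<circ> r)"
        using \<sigma>[OF u] by (rule continuous_map_compose)
      then have "continuous_map (subtopology P ?N) E e'"
      proof (rule continuous_map_eq)
        fix x assume "x \<in> topspace (subtopology P ?N)"
        then have x: "x \<in> ?N" "x \<in> topspace P" by auto
        then show "(\<sigma> u \<circ> r) x = e' x"
          using wN[OF x(1)] k1[OF u, of "e x"] IH(4)[of x] rV[of x] by (simp add: e'_def)
      qed
      moreover have "openin P ?N"
        by (intro pos continuous_map_diff w(1) u IH(1))
      ultimately show ?thesis using 3 p wN(2) by (intro loc[of ?N]) (auto simp: W'_def)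
    qed
  qed
  then show ?case
    unfolding glue using cW' W'0 e' by (simp add: o_def)
qed

text \<open>The gluing starts near the two ends of the interval with the two given maps, and the weights of
  the contractions vanish at the ends.  The partition of unity itself does not have enough room: each
  member is cut down by half the sum of the squares of all members.  It then vanishes near every point
  outside the open set that belongs to it.  As the sum of the squares is at most the largest value, some
  member remains positive at each point.\<close>

theorem vertical_homotopy:
  fixes Z :: "'z topology"
  assumes \<U>: "\<And>u. u \<in> \<U> \<Longrightarrow> continuous_map Y euclideanreal (\<rho> u)"
    "\<And>u y. u \<in> \<U> \<Longrightarrow> y \<in> topspace Y \<Longrightarrow> 0 \<le> \<rho> u y"
    "\<And>y. y \<in> topspace Y \<Longrightarrow> \<exists>N. openin Y N \<and> y \<in> N \<and> finite {u \<in> \<U>. \<exists>x\<in>N. \<rho> u x \<noteq> 0}"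
    "\<And>y. y \<in> topspace Y \<Longrightarrow> (\<Sum>u | u \<in> \<U> \<and> \<rho> u y \<noteq> 0. \<rho> u y) = 1"
    "\<And>u. u \<in> \<U> \<Longrightarrow> V u = {y \<in> topspace Y. \<rho> u y \<noteq> 0}"
    and f: "continuous_map Z E f0" "continuous_map Z E f1" "\<And>z. z \<in> topspace Z \<Longrightarrow> q (f0 z) = q (f1 z)"
  obtains M where "continuous_map (prod_topology Z unit_interval) E M"
    "\<And>z. z \<in> topspace Z \<Longrightarrow> M (z, 0) = f0 z" "\<And>z. z \<in> topspace Z \<Longrightarrow> M (z, 1) = f1 z"
    "\<And>z t. z \<in> topspace Z \<Longrightarrow> t \<in> {0..1} \<Longrightarrow> q (M (z, t)) = q (f0 z)"
proof -
  define S where "S = (\<lambda>y. {u \<in> \<U>. \<rho> u y \<noteq> 0})"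
  define sq where "sq = (\<lambda>y. \<Sum>u\<in>S y. (\<rho> u y)\<^sup>2)"
  have finS: "finite (S y)" if "y \<in> topspace Y" for y
    using \<U>(3)[OF that] unfolding S_def by (elim exE conjE) (erule finite_subset[rotated], auto)
  have sq: "continuous_map Y euclideanreal sq"
  proof (rule continuous_map_locally)
    fix y assume "y \<in> topspace Y"
    then obtain N where N: "openin Y N" "y \<in> N" "finite {u \<in> \<U>. \<exists>x\<in>N. \<rho> u x \<noteq> 0}" (is "finite ?I")
      using \<U>(3) by blast
    have "continuous_map (subtopology Y N) euclideanreal (\<lambda>x. \<Sum>u\<in>?I. (\<rho> u x)\<^sup>2)"
      by (intro continuous_map_sum N(3) continuous_map_real_pow continuous_map_from_subtopology \<U>(1)) simp
    moreover have "(\<Sum>u\<in>?I. (\<rho> u x)\<^sup>2) = sq x" if "x \<in> topspace (subtopology Y N)" for x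
      unfolding sq_def by (rule sum.mono_neutral_right[OF N(3)]) (use that in \<open>auto simp: S_def\<close>)
    ultimately have "continuous_map (subtopology Y N) euclideanreal sq"
      by (rule continuous_map_eq)
    then show "\<exists>N. openin Y N \<and> y \<in> N \<and> continuous_map (subtopology Y N) euclideanreal sq"
      using N by blast
  qed
  have sum1: "(\<Sum>u\<in>S y. \<rho> u y) = 1" if "y \<in> topspace Y" for y
    using \<U>(4)[OF that] by (simp add: S_def)
  have sq_pos: "sq y > 0" if y: "y \<in> topspace Y" for y
  proof -
    have "S y \<noteq> {}" using sum1[OF y] by auto
    then show ?thesis
      unfolding sq_def by (intro sum_pos finS y) (auto simp: S_def)
  qed
  have sq_le: "\<exists>u\<in>S y. sq y \<le> \<rho> u y" if y: "y \<in> topspace Y" for y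
  proof (rule ccontr)
    assume "\<not> ?thesis"
    then have less: "\<rho> u y < sq y" if "u \<in> S y" for u using that by force
    have "(\<Sum>u\<in>S y. (\<rho> u y)\<^sup>2) < (\<Sum>u\<in>S y. sq y * \<rho> u y)"
    proof (rule sum_strict_mono[OF finS[OF y]])
      show "S y \<noteq> {}" using sum1[OF y] by auto
      show "(\<rho> u y)\<^sup>2 < sq y * \<rho> u y" if u: "u \<in> S y" for u
      proof -
        have "0 < \<rho> u y" using u \<U>(2)[of u y] y by (auto simp: S_def less_le)
        then show ?thesis using less[OF u] by (simp add: power2_eq_square)
      qed
    qed
    then show False
      using sum1[OF y] by (simp add: sq_def flip: sum_distrib_left)
  qed
  let ?P = "prod_topology Z unit_interval"
  define r where "r = (\<lambda>p :: 'z \<times> real. q (f0 (fst p)))"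
  have r: "continuous_map ?P Y r"
    unfolding r_def
    using continuous_map_compose[OF continuous_map_compose[OF continuous_map_fst f(1)] q] by (simp add: o_def)
  have rY: "r p \<in> topspace Y" if "p \<in> topspace ?P" for p
    using r that by (auto simp: continuous_map_def)
  have sndP: "continuous_map ?P euclideanreal snd"
    by (rule continuous_map_top_of_set_real[OF continuous_map_snd])
  \<comment> \<open>\<open>s\<close> has weight \<open>1\<close> at both ends of the interval and weight \<open>0\<close> on the middle third, where it jumps
    from one map to the other; the weights \<open>w\<close> vanish at both ends.\<close>
  define v where "v = (\<lambda>u y. max 0 (\<rho> u y - sq y / 2))"
  define w where "w = (\<lambda>u p. snd p * (1 - snd p) * v u (r p))"
  define s where "s = (\<lambda>p :: 'z \<times> real. (max 0 (1 - 3 * snd p) + max 0 (3 * snd p - 2),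
      if snd p \<le> 1/2 then f0 (fst p) else f1 (fst p)))"
  have v: "continuous_map Y euclideanreal (v u)" if "u \<in> \<U>" for u
    unfolding v_def using that
    by (intro continuous_map_real_max continuous_map_diff continuous_map_real_divide sq \<U>(1)
        continuous_map_canonical_const) auto
  have w: "continuous_map ?P euclideanreal (w u)" if "u \<in> \<U>" for u
    unfolding w_def
    by (intro continuous_map_real_mult continuous_map_diff continuous_map_canonical_const sndP
        continuous_map_compose[OF r v, unfolded o_def] that)
  have w_nonneg: "0 \<le> w u p" if "p \<in> topspace ?P" for u p
    using that by (auto simp: w_def v_def)
  have w_zero: "\<exists>N. openin ?P N \<and> p \<in> N \<and> (\<forall>p'\<in>N. w u p' = 0)"
    if u: "u \<in> \<U>" and p: "p \<in> topspace ?P" "r p \<notin> V u" for u p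
  proof -
    let ?D = "{y \<in> topspace Y. sq y / 2 - \<rho> u y > 0}"
    have "continuous_map Y euclideanreal (\<lambda>y. sq y / 2 - \<rho> u y)"
      by (intro continuous_map_diff continuous_map_real_divide sq \<U>(1) u continuous_map_canonical_const) auto
    from openin_continuous_map_preimage[OF this, of "{0<..}"] have "openin Y ?D" by simp
    from openin_continuous_map_preimage[OF r this] have "openin ?P {p \<in> topspace ?P. r p \<in> ?D}" .
    moreover have "p \<in> {p \<in> topspace ?P. r p \<in> ?D}"
      using p rY[OF p(1)] sq_pos[OF rY[OF p(1)]] \<U>(5)[OF u] by auto
    moreover have "\<forall>p'\<in>{p \<in> topspace ?P. r p \<in> ?D}. w u p' = 0" by (auto simp: w_def v_def)
    ultimately show ?thesis by blast
  qed
  have s_pos: "fst (s p) > 0 \<longleftrightarrow> snd p < 1/3 \<or> snd p > 2/3" for p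
    by (auto simp: s_def)
  have s_cont: "continuous_map (subtopology ?P {p \<in> topspace ?P. fst (s p) > 0}) E (snd \<circ> s)" (is "continuous_map ?Q _ _")
  proof -
    have f0: "continuous_map ?P E (\<lambda>p. f0 (fst p))" and f1: "continuous_map ?P E (\<lambda>p. f1 (fst p))"
      using continuous_map_compose[OF continuous_map_fst] f(1,2) by (auto simp: o_def)
    have "continuous_map ?Q E (\<lambda>p. if snd p \<le> 1/2 then f0 (fst p) else f1 (fst p))"
    proof (rule continuous_map_cases_le)
      show "continuous_map ?Q euclideanreal snd" by (rule continuous_map_from_subtopology[OF sndP])
      show "f0 (fst p) = f1 (fst p)" if "p \<in> topspace ?Q" "snd p = 1/2" for p
        using that(1) unfolding topspace_subtopology s_pos by (simp add: that(2))
    qed (simp_all add: subtopology_subtopology continuous_map_from_subtopology[OF f0] continuous_map_from_subtopology[OF f1])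
    then show ?thesis by (simp add: s_def o_def)
  qed
  have s_fst: "continuous_map ?P euclideanreal (fst \<circ> s)"
    unfolding s_def o_def fst_conv
    by (intro continuous_map_add continuous_map_real_max continuous_map_diff continuous_map_real_mult
        continuous_map_canonical_const sndP)
  have s_E: "snd (s p) \<in> topspace E \<and> q (snd (s p)) = r p" if "p \<in> topspace ?P" for p
    using that f by (auto simp: s_def r_def continuous_map_def Pi_iff)
  have s_nonneg: "0 \<le> fst (s p)" for p by (simp add: s_def)
  have gc: "continuous_map (subtopology ?P {p \<in> topspace ?P. fst (glue w k s us p) > 0}) E (snd \<circ> glue w k s us)"
    "\<And>p. p \<in> topspace ?P \<Longrightarrow> q (snd (glue w k s us p)) = r p" if "set us \<subseteq> \<U>" for us
    using glue_continuous[where w = w and P = ?P and r = r and s = s and us = us]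
      r w w_nonneg w_zero s_fst s_nonneg s_cont s_E that by auto
  obtain enum :: "'u set \<Rightarrow> 'u list" where enum: "\<And>T. finite T \<Longrightarrow> set (enum T) = T"
    "\<And>S T. finite T \<Longrightarrow> S \<subseteq> T \<Longrightarrow> enum S = filter (\<lambda>x. x \<in> S) (enum T)"
    by (rule coherent_enumeration) blast
  define M where "M = (\<lambda>p. snd (glue w k s (enum (S (r p))) p))"
  have w_S: "w u p = 0" if "u \<in> \<U>" "u \<notin> S (r p)" "p \<in> topspace ?P" for u p
    using that sq_pos[OF rY[OF that(3)]] by (auto simp: w_def v_def S_def)
  have weight: "fst (glue w k s (enum T) p) > 0"
    if p: "p \<in> topspace ?P" and T: "finite T" "S (r p) \<subseteq> T" "T \<subseteq> \<U>" for p T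
  proof (cases "snd p = 0 \<or> snd p = 1")
    case True
    moreover have "0 \<le> (\<Sum>u\<leftarrow>enum T. w u p)"
      by (rule sum_list_nonneg) (use w_nonneg[OF p] in auto)
    ultimately show ?thesis by (auto simp: fst_glue s_def)
  next
    case False
    obtain u where u: "u \<in> S (r p)" "sq (r p) \<le> \<rho> u (r p)" using sq_le[OF rY[OF p]] by blast
    have "0 < snd p * (1 - snd p)"
      using p False by (intro mult_pos_pos) auto
    then have "0 < w u p" using u sq_pos[OF rY[OF p]] by (auto simp: w_def v_def)
    moreover have "w u p \<in> set (map (\<lambda>u. w u p) (enum T))" using u T enum(1) by auto
    then have "w u p \<le> (\<Sum>u\<leftarrow>enum T. w u p)"
      by (rule member_le_sum_list) (use w_nonneg[OF p] in auto)
    ultimately show ?thesis using s_nonneg[of p] by (simp add: fst_glue)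
  qed
  show thesis
  proof (rule that[of M])
    show "continuous_map ?P E M"
    proof (rule continuous_map_locally)
      fix p assume p: "p \<in> topspace ?P"
      obtain N where N: "openin Y N" "r p \<in> N" "finite {u \<in> \<U>. \<exists>x\<in>N. \<rho> u x \<noteq> 0}" (is "finite ?I")
        using \<U>(3)[OF rY[OF p]] by blast
      let ?N = "{p \<in> topspace ?P. r p \<in> N}"
      have S_sub: "S (r p') \<subseteq> ?I" if "p' \<in> ?N" for p' using that by (auto simp: S_def)
      have eq: "M p' = snd (glue w k s (enum ?I) p')" if "p' \<in> ?N" for p'
        unfolding M_def enum(2)[OF N(3) S_sub[OF that]]
        using that enum(1)[OF N(3)] by (subst glue_filter) (auto intro: w_S)
      have "continuous_map (subtopology ?P {p \<in> topspace ?P. fst (glue w k s (enum ?I) p) > 0}) E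
          (snd \<circ> glue w k s (enum ?I))"
        by (rule gc(1)) (use enum(1)[OF N(3)] in auto)
      then have "continuous_map (subtopology ?P ?N) E (snd \<circ> glue w k s (enum ?I))"
        by (rule continuous_map_from_subtopology_mono) (use weight[OF _ N(3) S_sub] in auto)
      then have "continuous_map (subtopology ?P ?N) E M"
        by (rule continuous_map_eq) (use eq in auto)
      moreover have "openin ?P ?N" using r N(1) by (rule openin_continuous_map_preimage)
      ultimately show "\<exists>N. openin ?P N \<and> p \<in> N \<and> continuous_map (subtopology ?P N) E M"
        using p N(2) by (intro exI[of _ ?N]) auto
    qed
    have ends: "glue w k s us (z, t) = s (z, t)" if "t = 0 \<or> t = 1" for us z t
      using that by (induction us) (auto simp: w_def Let_def prod_eq_iff)
    show "M (z, 0) = f0 z" "M (z, 1) = f1 z" for z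
      by (simp_all add: M_def ends) (simp_all add: s_def)
    show "q (M (z, t)) = q (f0 z)" if "z \<in> topspace Z" "t \<in> {0..1}" for z t
    proof -
      have zt: "(z, t) \<in> topspace ?P" using that by simp
      have "set (enum (S (r (z, t)))) \<subseteq> \<U>"
        using enum(1)[OF finS[OF rY[OF zt]]] by (auto simp: S_def)
      from gc(2)[OF this zt] show ?thesis by (simp add: M_def r_def)
    qed
  qed
qed

end

section \<open>A covering that contains a section of a fibration\<close>

text \<open>A fibration \<open>Bp\<close> with section \<open>Bs\<close>, and a covering \<open>\<pi>\<close> whose fundamental group is that of the
  section, in the sense that loops of the section lift to loops, and that a loop of the covering that
  becomes null-homotopic in the base of the fibration is so already.\<close>

locale section_covering =
  fixes X :: "'x topology" and Y :: "'y topology" and Bp :: "'x \<Rightarrow> 'y" and Bs :: "'y \<Rightarrow> 'x"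
    and E :: "'e topology" and \<pi> :: "'e \<Rightarrow> 'x" and e0 :: 'e
    and D :: "'d topology" and cD :: "'d \<Rightarrow> 'x" and W :: "'w topology" and cW :: "'w \<Rightarrow> 'y"
  assumes fib: "hurewicz_fibration X Y Bp"
    and Bs: "continuous_map Y X Bs" and Bp_Bs: "\<And>y. y \<in> topspace Y \<Longrightarrow> Bp (Bs y) = y"
    and E: "covering_projection E X \<pi>" and pcE: "path_connected_space E"
    and e0: "e0 \<in> topspace E" and Bs_e0: "Bs (Bp (\<pi> e0)) = \<pi> e0"
    and loop_lifts: "\<And>l. l \<in> loops Y (Bp (\<pi> e0)) \<Longrightarrow> \<exists>l'\<in>loops E e0. path_homotopic X (Bs \<circ> l) (\<pi> \<circ> l')"
    and loop_null: "\<And>l. l \<in> loops E e0 \<Longrightarrow> path_homotopic Y (Bp \<circ> (\<pi> \<circ> l)) (\<lambda>_. Bp (\<pi> e0)) \<Longrightarrow>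
      path_homotopic X (\<pi> \<circ> l) (\<lambda>_. \<pi> e0)"
    and D: "covering_projection D X cD" "contractible_space D"
    and W: "covering_projection W Y cW" "contractible_space W"
begin

definition q where "q = (\<lambda>e. Bp (\<pi> e))"

lemma Bp_cont: "continuous_map X Y Bp"
  using fib by (simp add: hurewicz_fibration_def)

lemma \<pi>_cont: "continuous_map E X \<pi>"
  using covering_projectionD[OF E] by simp

lemma q_cont: "continuous_map E Y q"
  unfolding q_def by (rule continuous_map_comp[OF \<pi>_cont Bp_cont])

lemma q_lift:
  fixes Z :: "'z topology"
  assumes f: "continuous_map Z E f" and h: "continuous_map (prod_topology Z unit_interval) Y h"
    and start: "\<And>z. z \<in> topspace Z \<Longrightarrow> h (z, 0) = q (f z)"
  obtains H where "continuous_map (prod_topology Z unit_interval) E H"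
    "\<And>z. z \<in> topspace Z \<Longrightarrow> H (z, 0) = f z"
    "\<And>z t. z \<in> topspace Z \<Longrightarrow> t \<in> {0..1} \<Longrightarrow> q (H (z, t)) = h (z, t)"
proof -
  have "continuous_map Z X (\<lambda>z. \<pi> (f z))" by (rule continuous_map_comp[OF f \<pi>_cont])
  then obtain G where G: "continuous_map (prod_topology Z unit_interval) X G"
    "\<And>z. z \<in> topspace Z \<Longrightarrow> G (z, 0) = \<pi> (f z)"
    "\<And>z t. z \<in> topspace Z \<Longrightarrow> t \<in> {0..1} \<Longrightarrow> Bp (G (z, t)) = h (z, t)"
    by (rule hurewicz_fibration_lift[OF fib _ h]) (use start in \<open>auto simp: q_def\<close>)
  obtain H where "continuous_map (prod_topology Z unit_interval) E H"
    "\<And>z. z \<in> topspace Z \<Longrightarrow> H (z, 0) = f z"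
    "\<And>z t. z \<in> topspace Z \<Longrightarrow> t \<in> {0..1} \<Longrightarrow> \<pi> (H (z, t)) = G (z, t)"
    by (rule covering_homotopy_lift[OF E G(1) f]) (use G(2) in auto)
  then show thesis using G(3) by (intro that[of H]) (auto simp: q_def)
qed

lemma w0_ex: "\<exists>w0\<in>topspace W. cW w0 = q e0"
proof -
  have "q e0 \<in> cW ` topspace W"
    using q_cont e0 covering_projectionD(2)[OF W(1)] by (auto simp: continuous_map_def)
  then show ?thesis by force
qed

lemma path_from: "contractible_space Z \<Longrightarrow> z \<in> topspace Z \<Longrightarrow> z' \<in> topspace Z \<Longrightarrow>
    \<exists>p. pathin Z p \<and> p 0 = z \<and> p 1 = z'"
  using contractible_imp_path_connected_space by (auto simp: path_connected_space_def)

text \<open>The composite of the section with the contractible covering \<open>cW\<close> lifts to \<open>E\<close>.  The lift is constant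
  on the fibres of \<open>cW\<close> because loops of the section lift to loops, and so it descends to \<open>Y\<close>.\<close>

lemma section_lift:
  obtains \<tau> where "continuous_map Y E \<tau>" "\<tau> (q e0) = e0" "\<And>y. y \<in> topspace Y \<Longrightarrow> \<pi> (\<tau> y) = Bs y"
proof -
  have cW: "continuous_map W Y cW" "cW ` topspace W = topspace Y" using covering_projectionD[OF W(1)] by auto
  obtain w0 where w0: "w0 \<in> topspace W" "cW w0 = q e0" using w0_ex by blast
  obtain s where s: "continuous_map W E s" "s w0 = e0" "\<And>w. w \<in> topspace W \<Longrightarrow> \<pi> (s w) = Bs (cW w)"
    by (rule contractible_lift[OF E W(2) continuous_map_comp[OF cW(1) Bs] w0(1) e0])
      (use Bs_e0 w0 in \<open>auto simp: q_def\<close>)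
  have s_eq: "s w = s w'" if w: "w \<in> topspace W" "w' \<in> topspace W" "cW w = cW w'" for w w'
  proof -
    obtain v v' where v: "pathin W v" "v 0 = w0" "v 1 = w" and v': "pathin W v'" "v' 0 = w0" "v' 1 = w'"
      using path_from[OF W(2) w0(1)] w by blast
    let ?r = "\<lambda>t. s (v t)" and ?r' = "\<lambda>t. s (v' t)"
    let ?g = "path_join (cW \<circ> v) (path_rev (cW \<circ> v'))"
    have r: "pathin E ?r" "pathin E ?r'" using v v' s(1) by (auto intro: pathin_comp)
    have "?g \<in> loops Y (q e0)"
      using v v' w w0 cW(1) by (auto simp: loops_def intro!: pathin_join pathin_rev pathin_compose)
    then obtain l where l: "l \<in> loops E e0" "path_homotopic X (Bs \<circ> ?g) (\<pi> \<circ> l)"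
      using loop_lifts unfolding q_def by blast
    have "path_homotopic X (path_join (\<pi> \<circ> ?r) (path_rev (\<pi> \<circ> ?r'))) (Bs \<circ> ?g)"
    proof (rule path_homotopic_eq)
      show "pathin X (path_join (\<pi> \<circ> ?r) (path_rev (\<pi> \<circ> ?r')))"
        using r \<pi>_cont v v' w s(3) by (intro pathin_join pathin_rev pathin_compose) auto
      show "path_join (\<pi> \<circ> ?r) (path_rev (\<pi> \<circ> ?r')) t = (Bs \<circ> ?g) t" if "t \<in> {0..1}" for t
        using that s(3) pathin_topspace[OF v(1)] pathin_topspace[OF v'(1)]
        by (auto simp: path_join_def path_rev_def)
    qed
    then have "path_homotopic X (path_join (\<pi> \<circ> ?r) (path_rev (\<pi> \<circ> ?r'))) (\<pi> \<circ> l)"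
      using l(2) path_homotopic_trans by blast
    then have "?r 1 = ?r' 1"
      by (rule covering_loop_closing[OF E r, rotated 3]) (use v v' w s l in auto)
    then show ?thesis using v v' by simp
  qed
  define \<tau> where "\<tau> = (\<lambda>y. s (SOME w. w \<in> topspace W \<and> cW w = y))"
  have \<tau>: "\<tau> (cW w) = s w" if "w \<in> topspace W" for w
    unfolding \<tau>_def using someI[of "\<lambda>v. v \<in> topspace W \<and> cW v = cW w" w] that s_eq by blast
  have "quotient_map W Y cW"
    using continuous_open_quotient_map[OF cW(1) covering_open_map[OF W(1)]] cW(2) by simp
  moreover have "continuous_map W E (\<tau> \<circ> cW)"
    by (rule continuous_map_eq[OF s(1)]) (simp add: \<tau>)
  ultimately have "continuous_map Y E \<tau>" by (rule continuous_compose_quotient_map)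
  moreover have "\<pi> (\<tau> y) = Bs y" if "y \<in> topspace Y" for y
  proof -
    have "y \<in> cW ` topspace W" using that cW(2) by simp
    then obtain w where "y = cW w" "w \<in> topspace W" by (rule imageE)
    then show ?thesis using \<tau> s(3) by simp
  qed
  ultimately show thesis using \<tau>[OF w0(1)] w0(2) s(2) by (intro that[of \<tau>]) auto
qed

definition ED_W where
  "ED_W = subtopology (prod_topology E W) {(e, w). q e = cW w}"

text \<open>The contractible covering \<open>D\<close> is the fibre product of \<open>E\<close> and \<open>W\<close>: the comparison map is
  bijective by a computation with lifted paths, and open because \<open>cD\<close> is open and the fibre product
  is locally injective over \<open>X\<close>.\<close>

lemma contractible_fibre_product:
  obtains \<delta> P \<Gamma> where "continuous_map D E \<delta>" "continuous_map D W P"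
    "\<And>z. z \<in> topspace D \<Longrightarrow> q (\<delta> z) = cW (P z)"
    "continuous_map ED_W D \<Gamma>"
    "\<And>e w. (e, w) \<in> topspace ED_W \<Longrightarrow> \<delta> (\<Gamma> (e, w)) = e \<and> P (\<Gamma> (e, w)) = w"
proof -
  have cD: "continuous_map D X cD" "cD ` topspace D = topspace X" using covering_projectionD[OF D(1)] by auto
  have cW: "continuous_map W Y cW" "cW ` topspace W = topspace Y" using covering_projectionD[OF W(1)] by auto
  obtain w0 where w0: "w0 \<in> topspace W" "cW w0 = q e0" using w0_ex by blast
  have "\<pi> e0 \<in> cD ` topspace D" using \<pi>_cont e0 cD(2) by (auto simp: continuous_map_def)
  then obtain d0 where d0: "d0 \<in> topspace D" "cD d0 = \<pi> e0" by force
  obtain \<delta> where \<delta>: "continuous_map D E \<delta>" "\<delta> d0 = e0" "\<And>z. z \<in> topspace D \<Longrightarrow> \<pi> (\<delta> z) = cD z"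
    by (rule contractible_lift[OF E D(2) cD(1) d0(1) e0]) (use d0 in auto)
  obtain P where P: "continuous_map D W P" "P d0 = w0" "\<And>z. z \<in> topspace D \<Longrightarrow> cW (P z) = q (\<delta> z)"
    by (rule contractible_lift[OF W(1) D(2) continuous_map_comp[OF \<delta>(1) q_cont] d0(1) w0(1)])
      (use w0 \<delta> in auto)
  obtain \<tau> where \<tau>: "continuous_map Y E \<tau>" "\<tau> (q e0) = e0" "\<And>y. y \<in> topspace Y \<Longrightarrow> \<pi> (\<tau> y) = Bs y"
    by (rule section_lift) blast
  have qY: "q e \<in> topspace Y" if "e \<in> topspace E" for e using q_cont that by (auto simp: continuous_map_def)
  have q\<tau>: "q (\<tau> y) = y" if "y \<in> topspace Y" for y using \<tau>(3)[OF that] Bp_Bs[OF that] by (simp add: q_def)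
  define f where "f = (\<lambda>z. (\<delta> z, P z))"
  have f: "continuous_map D ED_W f"
    unfolding f_def ED_W_def continuous_map_in_subtopology
    using P \<delta> by (auto intro: continuous_map_pairedI)
  have "inj_on f (topspace D)"
  proof (rule inj_onI)
    fix z z' assume z: "z \<in> topspace D" "z' \<in> topspace D" and "f z = f z'"
    then have eq: "\<delta> z = \<delta> z'" "P z = P z'" by (auto simp: f_def)
    obtain r r' where r: "pathin D r" "r 0 = d0" "r 1 = z" and r': "pathin D r'" "r' 0 = d0" "r' 1 = z'"
      using path_from[OF D(2) d0(1)] z by blast
    \<comment> \<open>Two paths to points with the same image form a loop \<open>?l\<close> in \<open>E\<close>.  It is null-homotopic in \<open>Y\<close>, since
      there it is the image of the loop \<open>?m\<close> in \<open>W\<close>, hence null-homotopic in \<open>X\<close>.\<close>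
    let ?l = "path_join (\<delta> \<circ> r) (path_rev (\<delta> \<circ> r'))"
    let ?m = "path_join (P \<circ> r) (path_rev (P \<circ> r'))"
    let ?c = "path_join (cD \<circ> r) (path_rev (cD \<circ> r'))"
    have l: "?l \<in> loops E e0"
      using r r' eq \<delta>(1,2) by (auto simp: loops_def intro!: pathin_join pathin_rev pathin_compose)
    have m: "pathin W ?m" "?m 0 = w0" "?m 1 = w0"
      using r r' eq P(1,2) by (auto intro!: pathin_join pathin_rev pathin_compose)
    have rD: "r t \<in> topspace D" "r' t \<in> topspace D" if "t \<in> {0..1}" for t
      using pathin_topspace r(1) r'(1) that by auto
    have "path_homotopic Y (cW \<circ> ?m) (cW \<circ> (\<lambda>_. w0))"
      using contractible_loop_null[OF W(2) m(1)] m(2,3) by (intro path_homotopic_compose[OF _ cW(1)]) simp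
    moreover have "path_homotopic Y (Bp \<circ> (\<pi> \<circ> ?l)) (cW \<circ> ?m)"
    proof (rule path_homotopic_eq)
      show "pathin Y (Bp \<circ> (\<pi> \<circ> ?l))"
        using l \<pi>_cont Bp_cont by (auto simp: loops_def intro!: pathin_compose)
      show "(Bp \<circ> (\<pi> \<circ> ?l)) t = (cW \<circ> ?m) t" if "t \<in> {0..1}" for t
        using that rD P(3) by (auto simp: path_join_def path_rev_def q_def)
    qed
    ultimately have "path_homotopic Y (Bp \<circ> (\<pi> \<circ> ?l)) (\<lambda>_. Bp (\<pi> e0))"
      using path_homotopic_trans w0(2) by (fastforce simp: o_def q_def)
    then have "path_homotopic X (\<pi> \<circ> ?l) (\<lambda>_. \<pi> e0)" by (rule loop_null[OF l])
    moreover have "path_homotopic X ?c (\<pi> \<circ> ?l)"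
    proof (rule path_homotopic_eq)
      have "cD z = cD z'" using \<delta>(3)[OF z(1)] \<delta>(3)[OF z(2)] eq(1) by simp
      then show "pathin X ?c"
        using r r' cD(1) by (auto intro!: pathin_join pathin_rev pathin_compose)
      show "?c t = (\<pi> \<circ> ?l) t" if "t \<in> {0..1}" for t
        using that rD \<delta>(3) by (auto simp: path_join_def path_rev_def)
    qed
    ultimately have "path_homotopic X ?c (cD \<circ> (\<lambda>_. d0))"
      using path_homotopic_trans d0(2) by (fastforce simp: o_def)
    then have "r 1 = r' 1"
      by (rule covering_loop_closing[OF D(1) r(1) r'(1), rotated 3])
        (use r r' \<delta>(3) z eq(1) d0 loops_const in \<open>auto simp flip: \<delta>(3)\<close>)
    then show "z = z'" using r r' by simp
  qed
  moreover have "f ` topspace D = topspace ED_W"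
  proof (intro equalityI subsetI)
    fix x assume "x \<in> f ` topspace D"
    then show "x \<in> topspace ED_W" using f by (auto simp: continuous_map_def)
  next
    fix x assume "x \<in> topspace ED_W"
    then obtain e w where x: "x = (e, w)" "e \<in> topspace E" "w \<in> topspace W" "q e = cW w"
      by (cases x) (auto simp: ED_W_def)
    obtain p where p: "pathin E p" "p 0 = e0" "p 1 = e"
      using pcE e0 x(2) by (auto simp: path_connected_space_def)
    obtain v where v: "pathin W v" "v 0 = w0" "v 1 = w" using path_from[OF W(2) w0(1) x(3)] by blast
    let ?a = "cW \<circ> v" and ?b = "q \<circ> p"
    have a: "pathin Y ?a" using v(1) cW(1) by (rule pathin_compose)
    have b: "pathin Y ?b" using p(1) q_cont by (rule pathin_compose)
    \<comment> \<open>A path from \<open>e0\<close> to \<open>e\<close> whose image in \<open>Y\<close> is homotopic to that of \<open>v\<close>: the image of \<open>p\<close> is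
      corrected by a loop, which is carried to \<open>E\<close> by the lifted section.  The end of its lift to \<open>D\<close> is
      the preimage of \<open>x\<close>.\<close>
    let ?p = "path_join (\<tau> \<circ> path_join ?a (path_rev ?b)) p"
    have ab: "pathin Y (path_join ?a (path_rev ?b))"
      using a b v p x(4) by (intro pathin_join pathin_rev) auto
    have p': "pathin E ?p"
      by (rule pathin_join[OF pathin_compose[OF ab \<tau>(1)] p(1)]) (use p \<tau>(2) in simp)
    have p'0: "?p 0 = e0" using v w0 \<tau>(2) by simp
    obtain y where y: "pathin D y" "y 0 = d0" "\<And>t. t \<in> {0..1} \<Longrightarrow> cD (y t) = \<pi> (?p t)"
      by (rule covering_path_lift[OF D(1) pathin_comp[OF p' \<pi>_cont] d0(1)]) (use p'0 d0 in auto)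
    have yD: "y t \<in> topspace D" if "t \<in> {0..1}" for t using pathin_topspace[OF y(1) that] .
    have \<delta>y: "\<delta> (y t) = ?p t" if "t \<in> {0..1}" for t
      by (rule covering_path_lift_unique[OF E pathin_comp[OF y(1) \<delta>(1)] p' _ _ that])
        (use y \<delta> p'0 yD in auto)
    have "path_homotopic Y (path_join (path_join ?a (path_rev ?b)) ?b) ?a"
      using v p x(4) by (intro path_homotopic_cancel a b) simp
    moreover have "path_homotopic Y (cW \<circ> (\<lambda>t. P (y t))) (path_join (path_join ?a (path_rev ?b)) ?b)"
    proof (rule path_homotopic_eq)
      show "pathin Y (cW \<circ> (\<lambda>t. P (y t)))"
        by (rule pathin_compose[OF pathin_comp[OF y(1) P(1)] cW(1)])
      show "(cW \<circ> (\<lambda>t. P (y t))) t = path_join (path_join ?a (path_rev ?b)) ?b t" if "t \<in> {0..1}" for t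
      proof -
        have "(cW \<circ> (\<lambda>t. P (y t))) t = q (?p t)" using P(3)[OF yD[OF that]] \<delta>y[OF that] by simp
        also have "\<dots> = path_join (path_join ?a (path_rev ?b)) ?b t"
        proof (cases "t \<le> 1/2")
          case True
          then have "path_join ?a (path_rev ?b) (2 * t) \<in> topspace Y"
            using that by (intro pathin_topspace[OF ab]) auto
          then show ?thesis using True q\<tau> by (simp add: path_join_def[of _ p] path_join_def[of _ ?b])
        qed (simp add: path_join_def)
        finally show ?thesis .
      qed
    qed
    ultimately have hom: "path_homotopic Y (cW \<circ> (\<lambda>t. P (y t))) (cW \<circ> v)"
      using path_homotopic_trans by blast
    have "P (y 1) = v 1"
      by (rule covering_lift_homotopic_end[OF W(1) pathin_comp[OF y(1) P(1)] v(1) _ hom]) (use y v P in auto)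
    moreover have "\<delta> (y 1) = e" using \<delta>y[of 1] p by simp
    ultimately have "f (y 1) = x" using v x by (simp add: f_def)
    then show "x \<in> f ` topspace D" using yD[of 1] by force
  qed
  moreover have "open_map D ED_W f"
  proof (rule open_map_into_locally_injective[OF f covering_open_map[OF D(1)]])
    show "continuous_map ED_W X (\<lambda>x. \<pi> (fst x))"
      unfolding ED_W_def by (intro continuous_map_from_subtopology continuous_map_comp[OF continuous_map_fst \<pi>_cont])
    show "\<pi> (fst (f z)) = cD z" if "z \<in> topspace D" for z using \<delta>(3)[OF that] by (simp add: f_def)
    fix x assume "x \<in> topspace ED_W"
    then obtain e w where x: "x = (e, w)" "e \<in> topspace E" "w \<in> topspace W" "q e = cW w"
      by (cases x) (auto simp: ED_W_def)
    obtain S j where S: "openin E S" "e \<in> S" "\<And>y. y \<in> S \<Longrightarrow> j (\<pi> y) = y"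
      by (rule covering_sheet[OF E x(2)]) blast
    obtain S' j' where S': "openin W S'" "w \<in> S'" "\<And>y. y \<in> S' \<Longrightarrow> j' (cW y) = y"
      by (rule covering_sheet[OF W(1) x(3)]) blast
    let ?N = "(S \<times> S') \<inter> {(e, w). q e = cW w}"
    have "openin ED_W ?N"
      unfolding ED_W_def openin_subtopology using S(1) S'(1) by (metis openin_prod_Times_iff)
    moreover have "inj_on (\<lambda>x. \<pi> (fst x)) ?N"
    proof (rule inj_onI, clarsimp)
      fix e1 w1 e2 w2
      assume A: "\<pi> e1 = \<pi> e2" "e1 \<in> S" "e2 \<in> S" "w1 \<in> S'" "w2 \<in> S'" "q e1 = cW w1" "q e2 = cW w2"
      then have "e1 = e2" using S(3) by metis
      then show "e1 = e2 \<and> w1 = w2" using A S'(3) by metis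
    qed
    ultimately show "\<exists>N. openin ED_W N \<and> x \<in> N \<and> inj_on (\<lambda>x. \<pi> (fst x)) N"
      using x S(2) S'(2) by (intro exI[of _ ?N]) auto
  qed
  ultimately have "homeomorphic_map D ED_W f"
    using f by (intro bijective_open_imp_homeomorphic_map)
  then obtain \<Gamma> where "homeomorphic_maps D ED_W f \<Gamma>" using homeomorphic_map_maps by blast
  then have "continuous_map ED_W D \<Gamma>" "\<And>x. x \<in> topspace ED_W \<Longrightarrow> f (\<Gamma> x) = x"
    by (auto simp: homeomorphic_maps_def)
  then show thesis using \<delta> P by (intro that[of \<delta> P \<Gamma>]) (auto simp: f_def)
qed

section \<open>Local contractions and sections of the covering\<close>

text \<open>Over an evenly covered set \<open>V\<close> with section \<open>j\<close> of \<open>cW\<close>, a point \<open>e\<close> corresponds to the point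
  \<open>\<Gamma> (e, j (q e))\<close> of \<open>D\<close>, and the contraction of \<open>D\<close> moves \<open>e\<close> to a fixed point of \<open>E\<close>.  This is not
  vertical, so every position is carried back to the fibre of \<open>e\<close>, by lifting to \<open>E\<close> the projection of
  a path in \<open>W\<close> from the position \<open>b\<close> below it to \<open>w = j (q e)\<close>: from \<open>b\<close> along the contraction of
  \<open>W\<close> to its end point and back along the contraction to \<open>w\<close>.  At the start \<open>b = w\<close>, and cutting
  that path off shrinks it to the constant path; this makes up the part of the deformation with
  \<open>u \<le> 1\<close>.  All these paths are lifted at once, over the space of the data \<open>(x, ((b, w), u))\<close> that
  determine them, so that the result at the end depends on \<open>w\<close> only.\<close>

lemma local_contraction:
  assumes V: "openin Y V" "evenly_covered W Y cW V"
  shows "\<exists>k \<sigma>. continuous_map (prod_topology (subtopology E {e \<in> topspace E. q e \<in> V}) unit_interval) E k \<and>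
    continuous_map (subtopology Y V) E \<sigma> \<and>
    (\<forall>e\<in>topspace E. q e \<in> V \<longrightarrow> k (e, 0) = e \<and> k (e, 1) = \<sigma> (q e) \<and> (\<forall>t\<in>{0..1}. q (k (e, t)) = q e))"
proof -
  have cW: "continuous_map W Y cW" "cW ` topspace W = topspace Y" using covering_projectionD[OF W(1)] by auto
  obtain j where j: "continuous_map (subtopology Y V) W j" "\<And>y. y \<in> V \<Longrightarrow> cW (j y) = y"
    by (rule evenly_covered_section[OF V(2,1) cW(2)]) blast
  have jW: "j y \<in> topspace W" if "y \<in> V" for y
    using j(1) that openin_subset[OF V(1)] by (auto simp: continuous_map_def)
  obtain \<delta> P \<Gamma> where \<delta>: "continuous_map D E \<delta>" and P: "continuous_map D W P"
    and qP: "\<And>z. z \<in> topspace D \<Longrightarrow> q (\<delta> z) = cW (P z)"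
    and \<Gamma>: "continuous_map ED_W D \<Gamma>"
      "\<And>e w. (e, w) \<in> topspace ED_W \<Longrightarrow> \<delta> (\<Gamma> (e, w)) = e \<and> P (\<Gamma> (e, w)) = w"
    by (rule contractible_fibre_product) blast
  have "topspace W \<noteq> {}" using w0_ex by blast
  then obtain w1 kW where kW: "w1 \<in> topspace W" "continuous_map (prod_topology W unit_interval) W kW"
    "\<And>w. kW (w, 0) = w" "\<And>w. kW (w, 1) = w1"
    using contractible_spaceE[OF W(2)] by blast
  have "topspace D \<noteq> {}"
    using covering_projectionD(2)[OF D(1)] continuous_map_image_subset_topspace[OF \<pi>_cont] e0 by blast
  then obtain d1 kD where kD: "d1 \<in> topspace D" "continuous_map (prod_topology D unit_interval) D kD"
    "\<And>z. kD (z, 0) = z" "\<And>z. kD (z, 1) = d1"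
    using contractible_spaceE[OF D(2)] by blast
  define T where "T = subtopology
    (prod_topology E (prod_topology (prod_topology W W) (top_of_set {0..2::real})))
    {(x, ((b, w), u)). q x = cW b \<and> (u \<le> 1 \<longrightarrow> b = w)}"
  have T: "(x, ((b, w), u)) \<in> topspace T \<longleftrightarrow> x \<in> topspace E \<and> b \<in> topspace W \<and> w \<in> topspace W \<and>
      u \<in> {0..2} \<and> q x = cW b \<and> (u \<le> 1 \<longrightarrow> b = w)" for x b w u
    by (auto simp: T_def)
  have into_T: "continuous_map Z T (\<lambda>z. (x z, ((b z, w z), u z)))"
    if "continuous_map Z E x" "continuous_map Z W b" "continuous_map Z W w" "continuous_map Z euclideanreal u"
      "\<And>z. z \<in> topspace Z \<Longrightarrow> u z \<in> {0..2} \<and> q (x z) = cW (b z) \<and> (u z \<le> 1 \<longrightarrow> b z = w z)"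
    for Z :: "'z topology" and x b w u
    unfolding T_def continuous_map_in_subtopology
    using that by (auto intro!: continuous_map_pairedI simp: continuous_map_in_subtopology)
  let ?TI = "prod_topology T unit_interval"
  define h where "h = (\<lambda>((x :: 'e, ((b, w), u)), t). cW (if t \<le> 1/2 then kW (b, min 1 u * (2 * t))
      else kW (w, min 1 u * (2 - 2 * t))))"
  have h: "continuous_map ?TI Y h"
  proof -
    have x: "continuous_map T E fst" and r: "continuous_map T (prod_topology (prod_topology W W) (top_of_set {0..2})) snd"
      unfolding T_def by (rule continuous_map_from_subtopology[OF continuous_map_fst],
          rule continuous_map_from_subtopology[OF continuous_map_snd])
    have bw: "continuous_map ?TI (prod_topology W W) (\<lambda>p. fst (snd (fst p)))"
      by (rule continuous_map_comp[OF continuous_map_comp[OF continuous_map_fst r] continuous_map_fst])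
    have b: "continuous_map ?TI W (\<lambda>p. fst (fst (snd (fst p))))"
      and w: "continuous_map ?TI W (\<lambda>p. snd (fst (snd (fst p))))"
      by (rule continuous_map_comp[OF bw continuous_map_fst], rule continuous_map_comp[OF bw continuous_map_snd])
    have u: "continuous_map ?TI euclideanreal (\<lambda>p. snd (snd (fst p)))"
      by (rule continuous_map_top_of_set_real[OF continuous_map_comp[OF continuous_map_comp[OF continuous_map_fst r]
              continuous_map_snd]])
    have t: "continuous_map ?TI euclideanreal snd"
      by (rule continuous_map_top_of_set_real[OF continuous_map_snd])
    have range: "snd (snd (fst p)) \<in> {0..2} \<and> snd p \<in> {0..1}" if "p \<in> topspace ?TI" for p
      using that by (auto simp: T_def)
    let ?A = "subtopology ?TI {p \<in> topspace ?TI. snd p \<le> 1/2}"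
    let ?B = "subtopology ?TI {p \<in> topspace ?TI. 1/2 \<le> snd p}"
    have "continuous_map ?TI W (\<lambda>p. if snd p \<le> 1/2
        then kW (fst (fst (snd (fst p))), min 1 (snd (snd (fst p))) * (2 * snd p))
        else kW (snd (fst (snd (fst p))), min 1 (snd (snd (fst p))) * (2 - 2 * snd p)))"
    proof (rule continuous_map_cases_le[OF t continuous_map_canonical_const])
      have "continuous_map ?A unit_interval (\<lambda>p. min 1 (snd (snd (fst p))) * (2 * snd p))"
      proof (rule continuous_map_unit_intervalI)
        show "continuous_map ?A euclideanreal (\<lambda>p. min 1 (snd (snd (fst p))) * (2 * snd p))"
          by (rule continuous_map_from_subtopology)
            (intro continuous_map_real_mult continuous_map_real_min continuous_map_canonical_const u t)
        show "0 \<le> min 1 (snd (snd (fst p))) * (2 * snd p) \<and> min 1 (snd (snd (fst p))) * (2 * snd p) \<le> 1"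
          if "p \<in> topspace ?A" for p
        proof -
          have p: "p \<in> topspace ?TI" "snd p \<le> 1/2" using that by (simp_all add: topspace_subtopology)
          then show ?thesis
            using range[OF p(1)] by (intro conjI[OF mult_nonneg_nonneg mult_le_one]) auto
        qed
      qed
      then show "continuous_map ?A W (\<lambda>p. kW (fst (fst (snd (fst p))), min 1 (snd (snd (fst p))) * (2 * snd p)))"
        by (intro continuous_map_comp[OF _ kW(2)] continuous_map_pairedI continuous_map_from_subtopology[OF b])
      have "continuous_map ?B unit_interval (\<lambda>p. min 1 (snd (snd (fst p))) * (2 - 2 * snd p))"
      proof (rule continuous_map_unit_intervalI)
        show "continuous_map ?B euclideanreal (\<lambda>p. min 1 (snd (snd (fst p))) * (2 - 2 * snd p))"
          by (rule continuous_map_from_subtopology)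
            (intro continuous_map_real_mult continuous_map_real_min continuous_map_diff continuous_map_canonical_const u t)
        show "0 \<le> min 1 (snd (snd (fst p))) * (2 - 2 * snd p) \<and> min 1 (snd (snd (fst p))) * (2 - 2 * snd p) \<le> 1"
          if "p \<in> topspace ?B" for p
        proof -
          have p: "p \<in> topspace ?TI" "1/2 \<le> snd p" using that by (simp_all add: topspace_subtopology)
          then show ?thesis
            using range[OF p(1)] by (intro conjI[OF mult_nonneg_nonneg mult_le_one]) auto
        qed
      qed
      then show "continuous_map ?B W (\<lambda>p. kW (snd (fst (snd (fst p))), min 1 (snd (snd (fst p))) * (2 - 2 * snd p)))"
        by (intro continuous_map_comp[OF _ kW(2)] continuous_map_pairedI continuous_map_from_subtopology[OF w])
      show "kW (fst (fst (snd (fst p))), min 1 (snd (snd (fst p))) * (2 * snd p)) =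
          kW (snd (fst (snd (fst p))), min 1 (snd (snd (fst p))) * (2 - 2 * snd p))"
        if p: "p \<in> topspace ?TI" "snd p = 1/2" for p
      proof -
        obtain x b w u t where p': "p = ((x, ((b, w), u)), t)" by (metis surj_pair)
        then have "u \<le> 1 \<longrightarrow> b = w" using p(1) T by simp
        moreover have "p = ((x, ((b, w), u)), 1/2)" using p(2) p' by simp
        ultimately show ?thesis using kW(4) by (cases "u \<le> 1") simp_all
      qed
    qed
    from continuous_map_comp[OF this cW(1)] show ?thesis
      by (rule continuous_map_eq) (auto simp: h_def)
  qed
  have "continuous_map T E fst"
    unfolding T_def by (rule continuous_map_from_subtopology[OF continuous_map_fst])
  then obtain H where H: "continuous_map ?TI E H" "\<And>z. z \<in> topspace T \<Longrightarrow> H (z, 0) = fst z"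
    "\<And>z t. z \<in> topspace T \<Longrightarrow> t \<in> {0..1} \<Longrightarrow> q (H (z, t)) = h (z, t)"
  proof (rule q_lift[OF _ h])
    show "h (z, 0) = q (fst z)" if "z \<in> topspace T" for z
    proof -
      obtain x b w u where z: "z = (x, ((b, w), u))" by (metis surj_pair)
      then show ?thesis using that T kW(3) by (simp add: h_def)
    qed
  qed blast
  let ?EV = "subtopology E {e \<in> topspace E. q e \<in> V}"
  let ?EI = "prod_topology ?EV unit_interval"
  define g where "g = (\<lambda>e. \<Gamma> (e, j (q e)))"
  have EDW: "(e, j (q e)) \<in> topspace ED_W" if "e \<in> topspace E" "q e \<in> V" for e
    using that j(2) jW by (simp add: ED_W_def)
  have jq: "continuous_map ?EV W (\<lambda>e. j (q e))"
    by (rule continuous_map_comp[OF _ j(1)])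
      (auto simp: continuous_map_in_subtopology continuous_map_from_subtopology[OF q_cont])
  have "continuous_map ?EV ED_W (\<lambda>e. (e, j (q e)))"
    unfolding ED_W_def continuous_map_in_subtopology
    using jq j(2) continuous_map_id_subt[of E] by (auto intro!: continuous_map_pairedI simp: id_def)
  then have g: "continuous_map ?EV D g" unfolding g_def by (rule continuous_map_comp[OF _ \<Gamma>(1)])
  have gD: "g e \<in> topspace D" "\<delta> (g e) = e" "P (g e) = j (q e)" if "e \<in> topspace E" "q e \<in> V" for e
    using g that \<Gamma>(2)[OF EDW[OF that]] by (auto simp: continuous_map_def g_def)
  \<comment> \<open>The first third of the vertical homotopy runs along the lifts of the constant paths, which may move;
    the rest runs through the ends of the lifts, with the parameter \<open>u = 3 t - 1\<close>, and \<open>D\<close> is contracted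
    for \<open>u \<ge> 1\<close> only.\<close>
  define z where "z = (\<lambda>(e, t). kD (g e, max 0 (max 0 (3 * t - 1) - 1)))"
  define k where "k = (\<lambda>(e, t). H ((\<delta> (z (e, t)), ((P (z (e, t)), j (q e)), max 0 (3 * t - 1))), min 1 (3 * t)))"
  define \<sigma> where "\<sigma> = (\<lambda>y. H ((\<delta> d1, ((P d1, j y), 2)), 1))"
  have EI: "continuous_map ?EI euclideanreal snd"
    by (rule continuous_map_top_of_set_real[OF continuous_map_snd])
  have "continuous_map ?EI D (\<lambda>p. kD (g (fst p), max 0 (max 0 (3 * snd p - 1) - 1)))"
    by (intro continuous_map_comp[OF _ kD(2)] continuous_map_pairedI continuous_map_comp[OF continuous_map_fst g]
        continuous_map_unit_intervalI continuous_map_real_max continuous_map_diff continuous_map_real_mult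
        continuous_map_canonical_const EI) auto
  then have z: "continuous_map ?EI D z"
    by (rule continuous_map_eq) (auto simp: z_def)
  have zD: "z (e, t) \<in> topspace D" if "e \<in> topspace E" "q e \<in> V" "t \<in> {0..1}" for e t
    using z that by (auto simp: continuous_map_def Pi_iff)
  have zT: "(\<delta> (z (e, t)), ((P (z (e, t)), j (q e)), max 0 (3 * t - 1))) \<in> topspace T"
    if "e \<in> topspace E" "q e \<in> V" "t \<in> {0..1}" for e t
  proof -
    have "P (z (e, t)) = j (q e)" if "max 0 (3 * t - 1) \<le> 1"
      using that kD(3) gD(3)[OF \<open>e \<in> topspace E\<close> \<open>q e \<in> V\<close>] by (simp add: z_def)
    then show ?thesis
      unfolding T using zD[OF that] qP[OF zD[OF that]] that jW \<delta> P by (auto simp: continuous_map_def)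
  qed
  have "continuous_map ?EI T (\<lambda>p. (\<delta> (z p), ((P (z p), j (q (fst p))), max 0 (3 * snd p - 1))))"
  proof (rule into_T)
    fix p assume p: "p \<in> topspace ?EI"
    then obtain e t where et: "p = (e, t)" "e \<in> topspace E" "q e \<in> V" "t \<in> {0..1}" by (cases p) auto
    show "max 0 (3 * snd p - 1) \<in> {0..2} \<and> q (\<delta> (z p)) = cW (P (z p)) \<and>
        (max 0 (3 * snd p - 1) \<le> 1 \<longrightarrow> P (z p) = j (q (fst p)))"
      using zT[OF et(2-4)] unfolding T et(1) by simp
  qed (intro continuous_map_comp[OF z \<delta>] continuous_map_comp[OF z P] continuous_map_comp[OF continuous_map_fst jq]
      continuous_map_real_max continuous_map_diff continuous_map_real_mult continuous_map_canonical_const EI)+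
  moreover have "continuous_map ?EI unit_interval (\<lambda>p. min 1 (3 * snd p))"
    by (intro continuous_map_unit_intervalI continuous_map_real_min continuous_map_real_mult
        continuous_map_canonical_const EI) auto
  ultimately have "continuous_map ?EI E
      (\<lambda>p. H ((\<delta> (z p), ((P (z p), j (q (fst p))), max 0 (3 * snd p - 1))), min 1 (3 * snd p)))"
    by (intro continuous_map_comp[OF _ H(1)] continuous_map_pairedI)
  then have k: "continuous_map ?EI E k"
    by (rule continuous_map_eq) (auto simp: k_def)
  have \<sigma>: "continuous_map (subtopology Y V) E \<sigma>"
  proof -
    have "continuous_map (subtopology Y V) T (\<lambda>y. (\<delta> d1, ((P d1, j y), 2)))"
      by (rule into_T)
        (use kD(1) \<delta> P j(1) qP in \<open>auto simp: continuous_map_def[of D]\<close>)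
    then show ?thesis
      unfolding \<sigma>_def by (intro continuous_map_comp[OF _ H(1)] continuous_map_pairedI) auto
  qed
  have "k (e, 0) = e \<and> k (e, 1) = \<sigma> (q e) \<and> (\<forall>t\<in>{0..1}. q (k (e, t)) = q e)"
    if e: "e \<in> topspace E" "q e \<in> V" for e
  proof (intro conjI ballI)
    show "k (e, 0) = e"
      using H(2)[OF zT[OF e, of 0]] kD(3) gD[OF e] by (simp add: k_def z_def)
    show "k (e, 1) = \<sigma> (q e)"
      using kD(4) by (simp add: k_def z_def \<sigma>_def)
    fix t :: real assume t: "t \<in> {0..1}"
    have "q (k (e, t)) = h ((\<delta> (z (e, t)), ((P (z (e, t)), j (q e)), max 0 (3 * t - 1))), min 1 (3 * t))"
      using H(3)[OF zT[OF e t], of "min 1 (3 * t)"] t by (simp add: k_def)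
    also have "\<dots> = cW (j (q e))"
    proof (cases "3 * t \<le> 1")
      case True
      then show ?thesis using kD(3) kW(3) gD[OF e] by (simp add: h_def z_def)
    next
      case False
      then show ?thesis using kW(3) by (simp add: h_def)
    qed
    finally show "q (k (e, t)) = q e" using j(2) e by simp
  qed
  then show ?thesis using k \<sigma> by blast
qed

text \<open>The partition of unity that belongs to the covering \<open>W\<close> consists of functions whose cozero sets are
  evenly covered, so that the local contractions over them can be glued.\<close>

lemma vertically_homotopic:
  fixes Z :: "'z topology"
  assumes num: "numerable_covering W Y cW"
    and f: "continuous_map Z E f0" "continuous_map Z E f1" "\<And>z. z \<in> topspace Z \<Longrightarrow> q (f0 z) = q (f1 z)"
  obtains M where "continuous_map (prod_topology Z unit_interval) E M"
    "\<And>z. z \<in> topspace Z \<Longrightarrow> M (z, 0) = f0 z" "\<And>z. z \<in> topspace Z \<Longrightarrow> M (z, 1) = f1 z"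
    "\<And>z t. z \<in> topspace Z \<Longrightarrow> t \<in> {0..1} \<Longrightarrow> q (M (z, t)) = q (f0 z)"
proof -
  obtain \<U> :: "('y \<Rightarrow> real) set" where
    "(\<forall>u\<in>\<U>. continuous_map Y euclideanreal u \<and> (\<forall>x\<in>topspace Y. 0 \<le> u x)) \<and>
     (\<forall>x\<in>topspace Y. \<exists>V. openin Y V \<and> x \<in> V \<and> finite {u\<in>\<U>. \<exists>y\<in>V. u y \<noteq> 0}) \<and>
     (\<forall>x\<in>topspace Y. (\<Sum>u | u \<in> \<U> \<and> u x \<noteq> 0. u x) = 1) \<and>
     (\<forall>u\<in>\<U>. evenly_covered W Y cW {x\<in>topspace Y. u x \<noteq> 0})"
    using num[unfolded numerable_covering_def, THEN conjunct2] ..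
  then have \<U>: "\<forall>u\<in>\<U>. continuous_map Y euclideanreal u \<and> (\<forall>x\<in>topspace Y. 0 \<le> u x)"
    "\<forall>x\<in>topspace Y. \<exists>V. openin Y V \<and> x \<in> V \<and> finite {u\<in>\<U>. \<exists>y\<in>V. u y \<noteq> 0}"
    "\<forall>x\<in>topspace Y. (\<Sum>u | u \<in> \<U> \<and> u x \<noteq> 0. u x) = 1"
    "\<forall>u\<in>\<U>. evenly_covered W Y cW {x\<in>topspace Y. u x \<noteq> 0}" by simp_all
  define V where "V = (\<lambda>u :: 'y \<Rightarrow> real. {y \<in> topspace Y. u y \<noteq> 0})"
  have V: "openin Y (V u)" "evenly_covered W Y cW (V u)" if "u \<in> \<U>" for u
  proof -
    have "continuous_map Y euclideanreal u" using \<U>(1) that by blast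
    from openin_continuous_map_preimage[OF this, of "- {0}"] show "openin Y (V u)" by (simp add: V_def open_Compl)
    show "evenly_covered W Y cW (V u)" using \<U>(4) that by (simp add: V_def)
  qed
  define contracts where "contracts = (\<lambda>u k \<sigma>.
    continuous_map (prod_topology (subtopology E {e \<in> topspace E. q e \<in> V u}) unit_interval) E k \<and>
    continuous_map (subtopology Y (V u)) E \<sigma> \<and>
    (\<forall>e\<in>topspace E. q e \<in> V u \<longrightarrow> k (e, 0) = e \<and> k (e, 1) = \<sigma> (q e) \<and> (\<forall>t\<in>{0..1}. q (k (e, t)) = q e)))"
  have "\<forall>u\<in>\<U>. \<exists>k \<sigma>. contracts u k \<sigma>"
    using local_contraction[OF V] unfolding contracts_def by blast
  then obtain k \<sigma> where k\<sigma>: "\<And>u. u \<in> \<U> \<Longrightarrow> contracts u (k u) (\<sigma> u)" by metis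
  interpret local_contractions E Y q \<U> V k \<sigma>
    using V(1) k\<sigma> q_cont unfolding contracts_def by unfold_locales auto
  show thesis
    by (rule vertical_homotopy[of "\<lambda>u. u" Z f0 f1]) (use \<U> f that in \<open>auto simp: V_def\<close>)
qed

text \<open>Over each open set, a section of the evaluation of fibrewise paths is turned into a section of \<open>\<pi>\<close> by
  lifting these paths from the lifted section, and a section of \<open>\<pi>\<close> into one of the evaluation by a
  vertical homotopy from the lifted section to it.\<close>

theorem parametrized_cat_eq_secat:
  assumes num: "numerable_covering W Y cW"
  shows "parametrized_cat X Bp Bs = secat E X \<pi>"
proof -
  let ?P = "fibrewise_path_space X Bp Bs"
  obtain \<tau> where \<tau>: "continuous_map Y E \<tau>" "\<tau> (q e0) = e0" "\<And>y. y \<in> topspace Y \<Longrightarrow> \<pi> (\<tau> y) = Bs y"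
    by (rule section_lift) blast
  have BpY: "Bp x \<in> topspace Y" if "x \<in> topspace X" for x using Bp_cont that by (auto simp: continuous_map_def)
  have "(\<exists>\<sigma>. continuous_map (subtopology X U) ?P \<sigma> \<and> (\<forall>y\<in>U. \<sigma> y 1 = y)) \<longleftrightarrow>
      (\<exists>\<sigma>. continuous_map (subtopology X U) E \<sigma> \<and> (\<forall>y\<in>U. \<pi> (\<sigma> y) = y))" if U: "openin X U" for U
  proof
    have sub: "U \<subseteq> topspace X" using U by (rule openin_subset)
    have \<tau>Bp: "continuous_map (subtopology X U) E (\<lambda>u. \<tau> (Bp u))"
      by (rule continuous_map_comp[OF continuous_map_from_subtopology[OF Bp_cont] \<tau>(1)])
    {
      assume "\<exists>\<sigma>. continuous_map (subtopology X U) ?P \<sigma> \<and> (\<forall>y\<in>U. \<sigma> y 1 = y)"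
      then obtain \<sigma> where \<sigma>: "continuous_map (subtopology X U) ?P \<sigma>" "\<And>y. y \<in> U \<Longrightarrow> \<sigma> y 1 = y" by blast
      have "continuous_map (subtopology X U) (mapping_space unit_interval X) \<sigma>"
        using \<sigma>(1) by (simp add: fibrewise_path_space_def continuous_map_in_subtopology)
      note h = continuous_map_uncurry[OF this]
      have start: "\<sigma> u 0 = Bs (Bp u)" if "u \<in> U" for u
      proof -
        have "\<sigma> u \<in> topspace ?P" using \<sigma>(1) that sub by (auto simp: continuous_map_def)
        then have "\<exists>b. \<forall>t\<in>{0..1}. Bp (\<sigma> u t) = b" and s0: "\<sigma> u 0 = Bs (Bp (\<sigma> u 0))"
          by (simp_all add: fibrewise_path_space_def)
        from this(1) have "Bp (\<sigma> u 0) = Bp (\<sigma> u 1)"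
          by (metis atLeastAtMost_iff order_refl zero_le_one)
        then show ?thesis using s0 \<sigma>(2)[OF that] by simp
      qed
      obtain H where H: "continuous_map (prod_topology (subtopology X U) unit_interval) E H"
        "\<And>u t. u \<in> topspace (subtopology X U) \<Longrightarrow> t \<in> {0..1} \<Longrightarrow> \<pi> (H (u, t)) = (case (u, t) of (z, t) \<Rightarrow> \<sigma> z t)"
        by (rule covering_homotopy_lift[OF E h \<tau>Bp]) (use start \<tau>(3) BpY in auto)
      have "continuous_map (subtopology X U) E (\<lambda>u. H (u, 1))"
        by (rule continuous_map_comp[OF _ H(1)]) (auto intro!: continuous_map_pairedI)
      moreover have "\<pi> (H (u, 1)) = u" if "u \<in> U" for u
        using H(2)[of u 1] \<sigma>(2)[OF that] that sub by auto
      ultimately show "\<exists>\<sigma>. continuous_map (subtopology X U) E \<sigma> \<and> (\<forall>y\<in>U. \<pi> (\<sigma> y) = y)" by blast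
    }
    {
      assume "\<exists>\<sigma>. continuous_map (subtopology X U) E \<sigma> \<and> (\<forall>y\<in>U. \<pi> (\<sigma> y) = y)"
      then obtain \<sigma> where \<sigma>: "continuous_map (subtopology X U) E \<sigma>" "\<And>y. y \<in> U \<Longrightarrow> \<pi> (\<sigma> y) = y" by blast
      have eq: "q (\<tau> (Bp u)) = Bp u" "q (\<sigma> u) = Bp u" if "u \<in> U" for u
        using that sub \<tau>(3) BpY Bp_Bs \<sigma>(2) by (auto simp: q_def)
      obtain M where M: "continuous_map (prod_topology (subtopology X U) unit_interval) E M"
        "\<And>u. u \<in> topspace (subtopology X U) \<Longrightarrow> M (u, 0) = \<tau> (Bp u)"
        "\<And>u. u \<in> topspace (subtopology X U) \<Longrightarrow> M (u, 1) = \<sigma> u"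
        "\<And>u t. u \<in> topspace (subtopology X U) \<Longrightarrow> t \<in> {0..1} \<Longrightarrow> q (M (u, t)) = q (\<tau> (Bp u))"
        by (rule vertically_homotopic[OF num \<tau>Bp \<sigma>(1)]) (use eq in auto)
      define \<alpha> where "\<alpha> = (\<lambda>u. \<lambda>t\<in>{0..1}. \<pi> (M (u, t)))"
      have "continuous_map (subtopology X U) (mapping_space unit_interval X) \<alpha>"
        unfolding \<alpha>_def by (rule continuous_map_curry[OF continuous_map_comp[OF M(1) \<pi>_cont]])
      moreover have "(\<exists>b. \<forall>t\<in>{0..1}. Bp (\<alpha> u t) = b) \<and> \<alpha> u 0 = Bs (Bp (\<alpha> u 0))" if "u \<in> U" for u
      proof -
        have u: "u \<in> topspace (subtopology X U)" using that sub by auto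
        have vert: "Bp (\<alpha> u t) = Bp u" if "t \<in> {0..1}" for t
          using M(4)[OF u that] eq(1)[OF \<open>u \<in> U\<close>] that by (simp add: \<alpha>_def q_def)
        have "\<alpha> u 0 = Bs (Bp u)"
          using M(2)[OF u] \<tau>(3) BpY sub that by (auto simp: \<alpha>_def)
        moreover have "Bp (\<alpha> u 0) = Bp u" by (rule vert) simp
        ultimately have "\<alpha> u 0 = Bs (Bp (\<alpha> u 0))" by simp
        then show ?thesis using vert by blast
      qed
      ultimately have "continuous_map (subtopology X U) ?P \<alpha>"
        by (auto simp: fibrewise_path_space_def continuous_map_in_subtopology)
      moreover have "\<alpha> u 1 = u" if "u \<in> U" for u
        using M(3)[of u] \<sigma>(2)[OF that] that sub by (auto simp: \<alpha>_def)
      ultimately show "\<exists>\<sigma>. continuous_map (subtopology X U) ?P \<sigma> \<and> (\<forall>y\<in>U. \<sigma> y 1 = y)" by blast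
    }
  qed
  then show ?thesis
    unfolding parametrized_cat_def secat_def
    by (intro arg_cong[where f = Inf] Collect_cong ex_cong1 conj_cong refl) blast+
qed

end

section \<open>The complexity of a derivation\<close>

text \<open>The image \<open>L\<close> of the splitting enters the second claim through two properties: it contains the
  classes of the loops of the section, and the projection to \<open>G\<close> is injective on it.\<close>

theorem theorem3p9:
  fixes K :: "('k, 'm) monoid_scheme" and G :: "('g, 'n) monoid_scheme"
    and a :: "'g \<Rightarrow> 'k \<Rightarrow> 'k" and d :: "'g \<Rightarrow> 'k"
    and X :: "'x topology" and x0 :: 'x and \<theta> :: "(real \<Rightarrow> 'x) set \<Rightarrow> 'k \<times> 'g"
    and Y :: "'y topology" and y0 :: 'y and \<eta> :: "(real \<Rightarrow> 'y) set \<Rightarrow> 'g"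
    and Bp :: "'x \<Rightarrow> 'y" and Bs :: "'y \<Rightarrow> 'x"
    and E :: "'e topology" and \<pi> :: "'e \<Rightarrow> 'x"
  assumes "group K" and "group G"
    and "a \<in> hom G (AutoGroup K)"
    and "derivation K G a d"
    and "classifying_fibration K G a d X x0 \<theta> Y y0 \<eta> Bp Bs"
    and "covering_determined_by X x0 \<theta> (splitting d ` carrier G) E \<pi>"
  shows "group_action (semidirect_product K G a) (carrier K) (derivation_action K a d) \<and>
         (\<exists>\<phi>. bij_betw \<phi> {e \<in> topspace E. \<pi> e = x0} (carrier K) \<and>
             (\<forall>A\<in>carrier (fundamental_group X x0). \<forall>e\<in>{e \<in> topspace E. \<pi> e = x0}.
                \<phi> (monodromy E \<pi> A e) = derivation_action K a d (\<theta> A) (\<phi> e))) \<and>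
         tc X Bp Bs = secat E X \<pi>"
proof -
  interpret group_derivation K G a d
    using assms(1-4) by (simp add: group_derivation_def group_derivation_axioms_def)
  have X: "classifying_space SD X x0 \<theta>" and Y: "classifying_space G Y y0 \<eta>"
    and Bp: "classifying_map X x0 \<theta> Y y0 \<eta> snd Bp"
    and Bs: "classifying_map Y y0 \<eta> X x0 \<theta> (splitting d) Bs"
    and fib: "hurewicz_fibration X Y Bp" and sec: "\<And>y. y \<in> topspace Y \<Longrightarrow> Bp (Bs y) = y"
    using assms(5) by (simp_all add: classifying_fibration_def)
  interpret PX: pi1_identification SD X x0 \<theta>
    using X by unfold_locales (auto simp: classifying_space_def)
  interpret PY: pi1_identification G Y y0 \<eta>
    using Y by unfold_locales (auto simp: classifying_space_def)
  have Bp0: "continuous_map X Y Bp" "Bp x0 = y0" and Bs0: "continuous_map Y X Bs" "Bs y0 = x0"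
    using Bp Bs by (auto simp: classifying_map_def)
  have val_Bp: "PY.val (Bp \<circ> l) = snd (PX.val l)" if "l \<in> loops X x0" for l
    using Bp that pi1_map_path_class[OF Bp0(1), of l]
    by (auto simp: classifying_map_def carrier_fundamental_group PX.val_def PY.val_def loops_def)
  have val_Bs: "PX.val (Bs \<circ> l) = splitting d (PY.val l)" if "l \<in> loops Y y0" for l
    using Bs that pi1_map_path_class[OF Bs0(1), of l]
    by (auto simp: classifying_map_def carrier_fundamental_group PX.val_def PY.val_def loops_def)
  obtain D :: "(real \<Rightarrow> 'x) set topology" and cD where D: "numerable_covering D X cD" "contractible_space D"
    using X unfolding classifying_space_def by blast
  obtain W :: "(real \<Rightarrow> 'y) set topology" and cW where num: "numerable_covering W Y cW" "contractible_space W"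
    using Y unfolding classifying_space_def by blast
  have E: "covering_projection E X \<pi>" "path_connected_space E"
    using assms(6) by (auto simp: covering_determined_by_def)
  obtain e0 where e0: "e0 \<in> topspace E" "\<pi> e0 = x0"
    and L1: "\<And>l. l \<in> loops E e0 \<Longrightarrow> PX.val (\<pi> \<circ> l) \<in> splitting d ` carrier G"
    and L2: "\<And>g. g \<in> splitting d ` carrier G \<Longrightarrow> \<exists>l\<in>loops E e0. PX.val (\<pi> \<circ> l) = g"
    using assms(6) by (rule PX.covering_determined_byE) blast
  have \<pi>_loop: "\<pi> \<circ> l \<in> loops X x0" if "l \<in> loops E e0" for l
    using loops_compose[OF _ that] covering_projectionD[OF E(1)] e0(2) by metis
  interpret section_covering X Y Bp Bs E \<pi> e0 D cD W cW
  proof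
    show "\<exists>l'\<in>loops E e0. path_homotopic X (Bs \<circ> l) (\<pi> \<circ> l')" if "l \<in> loops Y (Bp (\<pi> e0))" for l
    proof -
      have l: "l \<in> loops Y y0" using that e0(2) Bp0(2) by simp
      then obtain l' where l': "l' \<in> loops E e0" "PX.val (\<pi> \<circ> l') = PX.val (Bs \<circ> l)"
        using L2[of "PX.val (Bs \<circ> l)"] val_Bs[OF l] PY.val_closed[OF l] by auto
      moreover have "Bs \<circ> l \<in> loops X x0" using loops_compose[OF Bs0(1) l] Bs0(2) by simp
      ultimately show ?thesis using PX.val_eqD[OF _ \<pi>_loop] by metis
    qed
    show "path_homotopic X (\<pi> \<circ> l) (\<lambda>_. \<pi> e0)"
      if l: "l \<in> loops E e0" and null: "path_homotopic Y (Bp \<circ> (\<pi> \<circ> l)) (\<lambda>_. Bp (\<pi> e0))" for l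
    proof -
      have "snd (PX.val (\<pi> \<circ> l)) = \<one>\<^bsub>G\<^esub>"
        using PY.val_cong[OF null] val_Bp[OF \<pi>_loop[OF l]] PY.val_const e0(2) Bp0(2) by simp
      then have "PX.val (\<pi> \<circ> l) = PX.val (\<lambda>_. x0)"
        using L1[OF l] d_one PX.val_const by (auto simp: splitting_def)
      then show ?thesis
        using PX.val_eqD[OF \<pi>_loop[OF l] loops_const[OF PX.base]] e0(2) by simp
    qed
  qed (use fib Bs0 Bp0 sec E e0 D num in \<open>auto simp: numerable_covering_def\<close>)
  have "tc X Bp Bs = secat E X \<pi>"
    unfolding tc_def by (rule parametrized_cat_eq_secat[OF num(1)])
  then show ?thesis
    using group_action_act fibre_bijection[OF PX.base PX.iso assms(6)] by blast
qed

end
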